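(* Let $\kappa\in(\mathbb{R}\setminus\{0\})\cup\{\infty\}$ and $\gamma\in\mathbb{R}$, and let $f_{\kappa,\gamma}$ be the generalized Tsallis function. Then the main branch $W_{\kappa,\gamma}$ of the Lambert--Tsallis $W$ function exists if and only if one of the following holds: (i) $0<\kappa<1$ and $\gamma\le 0$; (ii) $1\le\kappa<\infty$ and $\gamma\le\frac14\left(1+\frac1\kappa\right)^2$; (iii) $-1<\kappa<0$ and $\gamma\le\frac1\kappa$; (iv) $\kappa\le -1$ and $\gamma\le\frac14\left(1+\frac1\kappa\right)^2$; (v) $\kappa=\infty$ and $\gamma\le\frac14$.
   Context: For real $\kappa\neq 0$ let $\exp_\kappa(z)=\left(1+\frac z\kappa\right)^\kappa$, where the principal branch of the power is taken when $\kappa$ is not an integer, and let $\exp_\infty(z)=e^z$. The generalized Tsallis function is $$f_{\kappa,\gamma}(z)=\frac{z}{1+\gamma z}\exp_\kappa(z).$$ Its domain $\mathcal{D}(f_{\kappa,\gamma})$ is as follows. If $\kappa$ is an integer or $\kappa=\infty$, it is $\mathbb{C}\setminus\{-\frac1\gamma\}$ (with $z=-\kappa$ also removed if $\kappa$ is a negative integer). If $\kappa$ is real and not an integer, it is $\mathbb{C}\setminus\{x\in\mathbb{R}: 1+\frac x\kappa\le 0\text{ or }x=-\frac1\gamma\}$. When $\gamma=0$ there is no point $-\frac1\gamma$ to remove. Since $f_{\kappa,\gamma}(0)=0$ and $f'_{\kappa,\gamma}(0)=1$, $f_{\kappa,\gamma}$ has a local holomorphic inverse $w_{\kappa,\gamma}$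 near $0$ with $w_{\kappa,\gamma}(0)=0$. For $z=x+yi$ and $\kappa\ne\infty$ let $\theta(x,y)=\mathrm{Arg}\left(1+\frac z\kappa\right)\in(-\pi,\pi]$ (principal argument). If $\kappa=\infty$, the expression $\kappa\theta(x,y)$ is read as $y$. For $y\neq0$ with $\sin(\kappa\theta(x,y))\ne0$ put $$F(x,y)=(x+\gamma x^2+\gamma y^2)+y\cot(\kappa\theta(x,y)),$$ and for $y=0$ put $F(x,0)=\lim_{y\to0}F(x,y)$; in particular $F(0,0)=1$. $\Omega_{\kappa,\gamma}$ is the connected component containing $z=0$ of the open set $\{z=x+yi\in\mathcal{D}(f_{\kappa,\gamma}): F(x,y)>0\}$, where points at which $F$ is not defined are excluded. Let $\mathcal{S}=\mathbb{R}\setminus f_{\kappa,\gamma}(\Omega_{\kappa,\gamma}\cap\mathbb{R})$ and let $\overline{\mathcal S}$ be its closure. "The main branch of the Lambert--Tsallis $W$ function exists" means: there exists a unique holomorphic extension $W_{\kappa,\gamma}$ of $w_{\kappa,\gamma}$ to $\mathbb{C}\setminus\overline{\mathcal S}$. *)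

theory Defs
  imports "HOL-Complex_Analysis.Complex_Analysis" "HOL-Library.FuncSet"
begin

text \<open>
  The parameter \<open>\<kappa> \<in> (\<real> - {0}) \<union> {\<infinity>}\<close> is an \<^typ>\<open>ereal\<close> different from \<open>0\<close> and \<open>-\<infinity>\<close>;
  the values of the constants below at \<open>\<kappa> = 0\<close> and \<open>\<kappa> = -\<infinity>\<close> are irrelevant.
\<close>

definition exp_kappa :: "ereal \<Rightarrow> complex \<Rightarrow> complex" where
  "exp_kappa \<kappa> z =
     (if \<kappa> = \<infinity> then exp z
      else let k = real_of_ereal \<kappa> in
        if k \<in> \<int> then (1 + z / of_real k) powi \<lfloor>k\<rfloor>
        else (1 + z / of_real k) powr of_real k)"

definition tsallis :: "ereal \<Rightarrow> real \<Rightarrow> complex \<Rightarrow> complex" where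
  "tsallis \<kappa> \<gamma> z = z / (1 + of_real \<gamma> * z) * exp_kappa \<kappa> z"

definition pole_set :: "real \<Rightarrow> complex set" where
  "pole_set \<gamma> = (if \<gamma> = 0 then {} else {of_real (- 1 / \<gamma>)})"

definition tsallis_dom :: "ereal \<Rightarrow> real \<Rightarrow> complex set" where
  "tsallis_dom \<kappa> \<gamma> =
     (if \<kappa> = \<infinity> then UNIV
      else let k = real_of_ereal \<kappa> in
        if k \<in> \<int> then (if k < 0 then UNIV - {of_real (- k)} else UNIV)
        else UNIV - {of_real x | x. 1 + x / k \<le> 0})
     - pole_set \<gamma>"

text \<open>The angle \<open>\<kappa>\<theta>(x,y)\<close>, read as \<open>y\<close> for \<open>\<kappa> = \<infinity>\<close>.\<close>

definition kappa_theta :: "ereal \<Rightarrow> real \<Rightarrow> real \<Rightarrow> real" where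
  "kappa_theta \<kappa> x y =
     (if \<kappa> = \<infinity> then y
      else let k = real_of_ereal \<kappa> in k * Arg (1 + Complex x y / of_real k))"

text \<open>
  \<open>F(x,y)\<close> is a partial function: \<open>F_formula\<close> is the defining expression off the real axis,
  \<open>F_defined\<close> its domain of definition, \<open>F_fun\<close> its value there. On the real axis the limit is
  the one-variable limit in \<open>y\<close> with \<open>x\<close> fixed; it counts as existing only if \<open>F(x,t)\<close> is
  defined for all small \<open>t \<noteq> 0\<close>. This explicit condition is needed because \<open>cot\<close> is \<open>0\<close> where
  \<open>sin\<close> vanishes, which would otherwise assign a limit at \<open>x = -\<kappa>\<close> for even positive \<open>\<kappa>\<close>.
\<close>

definition F_formula :: "ereal \<Rightarrow> real \<Rightarrow> real \<Rightarrow> real \<Rightarrow> real" where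
  "F_formula \<kappa> \<gamma> x y = (x + \<gamma> * x\<^sup>2 + \<gamma> * y\<^sup>2) + y * cot (kappa_theta \<kappa> x y)"

definition F_defined :: "ereal \<Rightarrow> real \<Rightarrow> real \<Rightarrow> real \<Rightarrow> bool" where
  "F_defined \<kappa> \<gamma> x y \<longleftrightarrow>
     (if y \<noteq> 0 then sin (kappa_theta \<kappa> x y) \<noteq> 0
      else (\<forall>\<^sub>F t in at 0. sin (kappa_theta \<kappa> x t) \<noteq> 0) \<and>
           (\<exists>L. (F_formula \<kappa> \<gamma> x \<longlongrightarrow> L) (at 0)))"

definition F_fun :: "ereal \<Rightarrow> real \<Rightarrow> real \<Rightarrow> real \<Rightarrow> real" where
  "F_fun \<kappa> \<gamma> x y =
     (if y \<noteq> 0 then F_formula \<kappa> \<gamma> x y else Lim (at 0) (F_formula \<kappa> \<gamma> x))"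

definition Omega :: "ereal \<Rightarrow> real \<Rightarrow> complex set" where
  "Omega \<kappa> \<gamma> = connected_component_set
     {z \<in> tsallis_dom \<kappa> \<gamma>. F_defined \<kappa> \<gamma> (Re z) (Im z) \<and> F_fun \<kappa> \<gamma> (Re z) (Im z) > 0} 0"

definition slit :: "ereal \<Rightarrow> real \<Rightarrow> complex set" where
  "slit \<kappa> \<gamma> = \<real> - tsallis \<kappa> \<gamma> ` (Omega \<kappa> \<gamma> \<inter> \<real>)"

definition local_inverse :: "ereal \<Rightarrow> real \<Rightarrow> (complex \<Rightarrow> complex) \<Rightarrow> bool" where
  "local_inverse \<kappa> \<gamma> w \<longleftrightarrow>
     (\<exists>U V. open U \<and> 0 \<in> U \<and> open V \<and> 0 \<in> V \<and> V \<subseteq> tsallis_dom \<kappa> \<gamma> \<and>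
        w holomorphic_on U \<and> w 0 = 0 \<and> w ` U = V \<and> tsallis \<kappa> \<gamma> ` V = U \<and>
        (\<forall>z\<in>U. tsallis \<kappa> \<gamma> (w z) = z) \<and> (\<forall>v\<in>V. w (tsallis \<kappa> \<gamma> v) = v))"

text \<open>
  The local inverse is unique only as a germ at \<open>0\<close>, so a function on \<open>\<complex> - closure S\<close> extends it
  if both agree near \<open>0\<close>. Functions on this set are represented by total functions that are
  \<^term>\<open>undefined\<close> outside it, so that \<open>\<exists>!\<close> expresses uniqueness on the set.
\<close>

definition main_branch :: "ereal \<Rightarrow> real \<Rightarrow> (complex \<Rightarrow> complex) \<Rightarrow> bool" where
  "main_branch \<kappa> \<gamma> W \<longleftrightarrow>
     W \<in> extensional (UNIV - closure (slit \<kappa> \<gamma>)) \<and>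
     W holomorphic_on (UNIV - closure (slit \<kappa> \<gamma>)) \<and>
     (\<exists>w. local_inverse \<kappa> \<gamma> w \<and> (\<forall>\<^sub>F z in nhds 0. W z = w z))"

definition main_branch_exists :: "ereal \<Rightarrow> real \<Rightarrow> bool" where
  "main_branch_exists \<kappa> \<gamma> \<longleftrightarrow> (\<exists>!W. main_branch \<kappa> \<gamma> W)"

end

theory Submission
  imports Defs
begin

text \<open>
  Write \<open>f\<close> for the Tsallis function, \<open>u = 1 + z/\<kappa>\<close> and \<open>Q(z) = \<gamma>z\<^sup>2 + (1 + 1/\<kappa>)z + 1\<close>, so that
  \<open>f' = exp\<^sub>\<kappa> Q / ((1 + \<gamma>z)\<^sup>2 u)\<close>. The bound \<open>(1 + 1/\<kappa>)\<^sup>2/4\<close> is the value of \<open>\<gamma>\<close> beyond which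
  the zeros of \<open>Q\<close> leave the real axis.

  Sufficiency. Where \<open>Im z > 0\<close> and \<open>0 < \<kappa>\<theta> < \<pi>\<close>, the conditions \<open>F > 0\<close> and \<open>Im f > 0\<close> agree;
  let \<open>V\<close> be the set of these points. Under the conditions of the theorem \<open>f\<close> maps \<open>V\<close> properly
  to the upper half-plane: near a real point or near infinity, \<open>f\<close> tends to a real number, to \<open>0\<close>
  or to infinity, except on the cut \<open>u < 0\<close>, which is met only if \<open>\<bar>\<kappa>\<bar> < 1\<close>; there the bound on \<open>\<gamma>\<close>
  makes \<open>z/(1 + \<gamma>z)\<close> negative, which turns the boundary values into the lower half-plane. Since
  \<open>Q\<close> has no nonreal zero, \<open>f\<close> is a covering of the simply connected upper half-plane by \<open>V\<close>,
  and the identity lifts to a section \<open>g\<close> through the local inverse at \<open>0\<close>. The image of \<open>g\<close> is open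
  and closed in \<open>V\<close>, so the connected set \<open>\<Omega>\<close> stays within this image, its mirror image
  and the real points between them. At a real value that \<open>f\<close> takes on \<open>\<Omega> \<inter> \<real>\<close>, a local inverse of \<open>f\<close> therefore
  joins \<open>g\<close> to its reflection, and \<open>g\<close> extends to the complement of the closure of \<open>S\<close>. The
  lemmas are \<open>tsallis_proper_on_upper_region\<close>, \<open>tsallis_section_exists\<close>, \<open>Omega_subset_inside\<close> and
  \<open>branch_near_real\<close>.

  Necessity. In the coordinate \<open>t = log u\<close> the function becomes
  \<open>G(t) = Z/(1 + \<gamma>Z) e\<^sup>\<kappa>\<^sup>t\<close> with \<open>Z = \<kappa>(e\<^sup>t - 1)\<close>, and the cut disappears. If a main branch \<open>W\<close> exists,
  then by the identity theorem \<open>W(G(t)) = Z(t)\<close> on every connected open set that is adherent to \<open>0\<close> and on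
  which \<open>Im G > 0\<close>. This is absurd if \<open>G\<close> has a critical point there, and also if \<open>G\<close> tends to \<open>0\<close> along
  points far from \<open>0\<close>, because \<open>W(0) = 0\<close>. With \<open>r = \<bar>u\<bar>\<close> and \<open>0 < \<kappa>\<theta> < \<pi>\<close>, the sign of \<open>Im G\<close> is that of a
  quadratic polynomial in \<open>r\<close> (\<open>Im_tsallis_of_log_pos\<close>). For \<open>\<kappa> > 0\<close> and \<open>\<gamma>\<close> above the bound its discriminant
  is negative for small \<open>\<theta>\<close>, and \<open>G\<close> tends to \<open>0\<close> at the far left of a thin strip. For
  \<open>0 < \<kappa> < 1\<close> and positive \<open>\<gamma>\<close> below the bound, \<open>Q\<close> has a real zero on the cut that can be reached through points
  with \<open>Im G > 0\<close>. The substitution \<open>t \<mapsto> -t\<close> turns \<open>(\<kappa>, \<gamma>)\<close> into \<open>(-\<kappa>, \<gamma> - 1/\<kappa>)\<close> and covers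
  negative \<open>\<kappa>\<close>.
\<close>

section \<open>The Tsallis function and its derivative\<close>

text \<open>
  For \<open>\<kappa> = \<infinity>\<close> the number \<open>real_of_ereal \<kappa>\<close> is \<open>0\<close>, and division by zero yields \<open>0\<close>. Hence this is \<open>1\<close>,
  \<open>critical_poly\<close> below has the linear coefficient \<open>1\<close>, and the formulas for finite \<open>\<kappa>\<close>, such as
  \<open>exp\<^sub>\<kappa>' = exp\<^sub>\<kappa> / u\<close>, are correct for \<open>\<kappa> = \<infinity>\<close> as well.
\<close>

definition kappa_base :: "ereal \<Rightarrow> complex \<Rightarrow> complex" where
  "kappa_base \<kappa> z = 1 + z / of_real (real_of_ereal \<kappa>)"

text \<open>
  These are the points of the domain of \<open>f\<close> other than \<open>z = -\<kappa>\<close>. That point belongs to the domain if \<open>\<kappa>\<close> is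
  a positive integer with \<open>\<gamma>\<kappa> \<noteq> 1\<close>, but \<open>f\<close> need not be locally injective there.
\<close>

definition regular_at :: "ereal \<Rightarrow> real \<Rightarrow> complex \<Rightarrow> bool" where
  "regular_at \<kappa> \<gamma> z \<longleftrightarrow> 1 + of_real \<gamma> * z \<noteq> 0 \<and> kappa_base \<kappa> z \<noteq> 0 \<and>
     (\<kappa> = \<infinity> \<or> real_of_ereal \<kappa> \<in> \<int> \<or> kappa_base \<kappa> z \<notin> \<real>\<^sub>\<le>\<^sub>0)"

text \<open>
  At regular points, the zeros of this polynomial are the critical points of \<open>f\<close>; its value at a regular real point is the
  limit of \<open>F\<close> there.
\<close>

definition critical_poly :: "ereal \<Rightarrow> real \<Rightarrow> complex \<Rightarrow> complex" where
  "critical_poly \<kappa> \<gamma> z = of_real \<gamma> * z\<^sup>2 + (1 + 1 / of_real (real_of_ereal \<kappa>)) * z + 1"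

lemma ereal_cases_kappa:
  assumes "\<kappa> \<noteq> 0" "\<kappa> \<noteq> -\<infinity>"
  obtains "\<kappa> = \<infinity>" "real_of_ereal \<kappa> = 0" | k where "\<kappa> = ereal k" "k \<noteq> 0"
  using assms by (cases \<kappa>) (auto simp: zero_ereal_def)

lemma kappa_base_infinity [simp]: "kappa_base \<infinity> z = 1" by (simp add: kappa_base_def)

lemma kappa_base_cnj: "kappa_base \<kappa> (cnj z) = cnj (kappa_base \<kappa> z)"
  by (simp add: kappa_base_def)

lemma Im_kappa_base: "Im (kappa_base \<kappa> z) = Im z / real_of_ereal \<kappa>"
  by (simp add: kappa_base_def)

lemma kappa_base_of_real: "kappa_base \<kappa> (of_real x) = of_real (1 + x / real_of_ereal \<kappa>)"
  by (simp add: kappa_base_def)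

lemma isCont_kappa_base [continuous_intros]: "isCont (kappa_base \<kappa>) z"
  unfolding kappa_base_def by (cases "real_of_ereal \<kappa> = 0") (auto intro!: continuous_intros)

text \<open>
  For integer \<open>\<kappa>\<close> the power function and the principal branch agree off zero, so integer and
  other values of \<open>\<kappa>\<close> are treated together.
\<close>

lemma exp_kappa_powr:
  assumes "k \<noteq> 0" "kappa_base (ereal k) z \<noteq> 0"
  shows "exp_kappa (ereal k) z = kappa_base (ereal k) z powr of_real k"
proof (cases "k \<in> \<int>")
  case True
  then obtain n where n: "k = of_int n" by (elim Ints_cases)
  then show ?thesis using assms
    by (simp add: exp_kappa_def kappa_base_def flip: complex_powr_of_int)
next
  case False
  then show ?thesis by (simp add: exp_kappa_def kappa_base_def)
qed

lemma regular_nonreal: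
  assumes "\<kappa> \<noteq> 0" "\<kappa> \<noteq> -\<infinity>" "Im z \<noteq> 0"
  shows "regular_at \<kappa> \<gamma> z"
proof -
  have a: "1 + of_real \<gamma> * z \<noteq> 0"
  proof
    assume "1 + of_real \<gamma> * z = 0"
    then have "Re (1 + of_real \<gamma> * z) = 0" "Im (1 + of_real \<gamma> * z) = 0" by simp_all
    then show False using assms by auto
  qed
  show ?thesis using assms(1,2)
  proof (cases rule: ereal_cases_kappa)
    case 1 then show ?thesis using a by (simp add: regular_at_def)
  next
    case (2 k)
    have "Im (kappa_base \<kappa> z) \<noteq> 0" using 2 assms by (simp add: Im_kappa_base)
    then have "kappa_base \<kappa> z \<noteq> 0" "kappa_base \<kappa> z \<notin> \<real>\<^sub>\<le>\<^sub>0"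
      by (auto simp: complex_nonpos_Reals_iff)
    then show ?thesis using a by (simp add: regular_at_def)
  qed
qed

lemma exp_kappa_has_derivative:
  assumes \<kappa>: "\<kappa> \<noteq> 0" "\<kappa> \<noteq> -\<infinity>" and reg: "regular_at \<kappa> \<gamma> z"
  shows "(exp_kappa \<kappa> has_field_derivative exp_kappa \<kappa> z / kappa_base \<kappa> z) (at z)"
  using \<kappa>
proof (cases rule: ereal_cases_kappa)
  case 1
  then have "exp_kappa \<kappa> = exp" by (auto simp: exp_kappa_def)
  then show ?thesis using 1 by simp
next
  case (2 k)
  have nz: "kappa_base \<kappa> z \<noteq> 0" using reg by (simp add: regular_at_def)
  have db: "(kappa_base \<kappa> has_field_derivative 1 / of_real k) (at z)"
    unfolding kappa_base_def using 2 by (auto intro!: derivative_eq_intros)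
  show ?thesis
  proof (cases "k \<in> \<int>")
    case True
    then obtain n where n: "k = of_int n" by (elim Ints_cases)
    have eq: "exp_kappa \<kappa> = (\<lambda>w. kappa_base \<kappa> w powi n)"
      using 2 n by (auto simp: exp_kappa_def kappa_base_def)
    have "((\<lambda>w. kappa_base \<kappa> w powi n) has_field_derivative of_int n * kappa_base \<kappa> z powi (n-1) * (1 / of_real k)) (at z)"
      by (rule DERIV_power_int[OF db]) (use nz in auto)
    moreover have "of_int n * kappa_base \<kappa> z powi (n-1) * (1 / of_real k) = kappa_base \<kappa> z powi n / kappa_base \<kappa> z"
      using nz n 2 by (simp add: power_int_diff)
    ultimately show ?thesis by (simp add: eq)
  next
    case False
    then have eq: "exp_kappa \<kappa> = (\<lambda>w. kappa_base \<kappa> w powr of_real k)"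
      using 2 by (auto simp: exp_kappa_def kappa_base_def)
    have np: "kappa_base \<kappa> z \<notin> \<real>\<^sub>\<le>\<^sub>0" using reg False 2 by (auto simp: regular_at_def)
    have "((\<lambda>w. kappa_base \<kappa> w powr of_real k) has_field_derivative
       (of_real k * kappa_base \<kappa> z powr (of_real k - 1) * (1 / of_real k))) (at z)"
      by (rule DERIV_chain2[OF has_field_derivative_powr[OF np] db])
    moreover have "(of_real k * kappa_base \<kappa> z powr (of_real k - 1) * (1 / of_real k)) = kappa_base \<kappa> z powr of_real k / kappa_base \<kappa> z"
      using nz 2 by (simp add: powr_diff)
    ultimately show ?thesis by (simp add: eq)
  qed
qed

lemma critical_poly_altdef: "critical_poly \<kappa> \<gamma> z = kappa_base \<kappa> z + z * (1 + of_real \<gamma> * z)"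
  by (simp add: critical_poly_def kappa_base_def power2_eq_square algebra_simps)

lemma tsallis_has_derivative:
  assumes \<kappa>: "\<kappa> \<noteq> 0" "\<kappa> \<noteq> -\<infinity>" and reg: "regular_at \<kappa> \<gamma> z"
  shows "(tsallis \<kappa> \<gamma> has_field_derivative
           exp_kappa \<kappa> z * critical_poly \<kappa> \<gamma> z / ((1 + of_real \<gamma> * z)\<^sup>2 * kappa_base \<kappa> z)) (at z)"
proof -
  have nz: "1 + of_real \<gamma> * z \<noteq> 0" "kappa_base \<kappa> z \<noteq> 0" using reg by (auto simp: regular_at_def)
  have gen: "1 / d\<^sup>2 * e + e / b * (w / d) = e * (b + w * d) / (d\<^sup>2 * b)"
    if "d \<noteq> 0" "b \<noteq> 0" for b d e w :: complex
    using that by (simp add: field_simps power2_eq_square)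
  have q: "((\<lambda>z. z / (1 + of_real \<gamma> * z)) has_field_derivative 1 / (1 + of_real \<gamma> * z)\<^sup>2) (at z)"
    by (rule derivative_eq_intros refl nz)+ (use nz in \<open>auto simp: field_simps power2_eq_square\<close>)
  have "(tsallis \<kappa> \<gamma> has_field_derivative 1 / (1 + of_real \<gamma> * z)\<^sup>2 * exp_kappa \<kappa> z
          + exp_kappa \<kappa> z / kappa_base \<kappa> z * (z / (1 + of_real \<gamma> * z))) (at z)"
    unfolding tsallis_def by (rule DERIV_mult'[THEN DERIV_cong, OF q exp_kappa_has_derivative[OF assms]]) (simp add: mult_ac)
  moreover have "1 / (1 + of_real \<gamma> * z)\<^sup>2 * exp_kappa \<kappa> z
          + exp_kappa \<kappa> z / kappa_base \<kappa> z * (z / (1 + of_real \<gamma> * z)) =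
      exp_kappa \<kappa> z * critical_poly \<kappa> \<gamma> z / ((1 + of_real \<gamma> * z)\<^sup>2 * kappa_base \<kappa> z)"
    unfolding critical_poly_altdef using nz by (rule gen)
  ultimately show ?thesis by simp
qed

lemma exp_kappa_nonzero:
  assumes \<kappa>: "\<kappa> \<noteq> 0" "\<kappa> \<noteq> -\<infinity>" and "kappa_base \<kappa> z \<noteq> 0"
  shows "exp_kappa \<kappa> z \<noteq> 0"
  using \<kappa>
proof (cases rule: ereal_cases_kappa)
  case 1 then show ?thesis by (simp add: exp_kappa_def)
next
  case (2 k) then show ?thesis using assms by (simp add: exp_kappa_powr)
qed

lemma eventually_regular:
  assumes "regular_at \<kappa> \<gamma> z"
  shows "\<forall>\<^sub>F w in nhds z. regular_at \<kappa> \<gamma> w"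
proof -
  have 1: "\<forall>\<^sub>F w in nhds z. 1 + of_real \<gamma> * w \<noteq> 0"
    using assms unfolding regular_at_def
    by (intro tendsto_imp_eventually_ne[of _ "1 + of_real \<gamma> * z"]) (auto intro!: tendsto_intros filterlim_ident)
  have tb: "(kappa_base \<kappa> \<longlongrightarrow> kappa_base \<kappa> z) (nhds z)"
    using isCont_kappa_base[where \<kappa>=\<kappa> and z=z] by (simp add: isCont_def tendsto_at_iff_tendsto_nhds)
  have 2: "\<forall>\<^sub>F w in nhds z. kappa_base \<kappa> w \<noteq> 0"
    using assms unfolding regular_at_def by (intro tendsto_imp_eventually_ne[OF tb]) auto
  have 3: "\<forall>\<^sub>F w in nhds z. kappa_base \<kappa> w \<notin> \<real>\<^sub>\<le>\<^sub>0" if "kappa_base \<kappa> z \<notin> \<real>\<^sub>\<le>\<^sub>0"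
    using topological_tendstoD[OF tb, of "- \<real>\<^sub>\<le>\<^sub>0"] that by (simp add: open_Compl)
  show ?thesis
  proof (cases "\<kappa> = \<infinity> \<or> real_of_ereal \<kappa> \<in> \<int>")
    case True
    from 1 2 show ?thesis by eventually_elim (use True in \<open>auto simp: regular_at_def\<close>)
  next
    case False
    then have "\<forall>\<^sub>F w in nhds z. kappa_base \<kappa> w \<notin> \<real>\<^sub>\<le>\<^sub>0" using assms 3 by (auto simp: regular_at_def)
    with 1 2 show ?thesis by eventually_elim (auto simp: regular_at_def)
  qed
qed

lemma open_regular: "open {z. regular_at \<kappa> \<gamma> z}"
  unfolding open_dist using eventually_regular by (auto simp: eventually_nhds_metric)

lemma tsallis_holomorphic:
  assumes \<kappa>: "\<kappa> \<noteq> 0" "\<kappa> \<noteq> -\<infinity>" and "\<And>z. z \<in> S \<Longrightarrow> regular_at \<kappa> \<gamma> z"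
  shows "tsallis \<kappa> \<gamma> holomorphic_on S"
  unfolding holomorphic_on_def
  using tsallis_has_derivative[OF \<kappa>] assms(3) has_field_derivative_at_within field_differentiable_def by blast

lemma exp_kappa_cnj:
  assumes \<kappa>: "\<kappa> \<noteq> 0" "\<kappa> \<noteq> -\<infinity>" and reg: "regular_at \<kappa> \<gamma> z"
  shows "exp_kappa \<kappa> (cnj z) = cnj (exp_kappa \<kappa> z)"
  using \<kappa>
proof (cases rule: ereal_cases_kappa)
  case 1 then show ?thesis by (simp add: exp_kappa_def exp_cnj)
next
  case (2 k)
  show ?thesis
  proof (cases "k \<in> \<int>")
    case True
    then show ?thesis using 2 by (simp add: exp_kappa_def power_int_def)
  next
    case False
    then have eq: "exp_kappa \<kappa> = (\<lambda>w. kappa_base \<kappa> w powr of_real k)"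
      using 2 by (auto simp: exp_kappa_def kappa_base_def)
    have np: "kappa_base \<kappa> z \<notin> \<real>\<^sub>\<le>\<^sub>0" using reg False 2 by (auto simp: regular_at_def)
    then show ?thesis unfolding eq kappa_base_cnj by (subst cnj_powr) (auto simp: complex_nonpos_Reals_iff)
  qed
qed

lemma tsallis_cnj:
  assumes "\<kappa> \<noteq> 0" "\<kappa> \<noteq> -\<infinity>" "regular_at \<kappa> \<gamma> z"
  shows "tsallis \<kappa> \<gamma> (cnj z) = cnj (tsallis \<kappa> \<gamma> z)"
  using exp_kappa_cnj[OF assms] by (simp add: tsallis_def)

lemma exp_kappa_real:
  assumes "\<kappa> \<noteq> 0" "\<kappa> \<noteq> -\<infinity>" "regular_at \<kappa> \<gamma> z" "z \<in> \<real>"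
  shows "exp_kappa \<kappa> z \<in> \<real>"
  using exp_kappa_cnj[OF assms(1-3)] assms(4) by (simp add: Reals_cnj_iff)

lemma tsallis_real:
  assumes "\<kappa> \<noteq> 0" "\<kappa> \<noteq> -\<infinity>" "regular_at \<kappa> \<gamma> z" "z \<in> \<real>"
  shows "tsallis \<kappa> \<gamma> z \<in> \<real>"
  using tsallis_cnj[OF assms(1-3)] assms(4) by (simp add: Reals_cnj_iff)

lemma regular_0 [simp]: "regular_at \<kappa> \<gamma> 0"
  by (simp add: regular_at_def kappa_base_def)

lemma tsallis_0 [simp]: "tsallis \<kappa> \<gamma> 0 = 0" by (simp add: tsallis_def)

lemma mem_tsallis_dom_iff:
  assumes \<kappa>: "\<kappa> \<noteq> 0" "\<kappa> \<noteq> -\<infinity>" and "kappa_base \<kappa> z \<noteq> 0"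
  shows "z \<in> tsallis_dom \<kappa> \<gamma> \<longleftrightarrow> regular_at \<kappa> \<gamma> z"
proof -
  have p: "z \<in> pole_set \<gamma> \<longleftrightarrow> 1 + of_real \<gamma> * z = 0"
    unfolding pole_set_def
    by (auto simp: field_simps add_eq_0_iff)
  show ?thesis using \<kappa>
  proof (cases rule: ereal_cases_kappa)
    case 1
    then show ?thesis using p by (auto simp: tsallis_dom_def regular_at_def)
  next
    case (2 k)
    have "kappa_base \<kappa> z \<in> \<real>\<^sub>\<le>\<^sub>0 \<longleftrightarrow> (\<exists>x. z = of_real x \<and> 1 + x / k \<le> 0)"
    proof
      assume "kappa_base \<kappa> z \<in> \<real>\<^sub>\<le>\<^sub>0"
      then have "Im z = 0" "1 + Re z / k \<le> 0"
        using 2 by (auto simp: complex_nonpos_Reals_iff kappa_base_def)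
      then show "\<exists>x. z = of_real x \<and> 1 + x / k \<le> 0" by (metis complex_is_Real_iff of_real_Re)
    next
      assume "\<exists>x. z = of_real x \<and> 1 + x / k \<le> 0"
      then show "kappa_base \<kappa> z \<in> \<real>\<^sub>\<le>\<^sub>0"
        using 2 by (auto simp: complex_nonpos_Reals_iff kappa_base_def)
    qed
    moreover have "z \<noteq> of_real (- k)" using assms(3) 2 by (auto simp: kappa_base_def)
    ultimately show ?thesis using assms(3) 2 p
      by (auto simp: tsallis_dom_def regular_at_def Let_def)
  qed
qed

lemma kappa_theta_finite:
  "kappa_theta (ereal k) (Re z) (Im z) = k * Arg (kappa_base (ereal k) z)"
  by (simp add: kappa_theta_def kappa_base_def)

lemma kappa_theta_infinity: "kappa_theta \<infinity> x y = y"
  by (simp add: kappa_theta_def)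

lemma exp_kappa_polar:
  assumes \<kappa>: "\<kappa> \<noteq> 0" "\<kappa> \<noteq> -\<infinity>" and "kappa_base \<kappa> z \<noteq> 0"
  shows "exp_kappa \<kappa> z = of_real (cmod (exp_kappa \<kappa> z)) * cis (kappa_theta \<kappa> (Re z) (Im z))"
  using \<kappa>
proof (cases rule: ereal_cases_kappa)
  case 1 then show ?thesis by (simp add: exp_kappa_def kappa_theta_infinity exp_eq_polar norm_mult)
next
  case (2 k)
  have "exp_kappa \<kappa> z = exp (of_real k * Ln (kappa_base \<kappa> z))"
    using exp_kappa_powr[of k z] 2 assms by (simp add: powr_def)
  also have "\<dots> = of_real (exp (Re (of_real k * Ln (kappa_base \<kappa> z)))) * cis (Im (of_real k * Ln (kappa_base \<kappa> z)))"
    by (simp add: exp_eq_polar)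
  also have "exp (Re (of_real k * Ln (kappa_base \<kappa> z))) = cmod (exp_kappa \<kappa> z)"
    using \<open>exp_kappa \<kappa> z = exp (of_real k * Ln (kappa_base \<kappa> z))\<close> by (simp only: norm_exp_eq_Re)
  also have "Im (of_real k * Ln (kappa_base \<kappa> z)) = kappa_theta \<kappa> (Re z) (Im z)"
    using 2 assms by (simp add: kappa_theta_finite Arg_eq_Im_Ln)
  finally show ?thesis .
qed

lemma norm_exp_kappa:
  assumes "k \<noteq> 0" "kappa_base (ereal k) z \<noteq> 0"
  shows "cmod (exp_kappa (ereal k) z) = cmod (kappa_base (ereal k) z) powr k"
  using assms by (simp add: exp_kappa_powr norm_powr_real_powr')

lemma kappa_theta_pos:
  assumes \<kappa>: "\<kappa> \<noteq> 0" "\<kappa> \<noteq> -\<infinity>" and "Im z > 0"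
  shows "kappa_theta \<kappa> (Re z) (Im z) > 0"
  using \<kappa>
proof (cases rule: ereal_cases_kappa)
  case 1 then show ?thesis using assms by (simp add: kappa_theta_infinity)
next
  case (2 k)
  show ?thesis
  proof (cases "k > 0")
    case True
    then have "0 < Im (kappa_base \<kappa> z)" using 2 assms by (simp add: Im_kappa_base)
    then have "0 < Arg (kappa_base \<kappa> z)" by (simp add: Arg_pos_iff)
    then show ?thesis using 2 True by (simp add: kappa_theta_finite)
  next
    case False
    then have "Im (kappa_base \<kappa> z) < 0" using 2 assms by (simp add: Im_kappa_base divide_simps)
    then have "Arg (kappa_base \<kappa> z) < 0" by (simp add: Arg_neg_iff)
    then show ?thesis using 2 False by (simp add: kappa_theta_finite mult_neg_neg)
  qed
qed

lemma isCont_kappa_theta: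
  assumes \<kappa>: "\<kappa> \<noteq> 0" "\<kappa> \<noteq> -\<infinity>" and "\<kappa> = \<infinity> \<or> kappa_base \<kappa> z \<notin> \<real>\<^sub>\<le>\<^sub>0"
  shows "isCont (\<lambda>z. kappa_theta \<kappa> (Re z) (Im z)) z"
  using \<kappa>
proof (cases rule: ereal_cases_kappa)
  case 1 then show ?thesis by (simp add: kappa_theta_infinity)
next
  case (2 k)
  have "isCont (\<lambda>z. k * Arg (kappa_base \<kappa> z)) z"
    by (intro continuous_intros isCont_o2[OF isCont_kappa_base continuous_at_Arg]) (use assms 2 in auto)
  then show ?thesis using 2 by (simp add: kappa_theta_finite)
qed

lemma kappa_theta_less_pi:
  assumes "Im z > 0" "\<kappa> = ereal k" "\<bar>k\<bar> \<le> 1" "k \<noteq> 0"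
  shows "kappa_theta \<kappa> (Re z) (Im z) < pi"
proof -
  have "Im (kappa_base \<kappa> z) \<noteq> 0" using assms by (simp add: Im_kappa_base)
  then have "Arg (kappa_base \<kappa> z) \<noteq> pi" "Arg (kappa_base \<kappa> z) > -pi" "Arg (kappa_base \<kappa> z) \<le> pi"
    using Arg_bounded[of "kappa_base \<kappa> z"] by (auto simp: Arg_eq_pi)
  then have "\<bar>Arg (kappa_base \<kappa> z)\<bar> < pi" by linarith
  then have "\<bar>k\<bar> * \<bar>Arg (kappa_base \<kappa> z)\<bar> < pi" using assms(3)
    by (smt (verit) abs_ge_zero mult_left_le_one_le)
  then show ?thesis using assms(2) by (simp add: kappa_theta_finite flip: abs_mult)
qed

section \<open>Sections of proper local biholomorphisms\<close>

text \<open>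
  The neighbourhood \<open>V\<close> is obtained as a ball on which the map is injective; the inverse is then holomorphic.
\<close>

lemma holomorphic_local_inverse:
  fixes f :: "complex \<Rightarrow> complex"
  assumes "f holomorphic_on S" "open S" "x \<in> S" "deriv f x \<noteq> 0"
  obtains V h where "open V" "x \<in> V" "V \<subseteq> S" "open (f ` V)" "inj_on f V" "h holomorphic_on f ` V"
    "\<And>z. z \<in> V \<Longrightarrow> h (f z) = z"
proof -
  obtain r where r: "r > 0" "ball x r \<subseteq> S" "open (f ` ball x r)" "inj_on f (ball x r)"
    using has_complex_derivative_locally_invertible[OF assms(1,3,2,4)] by metis
  obtain h where h: "h holomorphic_on (f ` ball x r)" "\<And>z. z \<in> ball x r \<Longrightarrow> h (f z) = z"
    using holomorphic_has_inverse[OF holomorphic_on_subset[OF assms(1) r(2)] open_ball r(4)] by metis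
  show ?thesis
    by (rule that[of "ball x r" h]) (use r h in auto)
qed

text \<open>
  Properness makes the fibre over \<open>w\<close> finite, and it forces the preimage of a small disc around \<open>w\<close> into the union
  of disjoint balls around the points of the fibre. On each ball the map is injective, so the disc is evenly covered.
  Surjectivity holds because the image is open and, again by properness, closed in the connected target.
\<close>

lemma proper_local_biholomorphism_covering:
  fixes f :: "complex \<Rightarrow> complex"
  assumes "open V" and hol: "f holomorphic_on V" and "open S" and "connected S"
    and im: "f ` V \<subseteq> S" and "V \<noteq> {}"
    and dnz: "\<And>z. z \<in> V \<Longrightarrow> deriv f z \<noteq> 0"
    and proper: "\<And>z w. \<lbrakk>\<And>n::nat. z n \<in> V; (\<lambda>n. f (z n)) \<longlonglongrightarrow> w; w \<in> S\<rbrakk>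
                   \<Longrightarrow> \<exists>l\<in>V. \<exists>r. strict_mono r \<and> (z \<circ> r) \<longlonglongrightarrow> l"
  shows "covering_space V f S"
proof -
  have cont: "continuous_on V f"
    using hol holomorphic_on_imp_continuous_on by blast
  have isc: "isCont f z" if "z \<in> V" for z
    using cont \<open>open V\<close> continuous_on_eq_continuous_at that by blast
  have sublim: "\<exists>l\<in>V. \<exists>r. strict_mono r \<and> (z \<circ> r) \<longlonglongrightarrow> l \<and> f l = w"
    if z: "\<And>n::nat. z n \<in> V" and lim: "(\<lambda>n. f (z n)) \<longlonglongrightarrow> w" and w: "w \<in> S" for z w
  proof -
    obtain l r where lr: "l \<in> V" "strict_mono r" "(z \<circ> r) \<longlonglongrightarrow> l"
      using proper[OF z lim w] by blast
    have "(\<lambda>n. f ((z \<circ> r) n)) \<longlonglongrightarrow> f l"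
      using isCont_tendsto_compose[OF isc[OF lr(1)] lr(3)] .
    moreover have "(\<lambda>n. f ((z \<circ> r) n)) \<longlonglongrightarrow> w"
      using LIMSEQ_subseq_LIMSEQ[OF lim lr(2)] by (simp add: o_def)
    ultimately have "f l = w" by (rule LIMSEQ_unique)
    then show ?thesis using lr by blast
  qed
  have openim: "open (f ` W)" if "W \<subseteq> V" "open W" for W
  proof (subst open_subopen, safe)
    fix x assume x: "x \<in> W"
    have "f holomorphic_on W" "deriv f x \<noteq> 0"
      using hol that(1) holomorphic_on_subset dnz x by blast+
    from holomorphic_local_inverse[OF this(1) that(2) x this(2)]
    obtain U where "open U" "x \<in> U" "U \<subseteq> W" "open (f ` U)" by metis
    then show "\<exists>T. open T \<and> f x \<in> T \<and> T \<subseteq> f ` W" by (intro exI[of _ "f ` U"]) auto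
  qed
  have surj: "f ` V = S"
  proof -
    have "openin (top_of_set S) (f ` V)"
      using openim[of V] \<open>open V\<close> \<open>open S\<close> im by (simp add: openin_open_eq)
    moreover have "closedin (top_of_set S) (f ` V)"
      unfolding closedin_limpt
    proof (intro conjI allI impI im)
      fix w assume "w islimpt f ` V \<and> w \<in> S"
      then have w: "w \<in> S" "w islimpt f ` V" by auto
      then obtain y where y: "\<And>n::nat. y n \<in> f ` V" "y \<longlonglongrightarrow> w"
        unfolding islimpt_sequential by blast
      then have "\<forall>n. \<exists>z\<in>V. y n = f z" by blast
      then obtain z where z: "\<And>n. z n \<in> V" "\<And>n. y n = f (z n)" by metis
      then have "y = (\<lambda>n. f (z n))" by auto
      then show "w \<in> f ` V" using sublim[of z w] y z w by auto
    qed
    ultimately show ?thesis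
      using \<open>connected S\<close>[unfolded connected_clopen, rule_format, of "f ` V"] \<open>V \<noteq> {}\<close> by simp
  qed
  show ?thesis
  proof (rule covering_spaceI[OF cont surj])
    fix w assume w: "w \<in> S"
    define Fi where "Fi = {z \<in> V. f z = w}"
    have "\<forall>z\<in>Fi. \<exists>r>0. ball z r \<subseteq> V \<and> inj_on f (ball z r)"
      using has_complex_derivative_locally_injective[OF hol _ \<open>open V\<close> dnz] unfolding Fi_def
      by (metis (no_types, lifting) mem_Collect_eq)
    then obtain r0 where r0: "\<And>z. z \<in> Fi \<Longrightarrow> r0 z > 0 \<and> ball z (r0 z) \<subseteq> V \<and> inj_on f (ball z (r0 z))"
      by metis
    have "compact Fi"
      unfolding compact_def
    proof (intro allI impI)
      fix z :: "nat \<Rightarrow> complex" assume z: "\<forall>n. z n \<in> Fi"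
      then have "\<And>n. z n \<in> V" "(\<lambda>n. f (z n)) \<longlonglongrightarrow> w" by (auto simp: Fi_def)
      then obtain l r where "l \<in> V" "strict_mono r" "(z \<circ> r) \<longlonglongrightarrow> l" "f l = w"
        using sublim[of z w] w by blast
      then show "\<exists>l\<in>Fi. \<exists>r. strict_mono r \<and> (z \<circ> r) \<longlonglongrightarrow> l" by (auto simp: Fi_def)
    qed
    have "finite Fi"
    proof (rule finite_not_islimpt_in_compact[OF \<open>compact Fi\<close>, of Fi, simplified])
      fix z assume z: "z \<in> Fi"
      show "\<not> z islimpt Fi"
      proof
        assume "z islimpt Fi"
        then obtain y where "y \<in> Fi" "y \<in> ball z (r0 z)" "y \<noteq> z"
          using r0[OF z] unfolding islimpt_def by (metis centre_in_ball open_ball)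
        then show False using r0[OF z] z by (auto simp: Fi_def inj_on_def)
      qed
    qed
    have "\<exists>d>0. \<forall>z\<in>Fi. \<forall>z'\<in>Fi. z \<noteq> z' \<longrightarrow> d \<le> dist z z'"
    proof -
      define D where "D = insert 1 {dist z z' | z z'. z \<in> Fi \<and> z' \<in> Fi \<and> z \<noteq> z'}"
      have "{dist z z' | z z'. z \<in> Fi \<and> z' \<in> Fi \<and> z \<noteq> z'} \<subseteq> (\<lambda>(a,b). dist a b) ` (Fi \<times> Fi)" by auto
      then have "finite D" using \<open>finite Fi\<close> finite_subset unfolding D_def by blast
      moreover have "Min D \<in> D" using \<open>finite D\<close> by (intro Min_in) (auto simp: D_def)
      ultimately show ?thesis
        by (intro exI[of _ "Min D"]) (auto simp: D_def intro!: Min_le)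
    qed
    then obtain d where d: "d > 0" "\<And>z z'. z \<in> Fi \<Longrightarrow> z' \<in> Fi \<Longrightarrow> z \<noteq> z' \<Longrightarrow> d \<le> dist z z'" by blast
    define B where "B z = ball z (min (r0 z) (d/2))" for z
    have B: "open (B z)" "z \<in> B z" "B z \<subseteq> V" "inj_on f (B z)" if "z \<in> Fi" for z
      using r0[OF that] d unfolding B_def by (auto intro: inj_on_subset)
    have disj: "B z \<inter> B z' = {}" if "z \<in> Fi" "z' \<in> Fi" "z \<noteq> z'" for z z'
    proof (rule ccontr)
      assume "B z \<inter> B z' \<noteq> {}"
      then obtain y where "dist z y < d/2" "dist z' y < d/2" by (auto simp: B_def)
      then have "dist z z' < d" using dist_triangle2[of z z' y] by linarith
      then show False using d(2)[OF that] by simp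
    qed
    have "\<exists>e>0. ball w e \<subseteq> S \<and> V \<inter> f -` ball w e \<subseteq> (\<Union>z\<in>Fi. B z) \<and> (\<forall>z\<in>Fi. ball w e \<subseteq> f ` B z)"
    proof -
      have "\<exists>e>0. V \<inter> f -` ball w e \<subseteq> (\<Union>z\<in>Fi. B z)"
      proof (rule ccontr)
        \<comment> \<open>Otherwise a sequence outside the balls has values tending to \<open>w\<close>, and by properness it accumulates
          at a point of the fibre.\<close>
        assume "\<not> ?thesis"
        then have "\<forall>n::nat. \<exists>y. y \<in> V \<and> f y \<in> ball w (1 / real (Suc n)) \<and> y \<notin> (\<Union>z\<in>Fi. B z)"
          by (metis (mono_tags, lifting) IntE of_nat_0_less_iff subsetI vimage_eq zero_less_Suc zero_less_divide_1_iff)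
        then obtain y where y: "\<And>n. y n \<in> V" "\<And>n::nat. f (y n) \<in> ball w (1 / real (Suc n))"
          "\<And>n. y n \<notin> (\<Union>z\<in>Fi. B z)" by metis
        have "(\<lambda>n. f (y n)) \<longlonglongrightarrow> w"
        proof (rule metric_tendsto_imp_tendsto[OF LIMSEQ_inverse_real_of_nat])
          show "\<forall>\<^sub>F n in sequentially. dist (f (y n)) w \<le> dist (inverse (real (Suc n))) 0"
            using y(2) by (auto simp: dist_commute inverse_eq_divide less_imp_le)
        qed
        then obtain l r where l: "l \<in> V" "strict_mono r" "(y \<circ> r) \<longlonglongrightarrow> l" "f l = w"
          using sublim[of y w] y w by blast
        then have lF: "l \<in> Fi" by (simp add: Fi_def)
        have "\<forall>\<^sub>F n in sequentially. (y \<circ> r) n \<in> B l"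
          using topological_tendstoD[OF l(3) B(1,2)[OF lF]] .
        then obtain n where "(y \<circ> r) n \<in> B l" unfolding eventually_sequentially by blast
        then show False using y(3)[of "r n"] lF by auto
      qed
      then obtain e1 where e1: "e1 > 0" "V \<inter> f -` ball w e1 \<subseteq> (\<Union>z\<in>Fi. B z)" by blast
      have "open (S \<inter> (\<Inter>z\<in>Fi. f ` B z))"
        using \<open>finite Fi\<close> B openim \<open>open S\<close> by (intro open_Int open_INT) auto
      moreover have "w \<in> S \<inter> (\<Inter>z\<in>Fi. f ` B z)"
        using w B(2) by (auto simp: Fi_def)
      ultimately obtain e2 where e2: "e2 > 0" "ball w e2 \<subseteq> S \<inter> (\<Inter>z\<in>Fi. f ` B z)"
        unfolding open_contains_ball by meson
      have b: "ball w (min e1 e2) \<subseteq> ball w e1" "ball w (min e1 e2) \<subseteq> ball w e2" by auto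
      show ?thesis
      proof (intro exI[of _ "min e1 e2"] conjI ballI)
        show "min e1 e2 > 0" using e1 e2 by simp
        show "ball w (min e1 e2) \<subseteq> S" using b(2) e2(2) by blast
        show "V \<inter> f -` ball w (min e1 e2) \<subseteq> (\<Union>z\<in>Fi. B z)" using b(1) e1(2) by blast
        show "ball w (min e1 e2) \<subseteq> f ` B z" if "z \<in> Fi" for z using b(2) e2(2) that by blast
      qed
    qed
    then obtain e where e: "e > 0" "ball w e \<subseteq> S" "V \<inter> f -` ball w e \<subseteq> (\<Union>z\<in>Fi. B z)"
      "\<And>z. z \<in> Fi \<Longrightarrow> ball w e \<subseteq> f ` B z" by blast
    define T where "T = ball w e"
    define vs where "vs = (\<lambda>z. B z \<inter> f -` T) ` Fi"
    have op: "open (B z \<inter> f -` T)" if "z \<in> Fi" for z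
      using continuous_open_preimage[of "B z" f T] B[OF that] cont unfolding T_def
      by (auto intro: continuous_on_subset)
    show "\<exists>T. w \<in> T \<and> openin (top_of_set S) T \<and>
             (\<exists>v. \<Union>v = V \<inter> f -` T \<and> (\<forall>u \<in> v. openin (top_of_set V) u) \<and>
              pairwise disjnt v \<and> (\<forall>u \<in> v. \<exists>q. homeomorphism u T f q))"
    proof (intro exI[of _ T] exI[of _ vs] conjI ballI)
      show "w \<in> T" using e by (simp add: T_def)
      show "openin (top_of_set S) T" using e \<open>open S\<close> by (simp add: T_def openin_open_eq)
      show "\<Union>vs = V \<inter> f -` T" using e(3) B(3) unfolding vs_def T_def by blast
      show "pairwise disjnt vs" using disj unfolding vs_def pairwise_def disjnt_def by blast
    next
      fix u assume "u \<in> vs"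
      then obtain z where z: "z \<in> Fi" "u = B z \<inter> f -` T" by (auto simp: vs_def)
      then show "openin (top_of_set V) u" using op B(3) \<open>open V\<close> by (auto simp: openin_open_eq)
      have "u \<subseteq> V" using B(3) z by auto
      have uT: "f ` u = T" using e(4)[OF z(1)] z by (auto simp: T_def)
      have c1: "continuous_on u f" using cont \<open>u \<subseteq> V\<close> continuous_on_subset by blast
      have c2: "inj_on f u" using B(4)[OF z(1)] z(2) by (auto intro: inj_on_subset)
      have c3: "openin (top_of_set T) (f ` U)" if U: "openin (top_of_set u) U" for U
      proof -
        have "open U" "U \<subseteq> u" using op[OF z(1)] z(2) U openin_open_eq by blast+
        then have "open (f ` U)" "f ` U \<subseteq> T" using openim \<open>u \<subseteq> V\<close> uT by blast+
        then show ?thesis by (simp add: T_def openin_open_eq)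
      qed
      have "\<exists>q. homeomorphism u T f q"
        using homeomorphism_injective_open_map[OF c1 uT c2 c3] by blast
      then show "\<exists>q. homeomorphism u T f q" .
    qed
  qed
qed

text \<open>
  The target is simply connected, so its identity map lifts through the covering.
\<close>

lemma proper_local_biholomorphism_section:
  fixes f :: "complex \<Rightarrow> complex"
  assumes "open V" and hol: "f holomorphic_on V" and "open S" and "convex S"
    and im: "f ` V \<subseteq> S" and z0: "z0 \<in> V"
    and dnz: "\<And>z. z \<in> V \<Longrightarrow> deriv f z \<noteq> 0"
    and proper: "\<And>z w. \<lbrakk>\<And>n::nat. z n \<in> V; (\<lambda>n. f (z n)) \<longlonglongrightarrow> w; w \<in> S\<rbrakk>
                   \<Longrightarrow> \<exists>l\<in>V. \<exists>r. strict_mono r \<and> (z \<circ> r) \<longlonglongrightarrow> l"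
  obtains g where "g holomorphic_on S" "g ` S \<subseteq> V" "g (f z0) = z0" "\<forall>w\<in>S. f (g w) = w"
proof -
  have cov: "covering_space V f S"
    by (rule proper_local_biholomorphism_covering[OF assms(1-3) convex_connected[OF assms(4)] im _ dnz proper])
      (use z0 in auto)
  obtain g where g: "continuous_on S g" "g \<in> S \<rightarrow> V" "g (f z0) = z0" "\<And>y. y \<in> S \<Longrightarrow> f (g y) = y"
  proof (rule covering_space_lift_strong[OF cov z0 _ convex_imp_simply_connected[OF \<open>convex S\<close>]
        convex_imp_locally_path_connected[OF \<open>convex S\<close>] continuous_on_id, of "f z0"])
    show "f z0 \<in> S" using im z0 by auto
  qed auto
  have "g holomorphic_on S"
    by (rule covering_space_lift_is_holomorphic[OF cov assms(1,2) holomorphic_on_ident _ g(2,1,4)]) auto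
  then show ?thesis using that g by blast
qed

section \<open>The sign of F and the imaginary part of f\<close>

text \<open>
  Multiplying by \<open>\<bar>1 + \<gamma>z\<bar>\<^sup>2\<close> replaces the factor \<open>z/(1 + \<gamma>z)\<close> by \<open>z(1 + \<gamma> cnj z)\<close>, whose
  real part \<open>x + \<gamma>x\<^sup>2 + \<gamma>y\<^sup>2\<close> is the first term of \<open>F\<close>.
\<close>

lemma Im_tsallis:
  assumes "1 + of_real \<gamma> * z \<noteq> 0"
  shows "(cmod (1 + of_real \<gamma> * z))\<^sup>2 * Im (tsallis \<kappa> \<gamma> z) =
           (Re z + \<gamma> * (Re z)\<^sup>2 + \<gamma> * (Im z)\<^sup>2) * Im (exp_kappa \<kappa> z) + Im z * Re (exp_kappa \<kappa> z)"
proof -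
  define d where "d = 1 + of_real \<gamma> * z"
  have "of_real ((cmod d)\<^sup>2) * tsallis \<kappa> \<gamma> z = z * cnj d * exp_kappa \<kappa> z"
    using assms unfolding tsallis_def complex_norm_square d_def by simp
  then have "Im (of_real ((cmod d)\<^sup>2) * tsallis \<kappa> \<gamma> z) = Im (z * cnj d * exp_kappa \<kappa> z)" by simp
  moreover have "z * cnj d = Complex (Re z + \<gamma> * (Re z)\<^sup>2 + \<gamma> * (Im z)\<^sup>2) (Im z)"
    by (simp add: d_def complex_eq_iff algebra_simps power2_eq_square)
  ultimately show ?thesis by (simp add: d_def algebra_simps power2_eq_square)
qed

lemma critical_poly_real: "critical_poly \<kappa> \<gamma> (of_real x) = of_real (\<gamma> * x\<^sup>2 + (1 + 1 / real_of_ereal \<kappa>) * x + 1)"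
  by (simp add: critical_poly_def)

definition positive_region :: "ereal \<Rightarrow> real \<Rightarrow> complex set" where
  "positive_region \<kappa> \<gamma> =
     {z \<in> tsallis_dom \<kappa> \<gamma>. F_defined \<kappa> \<gamma> (Re z) (Im z) \<and> F_fun \<kappa> \<gamma> (Re z) (Im z) > 0}"

text \<open>
  If \<open>\<bar>\<kappa>\<bar> > 1\<close>, then \<open>F\<close> can be positive also where \<open>\<kappa>\<theta> > \<pi>\<close>. These points are excluded: the curve
  \<open>\<kappa>\<theta> = \<pi>\<close>, on which \<open>F\<close> is undefined, separates them from the points near \<open>0\<close>.
\<close>

definition upper_region :: "ereal \<Rightarrow> real \<Rightarrow> complex set" where
  "upper_region \<kappa> \<gamma> = {z. Im z > 0 \<and> kappa_theta \<kappa> (Re z) (Im z) < pi \<and> Im (tsallis \<kappa> \<gamma> z) > 0}"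

context
  fixes \<kappa> :: ereal
  assumes \<kappa>: "\<kappa> \<noteq> 0" "\<kappa> \<noteq> -\<infinity>"
begin

lemma Im_nonzero_kappa_base:
  assumes "Im z \<noteq> 0" shows "kappa_base \<kappa> z \<noteq> 0"
  using regular_nonreal[OF \<kappa> assms, of 0] by (simp add: regular_at_def)

lemma sin_kappa_theta:
  assumes "Im z \<noteq> 0"
  shows "Im (exp_kappa \<kappa> z) = cmod (exp_kappa \<kappa> z) * sin (kappa_theta \<kappa> (Re z) (Im z))"
    and "Re (exp_kappa \<kappa> z) = cmod (exp_kappa \<kappa> z) * cos (kappa_theta \<kappa> (Re z) (Im z))"
    and "cmod (exp_kappa \<kappa> z) > 0"
proof -
  show "cmod (exp_kappa \<kappa> z) > 0" using exp_kappa_nonzero[OF \<kappa> Im_nonzero_kappa_base[OF assms]] by simp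
  have *: "exp_kappa \<kappa> z = of_real (cmod (exp_kappa \<kappa> z)) * cis (kappa_theta \<kappa> (Re z) (Im z))"
    by (rule exp_kappa_polar[OF \<kappa> Im_nonzero_kappa_base[OF assms]])
  show "Im (exp_kappa \<kappa> z) = cmod (exp_kappa \<kappa> z) * sin (kappa_theta \<kappa> (Re z) (Im z))"
    by (subst *) (simp del: of_real_mult)
  show "Re (exp_kappa \<kappa> z) = cmod (exp_kappa \<kappa> z) * cos (kappa_theta \<kappa> (Re z) (Im z))"
    by (subst *) (simp del: of_real_mult)
qed

lemma sin_kappa_theta_eq_0_iff:
  assumes "Im z \<noteq> 0"
  shows "sin (kappa_theta \<kappa> (Re z) (Im z)) = 0 \<longleftrightarrow> Im (exp_kappa \<kappa> z) = 0"
  using sin_kappa_theta[OF assms] by auto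

text \<open>
  The cotangent of \<open>\<kappa>\<theta>\<close> is the quotient of real and imaginary part of \<open>exp\<^sub>\<kappa>\<close>. In this form \<open>F\<close> is treated
  without reference to the angle.
\<close>

lemma F_formula_exp_kappa:
  assumes "Im z \<noteq> 0"
  shows "F_formula \<kappa> \<gamma> (Re z) (Im z) =
     (Re z + \<gamma> * (Re z)\<^sup>2 + \<gamma> * (Im z)\<^sup>2) + Im z * (Re (exp_kappa \<kappa> z) / Im (exp_kappa \<kappa> z))"
  using sin_kappa_theta[OF assms] by (simp add: F_formula_def cot_def)

lemma positive_region_nonreal:
  assumes "Im z \<noteq> 0"
  shows "z \<in> positive_region \<kappa> \<gamma> \<longleftrightarrow> Im (exp_kappa \<kappa> z) \<noteq> 0 \<and>
     (Re z + \<gamma> * (Re z)\<^sup>2 + \<gamma> * (Im z)\<^sup>2) + Im z * (Re (exp_kappa \<kappa> z) / Im (exp_kappa \<kappa> z)) > 0"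
proof -
  have "z \<in> tsallis_dom \<kappa> \<gamma>"
    using mem_tsallis_dom_iff[OF \<kappa> Im_nonzero_kappa_base[OF assms]] regular_nonreal[OF \<kappa> assms] by blast
  then show ?thesis using assms
    by (simp add: positive_region_def F_defined_def F_fun_def sin_kappa_theta_eq_0_iff F_formula_exp_kappa)
qed

lemma positive_region_cnj:
  assumes "z \<in> positive_region \<kappa> \<gamma>"
  shows "cnj z \<in> positive_region \<kappa> \<gamma>"
proof (cases "Im z = 0")
  case True
  then have "cnj z = z" by (simp add: complex_eq_iff)
  then show ?thesis using assms by simp
next
  case False
  have "exp_kappa \<kappa> (cnj z) = cnj (exp_kappa \<kappa> z)"
    using exp_kappa_cnj[OF \<kappa> regular_nonreal[OF \<kappa> False]] .
  then show ?thesis using assms False positive_region_nonreal[OF False] positive_region_nonreal[of "cnj z"]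
    by auto
qed

lemma Im_exp_kappa_pos:
  assumes "Im z > 0" "kappa_theta \<kappa> (Re z) (Im z) < pi"
  shows "Im (exp_kappa \<kappa> z) > 0"
  using sin_kappa_theta[of z] assms sin_gt_zero[OF kappa_theta_pos[OF \<kappa>]] by simp

lemma positive_region_upper_iff:
  assumes "Im z > 0" "kappa_theta \<kappa> (Re z) (Im z) < pi"
  shows "z \<in> positive_region \<kappa> \<gamma> \<longleftrightarrow> z \<in> upper_region \<kappa> \<gamma>"
proof -
  define e where "e = exp_kappa \<kappa> z"
  define a where "a = Re z + \<gamma> * (Re z)\<^sup>2 + \<gamma> * (Im z)\<^sup>2"
  have e: "Im e > 0" using Im_exp_kappa_pos[OF assms] by (simp add: e_def)
  have d: "1 + of_real \<gamma> * z \<noteq> 0"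
    using regular_nonreal[OF \<kappa>, of z \<gamma>] assms by (auto simp: regular_at_def)
  have "(cmod (1 + of_real \<gamma> * z))\<^sup>2 * Im (tsallis \<kappa> \<gamma> z) = Im e * (a + Im z * (Re e / Im e))"
    using Im_tsallis[OF d, of \<kappa>] e by (simp add: e_def a_def field_simps)
  moreover have "(cmod (1 + of_real \<gamma> * z))\<^sup>2 > 0" using d by simp
  ultimately have "Im (tsallis \<kappa> \<gamma> z) > 0 \<longleftrightarrow> a + Im z * (Re e / Im e) > 0"
    using e by (metis zero_less_mult_pos mult_pos_pos)
  then show ?thesis using assms e positive_region_nonreal[of z \<gamma>]
    by (simp add: upper_region_def e_def a_def)
qed

lemma positive_region_kappa_theta:
  assumes "z \<in> positive_region \<kappa> \<gamma>" "Im z > 0"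
  shows "kappa_theta \<kappa> (Re z) (Im z) \<noteq> pi"
  using assms positive_region_nonreal[of z \<gamma>] sin_kappa_theta_eq_0_iff[of z] by auto

text \<open>
  On the vertical line through \<open>x\<close>, the quotient \<open>Im exp\<^sub>\<kappa> / t\<close> tends to the derivative \<open>exp\<^sub>\<kappa>(x) / u\<close>, which
  is a nonzero real number, while \<open>Re exp\<^sub>\<kappa>\<close> tends to \<open>exp\<^sub>\<kappa>(x)\<close>. Hence the cotangent term tends to \<open>u\<close>. This includes the
  real points beyond \<open>-\<kappa>\<close> when \<open>\<kappa>\<close> is an integer.
\<close>

lemma F_formula_tendsto:
  fixes x :: real
  assumes reg: "regular_at \<kappa> \<gamma> (of_real x)"
  shows "(F_formula \<kappa> \<gamma> x \<longlongrightarrow> Re (critical_poly \<kappa> \<gamma> (of_real x))) (at 0)"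
    and "\<forall>\<^sub>F t in at 0. sin (kappa_theta \<kappa> x t) \<noteq> 0"
proof -
  define c where "c t = exp_kappa \<kappa> (Complex x t)" for t
  define u where "u = 1 + x / real_of_ereal \<kappa>"
  define ex where "ex = Re (exp_kappa \<kappa> (of_real x))"
  have u: "kappa_base \<kappa> (of_real x) = of_real u" by (simp add: u_def kappa_base_of_real)
  have u0: "u \<noteq> 0" using reg u unfolding regular_at_def by auto
  have ex: "exp_kappa \<kappa> (of_real x) = of_real ex"
    using exp_kappa_real[OF \<kappa> reg] by (simp add: ex_def)
  have ex0: "ex \<noteq> 0" using exp_kappa_nonzero[OF \<kappa>, of "of_real x"] u u0 ex by auto
  have cx: "Complex x t = of_real x + \<i> * of_real t" for t by (simp add: complex_eq_iff)
  have der: "(c has_vector_derivative (\<i> * of_real (ex / u))) (at 0)"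
  proof -
    have 1: "((\<lambda>t. Complex x t) has_vector_derivative \<i>) (at 0)"
      unfolding cx by (auto intro!: derivative_eq_intros simp: has_vector_derivative_def scaleR_conv_of_real mult.commute)
    have 2: "(exp_kappa \<kappa> has_field_derivative of_real (ex / u)) (at (Complex x 0))"
      using exp_kappa_has_derivative[OF \<kappa> reg] ex u by (simp add: Complex_eq)
    show ?thesis using field_vector_diff_chain_at[OF 1 2] by (simp add: c_def[abs_def] o_def)
  qed
  have dIm: "((\<lambda>t. Im (c t)) has_real_derivative ex / u) (at 0)"
    using bounded_linear.has_vector_derivative[OF bounded_linear_Im der] by (simp add: has_real_derivative_iff_has_vector_derivative)
  have c0: "c 0 = of_real ex" using ex by (simp add: c_def Complex_eq)
  have l1: "((\<lambda>t. Im (c t) / t) \<longlongrightarrow> ex / u) (at 0)"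
    using dIm c0 unfolding DERIV_def by simp
  have l2: "((\<lambda>t. Re (c t)) \<longlongrightarrow> ex) (at 0)"
    using has_vector_derivative_continuous[OF der] c0
    by (auto simp: continuous_at intro: tendsto_Re[THEN tendsto_eq_rhs])
  have ne: "\<forall>\<^sub>F t in at 0. Im (c t) / t \<noteq> 0"
    by (rule tendsto_imp_eventually_ne[OF l1]) (use ex0 u0 in simp)
  have ne0: "\<forall>\<^sub>F t::real in at 0. t \<noteq> 0" by (simp add: eventually_at_filter)
  show "\<forall>\<^sub>F t in at 0. sin (kappa_theta \<kappa> x t) \<noteq> 0"
    using ne ne0
  proof eventually_elim
    case (elim t)
    then show ?case using sin_kappa_theta_eq_0_iff[of "Complex x t"] by (simp add: c_def)
  qed
  have "((\<lambda>t. (x + \<gamma> * x\<^sup>2 + \<gamma> * t\<^sup>2) + Re (c t) / (Im (c t) / t)) \<longlongrightarrow>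
      (x + \<gamma> * x\<^sup>2 + \<gamma> * 0\<^sup>2) + ex / (ex / u)) (at 0)"
    by (intro tendsto_intros l1 l2) (use ex0 u0 in auto)
  moreover have "(x + \<gamma> * x\<^sup>2 + \<gamma> * 0\<^sup>2) + ex / (ex / u) = Re (critical_poly \<kappa> \<gamma> (of_real x))"
    using ex0 u0 unfolding critical_poly_altdef u by (simp add: algebra_simps power2_eq_square)
  moreover have "\<forall>\<^sub>F t in at 0. (x + \<gamma> * x\<^sup>2 + \<gamma> * t\<^sup>2) + Re (c t) / (Im (c t) / t) = F_formula \<kappa> \<gamma> x t"
    using ne0
  proof eventually_elim
    case (elim t)
    then show ?case using F_formula_exp_kappa[of "Complex x t" \<gamma>] by (simp add: c_def mult.commute)
  qed
  ultimately show "(F_formula \<kappa> \<gamma> x \<longlongrightarrow> Re (critical_poly \<kappa> \<gamma> (of_real x))) (at 0)"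
    by (simp add: tendsto_cong)
qed

lemma positive_region_real:
  assumes "kappa_base \<kappa> (of_real x) \<noteq> 0"
  shows "of_real x \<in> positive_region \<kappa> \<gamma> \<longleftrightarrow>
           regular_at \<kappa> \<gamma> (of_real x) \<and> Re (critical_poly \<kappa> \<gamma> (of_real x)) > 0"
proof (cases "regular_at \<kappa> \<gamma> (of_real x)")
  case True
  note F = F_formula_tendsto[OF True]
  have "Lim (at 0) (F_formula \<kappa> \<gamma> x) = Re (critical_poly \<kappa> \<gamma> (of_real x))"
    using tendsto_Lim[OF _ F(1)] by simp
  then show ?thesis
    using True F mem_tsallis_dom_iff[OF \<kappa> assms] by (auto simp: positive_region_def F_defined_def F_fun_def)
next
  case False
  then show ?thesis using mem_tsallis_dom_iff[OF \<kappa> assms] by (auto simp: positive_region_def)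
qed

end

section \<open>Properness over the upper half-plane\<close>

definition existence_condition :: "ereal \<Rightarrow> real \<Rightarrow> bool" where
  "existence_condition \<kappa> \<gamma> \<longleftrightarrow>
      (0 < \<kappa> \<and> \<kappa> < 1 \<and> \<gamma> \<le> 0)
    \<or> (1 \<le> \<kappa> \<and> \<kappa> < \<infinity> \<and> \<gamma> \<le> 1 / 4 * (1 + 1 / real_of_ereal \<kappa>)\<^sup>2)
    \<or> (-1 < \<kappa> \<and> \<kappa> < 0 \<and> \<gamma> \<le> 1 / real_of_ereal \<kappa>)
    \<or> (\<kappa> \<le> -1 \<and> \<gamma> \<le> 1 / 4 * (1 + 1 / real_of_ereal \<kappa>)\<^sup>2)
    \<or> (\<kappa> = \<infinity> \<and> \<gamma> \<le> 1 / 4)"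

text \<open>
  The condition \<open>\<kappa>\<theta> < \<pi>\<close> confines \<open>u\<close> to the sector of half-angle \<open>\<pi>/\<bar>\<kappa>\<bar>\<close>. Stated as a closed condition on \<open>u\<close>,
  it passes to limits even at points of the negative real axis, where the argument is discontinuous.
\<close>

lemma upper_region_cone:
  assumes "k \<noteq> 0" "1 \<le> \<bar>k\<bar>" "kappa_theta (ereal k) (Re z) (Im z) < pi" "Im z > 0"
  shows "cmod (kappa_base (ereal k) z) * cos (pi / \<bar>k\<bar>) \<le> Re (kappa_base (ereal k) z)"
proof -
  define u where "u = kappa_base (ereal k) z"
  have "\<bar>k * Arg u\<bar> < pi"
    using assms kappa_theta_pos[of "ereal k" z] kappa_theta_finite[of k z] by (auto simp: u_def)
  then have "\<bar>Arg u\<bar> \<le> pi / \<bar>k\<bar>"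
    using assms(1) by (simp add: abs_mult field_simps)
  moreover have "pi / \<bar>k\<bar> \<le> pi" using assms(1,2) by (simp add: field_simps)
  ultimately have "cos (pi / \<bar>k\<bar>) \<le> cos \<bar>Arg u\<bar>" by (intro cos_monotone_0_pi_le) auto
  then have "cmod u * cos (pi / \<bar>k\<bar>) \<le> cmod u * cos (Arg u)" by (intro mult_left_mono) auto
  also have "\<dots> = Re u" using rcis_cmod_Arg[of u] by (metis Re_rcis)
  finally show ?thesis by (simp add: u_def)
qed

lemma powr_tendsto_0_at_0:
  assumes "(a \<longlongrightarrow> 0) F" "p > 0" "\<forall>\<^sub>F n in F. 0 \<le> a n"
  shows "((\<lambda>n. a n powr p) \<longlongrightarrow> (0::real)) F"
  using tendsto_powr'[OF assms(1) tendsto_const, of p] assms(2,3) by simp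

lemma powr_tendsto_0_at_infinity:
  assumes "filterlim a at_top F" "p < 0"
  shows "((\<lambda>n. a n powr p) \<longlongrightarrow> (0::real)) F"
  using tendsto_neg_powr[OF assms(2,1)] .

text \<open>
  Where \<open>\<kappa>\<theta> = \<pi>\<close> the number \<open>exp\<^sub>\<kappa>\<close> is negative, while \<open>z/(1 + \<gamma>z)\<close> lies in the upper half-plane.
\<close>

lemma kappa_theta_limit_not_pi:
  assumes \<kappa>: "\<kappa> \<noteq> 0" "\<kappa> \<noteq> -\<infinity>" and "Im z > 0" "Im (tsallis \<kappa> \<gamma> z) > 0"
  shows "kappa_theta \<kappa> (Re z) (Im z) \<noteq> pi"
proof
  assume *: "kappa_theta \<kappa> (Re z) (Im z) = pi"
  have nz: "1 + of_real \<gamma> * z \<noteq> 0"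
    using regular_nonreal[OF \<kappa>, of z \<gamma>] assms by (auto simp: regular_at_def)
  have "Im z \<noteq> 0" using assms by simp
  note s = sin_kappa_theta[OF \<kappa> this]
  have "(cmod (1 + of_real \<gamma> * z))\<^sup>2 * Im (tsallis \<kappa> \<gamma> z) = - Im z * cmod (exp_kappa \<kappa> z)"
    using Im_tsallis[OF nz, of \<kappa>] s * by simp
  moreover have "(cmod (1 + of_real \<gamma> * z))\<^sup>2 * Im (tsallis \<kappa> \<gamma> z) > 0" using assms nz by simp
  ultimately show False using s(3) assms(3) by (simp add: mult_less_0_iff)
qed

lemma norm_tsallis:
  assumes "1 + of_real \<gamma> * z \<noteq> 0"
  shows "cmod (tsallis \<kappa> \<gamma> z) * cmod (1 + of_real \<gamma> * z) = cmod z * cmod (exp_kappa \<kappa> z)"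
  using assms by (simp add: tsallis_def norm_mult norm_divide)

text \<open>
  Properness fails only if such a sequence tends to infinity or to a point outside the region. The lemmas of this
  locale treat the possible limits one at a time.
\<close>

locale upper_sequence =
  fixes \<kappa> :: ereal and \<gamma> :: real and z :: "nat \<Rightarrow> complex" and w :: complex
  assumes \<kappa>: "\<kappa> \<noteq> 0" "\<kappa> \<noteq> -\<infinity>" and z: "\<And>n. z n \<in> upper_region \<kappa> \<gamma>"
    and lim: "(\<lambda>n. tsallis \<kappa> \<gamma> (z n)) \<longlonglongrightarrow> w" and w: "Im w > 0"
begin

lemma zpos: "Im (z n) > 0" "kappa_theta \<kappa> (Re (z n)) (Im (z n)) < pi"
  using z unfolding upper_region_def by auto

lemma w0: "w \<noteq> 0" using w by auto

lemma d0: "1 + of_real \<gamma> * z n \<noteq> 0" and u0: "kappa_base \<kappa> (z n) \<noteq> 0"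
proof -
  have "Im (z n) \<noteq> 0" using zpos(1)[of n] by simp
  from regular_nonreal[OF \<kappa> this, of \<gamma>]
  show "1 + of_real \<gamma> * z n \<noteq> 0" "kappa_base \<kappa> (z n) \<noteq> 0" by (auto simp: regular_at_def)
qed

lemma norm_lim: "(\<lambda>n. cmod (tsallis \<kappa> \<gamma> (z n))) \<longlonglongrightarrow> cmod w"
  using tendsto_norm[OF lim] .

lemma norm_eq: "cmod (tsallis \<kappa> \<gamma> (z n)) * cmod (1 + of_real \<gamma> * z n) = cmod (z n) * cmod (exp_kappa \<kappa> (z n))"
  by (rule norm_tsallis[OF d0])

lemma subsequence:
  assumes "strict_mono r" shows "upper_sequence \<kappa> \<gamma> (z \<circ> r) w"
  using \<kappa> z w LIMSEQ_subseq_LIMSEQ[OF lim assms] by unfold_locales (auto simp: o_def)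

lemma finite_limit_nonreal:
  assumes l: "z \<longlonglongrightarrow> l" and "Im l > 0"
  shows "l \<in> upper_region \<kappa> \<gamma>"
proof -
  have reg: "regular_at \<kappa> \<gamma> l" using regular_nonreal[OF \<kappa>] assms by auto
  have "isCont (tsallis \<kappa> \<gamma>) l" using tsallis_has_derivative[OF \<kappa> reg] DERIV_isCont by blast
  then have "(\<lambda>n. tsallis \<kappa> \<gamma> (z n)) \<longlonglongrightarrow> tsallis \<kappa> \<gamma> l" using isCont_tendsto_compose l by blast
  then have fl: "tsallis \<kappa> \<gamma> l = w" using lim LIMSEQ_unique by blast
  have "\<kappa> = \<infinity> \<or> kappa_base \<kappa> l \<notin> \<real>\<^sub>\<le>\<^sub>0"
    using Im_kappa_base[of \<kappa> l] assms \<kappa> by (cases rule: ereal_cases_kappa[OF \<kappa>]) (auto simp: complex_nonpos_Reals_iff)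
  from isCont_tendsto_compose[OF isCont_kappa_theta[OF \<kappa> this] l]
  have "kappa_theta \<kappa> (Re l) (Im l) \<le> pi"
    using zpos(2) by (intro LIMSEQ_le_const2) (auto intro: less_imp_le)
  moreover have "kappa_theta \<kappa> (Re l) (Im l) \<noteq> pi"
    using kappa_theta_limit_not_pi[OF \<kappa> \<open>Im l > 0\<close>] fl w by auto
  ultimately show ?thesis unfolding upper_region_def using assms fl w by auto
qed

lemma finite_limit_regular:
  assumes l: "z \<longlonglongrightarrow> l" and "Im l = 0" and reg: "regular_at \<kappa> \<gamma> l"
  shows False
proof -
  have "isCont (tsallis \<kappa> \<gamma>) l" using tsallis_has_derivative[OF \<kappa> reg] DERIV_isCont by blast
  then have "(\<lambda>n. tsallis \<kappa> \<gamma> (z n)) \<longlonglongrightarrow> tsallis \<kappa> \<gamma> l" using isCont_tendsto_compose l by blast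
  then have fl: "tsallis \<kappa> \<gamma> l = w" using lim LIMSEQ_unique by blast
  have "l \<in> \<real>" using assms(2) by (simp add: complex_is_Real_iff)
  then show False using tsallis_real[OF \<kappa> reg] fl w by (simp add: complex_is_Real_iff)
qed

lemma kappa_base_tendsto:
  assumes l: "z \<longlonglongrightarrow> l" shows "(\<lambda>n. kappa_base \<kappa> (z n)) \<longlonglongrightarrow> kappa_base \<kappa> l"
  using isCont_tendsto_compose[OF isCont_kappa_base l] .

text \<open>
  At a zero of \<open>1 + \<gamma>z\<close> the value of \<open>f\<close> would have to be infinite. Only \<open>\<bar>exp\<^sub>\<kappa>\<bar>\<close> is continuous on the cut, hence the
  estimate of absolute values.
\<close>

lemma finite_limit_pole:
  assumes l: "z \<longlonglongrightarrow> l" and d: "1 + of_real \<gamma> * l = 0" and u: "kappa_base \<kappa> l \<noteq> 0"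
  shows False
proof -
  have l0: "l \<noteq> 0" using d by auto
  have "(\<lambda>n. cmod (tsallis \<kappa> \<gamma> (z n)) * cmod (1 + of_real \<gamma> * z n)) \<longlonglongrightarrow> cmod w * cmod (1 + of_real \<gamma> * l)"
    by (intro tendsto_intros norm_lim l)
  then have 1: "(\<lambda>n. cmod (z n) * cmod (exp_kappa \<kappa> (z n))) \<longlonglongrightarrow> 0" using d norm_eq by simp
  have "\<exists>c>0. (\<lambda>n. cmod (exp_kappa \<kappa> (z n))) \<longlonglongrightarrow> c"
    using \<kappa>
  proof (cases rule: ereal_cases_kappa)
    case 1
    have "(\<lambda>n. cmod (exp (z n))) \<longlonglongrightarrow> cmod (exp l)" by (intro tendsto_intros l)
    then show ?thesis using 1 by (intro exI[of _ "cmod (exp l)"]) (simp add: exp_kappa_def)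
  next
    case (2 k)
    have "(\<lambda>n. cmod (kappa_base \<kappa> (z n)) powr k) \<longlonglongrightarrow> cmod (kappa_base \<kappa> l) powr k"
      using u by (intro tendsto_intros kappa_base_tendsto l) auto
    moreover have "cmod (exp_kappa \<kappa> (z n)) = cmod (kappa_base \<kappa> (z n)) powr k" for n
      using norm_exp_kappa[of k "z n"] 2 u0 by simp
    ultimately show ?thesis using u by (intro exI[of _ "cmod (kappa_base \<kappa> l) powr k"]) simp
  qed
  then obtain c where c: "c > 0" "(\<lambda>n. cmod (exp_kappa \<kappa> (z n))) \<longlonglongrightarrow> c" by blast
  have "(\<lambda>n. cmod (z n) * cmod (exp_kappa \<kappa> (z n))) \<longlonglongrightarrow> cmod l * c"
    by (intro tendsto_intros c l)
  with 1 have "cmod l * c = 0" using LIMSEQ_unique by blast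
  then show False using l0 c by auto
qed

text \<open>
  As \<open>u \<rightarrow> 0\<close>, the value of \<open>f\<close> behaves like a nonzero multiple of \<open>u\<^sup>\<kappa>\<close>, or of \<open>u\<^sup>\<kappa>\<^sup>-\<^sup>1\<close> in case
  the pole \<open>-1/\<gamma>\<close> coincides with \<open>-\<kappa>\<close>; neither has a finite nonzero limit, except that \<open>f\<close> is the identity for
  \<open>\<kappa> = \<gamma> = 1\<close>, and then the limit is real.
\<close>

lemma finite_limit_kappa_base_0:
  assumes l: "z \<longlonglongrightarrow> l" and u: "kappa_base \<kappa> l = 0" and "Im l = 0"
  shows False
  using \<kappa>
proof (cases rule: ereal_cases_kappa)
  case 1 then show False using u by simp
next
  case (2 k)
  have lk: "l = of_real (- k)" using u 2 by (auto simp: kappa_base_def field_simps add_eq_0_iff)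
  have l0: "l \<noteq> 0" using lk 2 by auto
  have ub: "(\<lambda>n. cmod (kappa_base \<kappa> (z n))) \<longlonglongrightarrow> 0" using tendsto_norm[OF kappa_base_tendsto[OF l]] u by simp
  have ne: "cmod (tsallis \<kappa> \<gamma> (z n)) * cmod (1 + of_real \<gamma> * z n) = cmod (z n) * cmod (kappa_base \<kappa> (z n)) powr k" for n
    using norm_eq[of n] norm_exp_kappa[of k "z n"] 2 u0[of n] by simp
  have zl: "(\<lambda>n. cmod (z n)) \<longlonglongrightarrow> cmod l" by (intro tendsto_intros l)
  show False
  proof (cases "1 + of_real \<gamma> * l = 0")
    case False
    have L: "(\<lambda>n. cmod (tsallis \<kappa> \<gamma> (z n)) * cmod (1 + of_real \<gamma> * z n)) \<longlonglongrightarrow> cmod w * cmod (1 + of_real \<gamma> * l)"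
      by (intro tendsto_intros norm_lim l)
    show False
    proof (cases "k > 0")
      case True
      have "(\<lambda>n. cmod (z n) * cmod (kappa_base \<kappa> (z n)) powr k) \<longlonglongrightarrow> cmod l * 0"
        by (intro tendsto_mult zl powr_tendsto_0_at_0 ub True) simp
      then have "cmod l * 0 = cmod w * cmod (1 + of_real \<gamma> * l)" using L unfolding ne by (rule LIMSEQ_unique)
      then show False using False w0 by simp
    next
      case kneg: False
      have "(\<lambda>n. cmod (tsallis \<kappa> \<gamma> (z n)) * cmod (1 + of_real \<gamma> * z n) * cmod (kappa_base \<kappa> (z n)) powr (-k))
          \<longlonglongrightarrow> cmod w * cmod (1 + of_real \<gamma> * l) * 0"
        using kneg 2 by (intro tendsto_mult L powr_tendsto_0_at_0 ub) auto
      moreover have "cmod (tsallis \<kappa> \<gamma> (z n)) * cmod (1 + of_real \<gamma> * z n) * cmod (kappa_base \<kappa> (z n)) powr (-k) = cmod (z n)" for n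
        unfolding ne using u0[of n] by (simp add: mult.assoc flip: powr_add)
      ultimately have "cmod l = 0" using zl LIMSEQ_unique by fastforce
      then show False using l0 by simp
    qed
  next
    case True
    then have "of_real (\<gamma> * k) = (1::complex)" using lk by (simp add: algebra_simps)
    then have gk: "\<gamma> * k = 1" by (metis of_real_eq_1_iff)
    have du: "1 + of_real \<gamma> * z n = kappa_base \<kappa> (z n)" for n
    proof -
      have "\<gamma> = 1 / k" using gk 2 by (simp add: field_simps)
      then show ?thesis using 2 by (simp add: kappa_base_def)
    qed
    have fk: "cmod (tsallis \<kappa> \<gamma> (z n)) = cmod (z n) * cmod (kappa_base \<kappa> (z n)) powr (k - 1)" for n
      using ne[of n] u0[of n] unfolding du by (simp add: powr_diff field_simps)
    consider "k < 1" | "k = 1" | "k > 1" by linarith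
    then show False
    proof cases
      case 1
      have "(\<lambda>n. cmod (tsallis \<kappa> \<gamma> (z n)) * cmod (kappa_base \<kappa> (z n)) powr (1 - k)) \<longlonglongrightarrow> cmod w * 0"
        using 1 by (intro tendsto_mult norm_lim powr_tendsto_0_at_0 ub) auto
      moreover have "cmod (tsallis \<kappa> \<gamma> (z n)) * cmod (kappa_base \<kappa> (z n)) powr (1 - k) = cmod (z n)" for n
        unfolding fk using u0[of n] by (simp add: mult.assoc flip: powr_add)
      ultimately have "cmod l = 0" using zl LIMSEQ_unique by fastforce
      then show False using l0 by simp
    next
      case k1: 2
      have "tsallis \<kappa> \<gamma> (z n) = z n" for n
        using du[of n] u0[of n] exp_kappa_powr[of k "z n"] 2 k1 by (simp add: tsallis_def)
      then have "l = w" using lim l LIMSEQ_unique by simp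
      then show False using w assms(3) by simp
    next
      case 3
      have "(\<lambda>n. cmod (z n) * cmod (kappa_base \<kappa> (z n)) powr (k - 1)) \<longlonglongrightarrow> cmod l * 0"
        using 3 by (intro tendsto_mult zl powr_tendsto_0_at_0 ub) auto
      then have "cmod w = 0" using norm_lim unfolding fk using LIMSEQ_unique by fastforce
      then show False using w0 by simp
    qed
  qed
qed

text \<open>
  For \<open>\<bar>\<kappa>\<bar> \<ge> 1\<close> the cut is outside the sector of \<open>upper_region_cone\<close>. For \<open>\<bar>\<kappa>\<bar> < 1\<close> this is the place where the sign
  conditions on \<open>\<gamma>\<close> enter: they make \<open>q = x/(1 + \<gamma>x)\<close> negative on the cut. Then \<open>exp\<^sub>\<kappa>\<close>, which is \<open>f\<close> divided by
  \<open>z/(1 + \<gamma>z)\<close>, tends to \<open>w/q\<close> in the lower half-plane, although it takes values in the upper half-plane.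
\<close>

lemma finite_limit_cut:
  assumes l: "z \<longlonglongrightarrow> of_real x" and \<kappa>k: "\<kappa> = ereal k" "k \<noteq> 0" and "1 + \<gamma> * x \<noteq> 0"
    and u: "1 + x / k < 0" and nint: "k \<notin> \<int>" and cond: "existence_condition \<kappa> \<gamma>"
  shows False
proof (cases "\<bar>k\<bar> \<ge> 1")
  case True
  then have k1: "\<bar>k\<bar> > 1" using nint by (cases "k \<ge> 0") (auto simp: order_less_le abs_if)
  have bl: "kappa_base \<kappa> (of_real x) = of_real (1 + x / k)" using \<kappa>k by (simp add: kappa_base_of_real)
  have "cmod (of_real (1 + x / k)) * cos (pi / \<bar>k\<bar>) \<le> Re (of_real (1 + x / k))"
  proof (rule LIMSEQ_le)
    show "(\<lambda>n. cmod (kappa_base \<kappa> (z n)) * cos (pi / \<bar>k\<bar>)) \<longlonglongrightarrow> cmod (of_real (1 + x / k)) * cos (pi / \<bar>k\<bar>)"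
      by (intro tendsto_intros kappa_base_tendsto[OF l, unfolded bl])
    show "(\<lambda>n. Re (kappa_base \<kappa> (z n))) \<longlonglongrightarrow> Re (of_real (1 + x / k))"
      by (intro tendsto_intros kappa_base_tendsto[OF l, unfolded bl])
    show "\<exists>N. \<forall>n\<ge>N. cmod (kappa_base \<kappa> (z n)) * cos (pi / \<bar>k\<bar>) \<le> Re (kappa_base \<kappa> (z n))"
      using upper_region_cone[OF \<kappa>k(2) True, of "z n" for n] zpos \<kappa>k by auto
  qed
  then have "- (1 + x / k) * cos (pi / \<bar>k\<bar>) \<le> 1 + x / k" using u unfolding norm_of_real by simp
  then have "0 \<le> (1 + x / k) * (1 + cos (pi / \<bar>k\<bar>))" by (simp add: algebra_simps)
  moreover have "cos (pi / \<bar>k\<bar>) > cos pi"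
    using k1 by (intro cos_monotone_0_pi) (auto simp: field_simps)
  ultimately show False using u by (simp add: zero_le_mult_iff)
next
  case False
  define q where "q = x / (1 + \<gamma> * x)"
  have q: "q < 0"
  proof (cases "k > 0")
    case True
    then have g: "\<gamma> \<le> 0" using cond False \<kappa>k by (auto simp: existence_condition_def one_ereal_def zero_ereal_def)
    have "x < 0" using u True by (simp add: field_simps) 
    moreover have "1 + \<gamma> * x > 0" using g \<open>x < 0\<close> by (smt (verit) mult_nonpos_nonpos)
    ultimately show ?thesis by (simp add: q_def divide_neg_pos)
  next
    case kneg: False
    then have g: "\<gamma> \<le> 1 / k" using cond False \<kappa>k by (auto simp: existence_condition_def one_ereal_def zero_ereal_def)
    have "x > 0" using u kneg \<kappa>k(2) by (smt (verit) divide_nonpos_nonpos)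
    moreover have "\<gamma> * x \<le> 1 / k * x" using g \<open>x > 0\<close> by (intro mult_right_mono) auto
    then have "1 + \<gamma> * x < 0" using u by simp
    ultimately show ?thesis by (simp add: q_def divide_pos_neg)
  qed
  have d: "1 + of_real \<gamma> * of_real x \<noteq> (0::complex)"
    using assms(4) by (metis of_real_1 of_real_add of_real_eq_0_iff of_real_mult)
  have ql: "(\<lambda>n. z n / (1 + of_real \<gamma> * z n)) \<longlonglongrightarrow> of_real q"
  proof -
    have "(\<lambda>n. z n / (1 + of_real \<gamma> * z n)) \<longlonglongrightarrow> of_real x / (1 + of_real \<gamma> * of_real x)"
      by (intro tendsto_intros l d)
    then show ?thesis by (simp add: q_def)
  qed
  have "(\<lambda>n. tsallis \<kappa> \<gamma> (z n) / (z n / (1 + of_real \<gamma> * z n))) \<longlonglongrightarrow> w / of_real q"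
    using q by (intro tendsto_divide lim ql) auto
  moreover have "tsallis \<kappa> \<gamma> (z n) / (z n / (1 + of_real \<gamma> * z n)) = exp_kappa \<kappa> (z n)" for n
    using d0[of n] zpos(1)[of n] by (auto simp: tsallis_def)
  ultimately have "(exp_kappa \<kappa> \<circ> z) \<longlonglongrightarrow> w / of_real q"
    by (simp add: o_def)
  then have "(\<lambda>n. Im (exp_kappa \<kappa> (z n))) \<longlonglongrightarrow> Im (w / of_real q)"
    unfolding o_def by (rule tendsto_Im)
  moreover have "Im (exp_kappa \<kappa> (z n)) \<ge> 0" for n
    using Im_exp_kappa_pos[OF \<kappa> zpos] by (simp add: less_imp_le)
  ultimately have "Im (w / of_real q) \<ge> 0" by (intro LIMSEQ_le_const) auto
  then show False using w q by (simp add: zero_le_divide_iff)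
qed

text \<open>
  At infinity \<open>\<bar>f\<bar>\<close> is comparable to \<open>\<bar>u\<bar>\<^sup>\<kappa>\<close> if \<open>\<gamma> \<noteq> 0\<close> and to \<open>\<bar>u\<bar>\<^sup>\<kappa>\<^sup>+\<^sup>1\<close> if \<open>\<gamma> = 0\<close>. The limit is \<open>0\<close>
  or infinity, except for the fractional linear map with \<open>\<kappa> = -1\<close> and \<open>\<gamma> = 0\<close>, whose value at infinity is real.
\<close>

lemma no_infinite_limit_finite_kappa:
  assumes inf: "filterlim (\<lambda>n. cmod (z n)) at_top sequentially" and \<kappa>k: "\<kappa> = ereal k" "k \<noteq> 0"
  shows False
proof -
  have zi: "(\<lambda>n. inverse (z n)) \<longlonglongrightarrow> 0"
    by (rule filterlim_compose[OF tendsto_inverse_0 filterlim_norm_at_top_imp_at_infinity[OF inf]])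
  have z0: "z n \<noteq> 0" for n using zpos(1)[of n] by auto
  have "(\<lambda>n. inverse (z n) + 1 / of_real k) \<longlonglongrightarrow> 0 + 1 / of_real k" by (intro tendsto_intros zi)
  moreover have "inverse (z n) + 1 / of_real k = kappa_base \<kappa> (z n) / z n" for n
    using z0[of n] \<kappa>k by (simp add: kappa_base_def field_simps)
  ultimately have uz: "(\<lambda>n. kappa_base \<kappa> (z n) / z n) \<longlonglongrightarrow> 1 / of_real k" by simp
  have uzn: "(\<lambda>n. cmod (kappa_base \<kappa> (z n)) / cmod (z n)) \<longlonglongrightarrow> 1 / \<bar>k\<bar>"
    using tendsto_norm[OF uz] by (simp add: norm_divide)
  have uinf: "filterlim (\<lambda>n. cmod (kappa_base \<kappa> (z n))) at_top sequentially"
  proof -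
    have "filterlim (\<lambda>n. cmod (kappa_base \<kappa> (z n)) / cmod (z n) * cmod (z n)) at_top sequentially"
      using \<kappa>k by (intro filterlim_tendsto_pos_mult_at_top[OF uzn _ inf]) auto
    then show ?thesis using z0 by simp
  qed
  have "(\<lambda>n. inverse (z n) + of_real \<gamma>) \<longlonglongrightarrow> 0 + of_real \<gamma>" by (intro tendsto_intros zi)
  moreover have "inverse (z n) + of_real \<gamma> = (1 + of_real \<gamma> * z n) / z n" for n
    using z0[of n] by (simp add: field_simps)
  ultimately have dz: "(\<lambda>n. cmod (1 + of_real \<gamma> * z n) / cmod (z n)) \<longlonglongrightarrow> \<bar>\<gamma>\<bar>"
    using tendsto_norm by (fastforce simp: norm_divide)
  have ne: "cmod (tsallis \<kappa> \<gamma> (z n)) * cmod (1 + of_real \<gamma> * z n) = cmod (z n) * cmod (kappa_base \<kappa> (z n)) powr k" for n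
    using norm_eq[of n] norm_exp_kappa[of k "z n"] \<kappa>k u0[of n] by simp
  show False
  proof (cases "\<gamma> = 0")
    case False
    have L: "(\<lambda>n. cmod (tsallis \<kappa> \<gamma> (z n)) * (cmod (1 + of_real \<gamma> * z n) / cmod (z n))) \<longlonglongrightarrow> cmod w * \<bar>\<gamma>\<bar>"
      by (intro tendsto_mult norm_lim dz)
    have eq: "cmod (tsallis \<kappa> \<gamma> (z n)) * (cmod (1 + of_real \<gamma> * z n) / cmod (z n)) = cmod (kappa_base \<kappa> (z n)) powr k" for n
      using ne[of n] z0[of n] by (simp add: field_simps)
    show False
    proof (cases "k > 0")
      case True
      have "(\<lambda>n. cmod (kappa_base \<kappa> (z n)) powr k * cmod (kappa_base \<kappa> (z n)) powr (-k)) \<longlonglongrightarrow> cmod w * \<bar>\<gamma>\<bar> * 0"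
        using True by (intro tendsto_mult L[unfolded eq] powr_tendsto_0_at_infinity uinf) auto
      moreover have "cmod (kappa_base \<kappa> (z n)) powr k * cmod (kappa_base \<kappa> (z n)) powr (-k) = 1" for n
        using u0[of n] by (simp flip: powr_add)
      ultimately show False using LIMSEQ_unique[of "\<lambda>_. 1::real" 0 1] by simp
    next
      case kneg: False
      have "(\<lambda>n. cmod (kappa_base \<kappa> (z n)) powr k) \<longlonglongrightarrow> 0"
        using kneg \<kappa>k by (intro powr_tendsto_0_at_infinity uinf) auto
      then have "cmod w * \<bar>\<gamma>\<bar> = 0" using L[unfolded eq] LIMSEQ_unique by blast
      then show False using False w0 by simp
    qed
  next
    case True
    have fk: "cmod (tsallis \<kappa> \<gamma> (z n)) * (cmod (kappa_base \<kappa> (z n)) / cmod (z n)) = cmod (kappa_base \<kappa> (z n)) powr (k + 1)" for n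
      using ne[of n] True z0[of n] u0[of n] by (simp add: powr_add)
    have L: "(\<lambda>n. cmod (kappa_base \<kappa> (z n)) powr (k + 1)) \<longlonglongrightarrow> cmod w * (1 / \<bar>k\<bar>)"
      unfolding fk[symmetric] by (intro tendsto_mult norm_lim uzn)
    consider "k > -1" | "k = -1" | "k < -1" by linarith
    then show False
    proof cases
      case 1
      have "(\<lambda>n. cmod (kappa_base \<kappa> (z n)) powr (k+1) * cmod (kappa_base \<kappa> (z n)) powr (-(k+1))) \<longlonglongrightarrow> cmod w * (1 / \<bar>k\<bar>) * 0"
        using 1 by (intro tendsto_mult[OF L] powr_tendsto_0_at_infinity uinf) auto
      moreover have "cmod (kappa_base \<kappa> (z n)) powr (k+1) * cmod (kappa_base \<kappa> (z n)) powr (-(k+1)) = 1" for n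
        using u0[of n] unfolding powr_add[symmetric] by simp
      ultimately show False using LIMSEQ_unique[of "\<lambda>_. 1::real" 0 1] by simp
    next
      case 2
      have "tsallis \<kappa> \<gamma> (z n) * (kappa_base \<kappa> (z n) / z n) = 1" for n
        using u0[of n] z0[of n] exp_kappa_powr[of k "z n"] \<kappa>k 2 True by (simp add: tsallis_def powr_minus)
      moreover have "(\<lambda>n. tsallis \<kappa> \<gamma> (z n) * (kappa_base \<kappa> (z n) / z n)) \<longlonglongrightarrow> w * (1 / of_real k)"
        by (intro tendsto_mult lim uz)
      ultimately have "w * (1 / of_real k) = 1" by (simp add: tendsto_const_iff)
      then show False using 2 w by (auto simp: complex_eq_iff)
    next
      case 3
      have "(\<lambda>n. cmod (kappa_base \<kappa> (z n)) powr (k+1)) \<longlonglongrightarrow> 0"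
        using 3 by (intro powr_tendsto_0_at_infinity uinf) auto
      then have "cmod w * (1 / \<bar>k\<bar>) = 0" using L LIMSEQ_unique by blast
      then show False using \<kappa>k w0 by simp
    qed
  qed
qed

text \<open>
  The condition \<open>y < \<pi>\<close> forces \<open>\<bar>x\<bar> \<rightarrow> \<infinity>\<close>, and \<open>e\<^sup>x\<close> dominates the remaining factor of \<open>f\<close>.
\<close>

lemma no_infinite_limit_infinite_kappa:
  assumes inf: "filterlim (\<lambda>n. cmod (z n)) at_top sequentially" and \<kappa>i: "\<kappa> = \<infinity>"
  shows False
proof -
  have zi: "(\<lambda>n. inverse (z n)) \<longlonglongrightarrow> 0"
    by (rule filterlim_compose[OF tendsto_inverse_0 filterlim_norm_at_top_imp_at_infinity[OF inf]])
  have z0: "z n \<noteq> 0" for n using zpos(1)[of n] by auto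
  have Imz: "0 < Im (z n)" "Im (z n) < pi" for n
    using zpos[of n] \<kappa>i by (auto simp: kappa_theta_infinity)
  have "(\<lambda>n. inverse (z n) + of_real \<gamma>) \<longlonglongrightarrow> 0 + of_real \<gamma>" by (intro tendsto_intros zi)
  moreover have "inverse (z n) + of_real \<gamma> = (1 + of_real \<gamma> * z n) / z n" for n
    using z0[of n] by (simp add: field_simps)
  ultimately have dz: "(\<lambda>n. cmod (1 + of_real \<gamma> * z n) / cmod (z n)) \<longlonglongrightarrow> \<bar>\<gamma>\<bar>"
    using tendsto_norm by (fastforce simp: norm_divide)
  have eq: "cmod (tsallis \<kappa> \<gamma> (z n)) * (cmod (1 + of_real \<gamma> * z n) / cmod (z n)) = exp (Re (z n))" for n
    using norm_eq[of n] z0[of n] \<kappa>i by (simp add: exp_kappa_def field_simps)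
  have L: "(\<lambda>n. exp (Re (z n))) \<longlonglongrightarrow> cmod w * \<bar>\<gamma>\<bar>"
    unfolding eq[symmetric] by (intro tendsto_mult norm_lim dz)
  have bd: "cmod (z n) \<le> \<bar>Re (z n)\<bar> + pi" for n
    using cmod_le[of "z n"] Imz[of n] by simp
  show False
  proof (cases "\<gamma> = 0")
    case False
    then have "(\<lambda>n. ln (exp (Re (z n)))) \<longlonglongrightarrow> ln (cmod w * \<bar>\<gamma>\<bar>)"
      using w0 by (intro tendsto_ln L) auto
    then have "(\<lambda>n. Re (z n)) \<longlonglongrightarrow> ln (cmod w * \<bar>\<gamma>\<bar>)" by simp
    then have "(\<lambda>n. \<bar>Re (z n)\<bar> + pi) \<longlonglongrightarrow> \<bar>ln (cmod w * \<bar>\<gamma>\<bar>)\<bar> + pi" by (intro tendsto_intros)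
    moreover have "filterlim (\<lambda>n. \<bar>Re (z n)\<bar> + pi) at_top sequentially"
      by (rule filterlim_at_top_mono[OF inf]) (use bd in auto)
    ultimately show False using not_tendsto_and_filterlim_at_infinity[of sequentially]
      by (metis filterlim_at_top_imp_at_infinity sequentially_bot)
  next
    case True
    have "(\<lambda>n. exp (Re (z n))) \<longlonglongrightarrow> 0" using L True by simp
    then have "filterlim (\<lambda>n. exp (Re (z n))) (at_right 0) sequentially"
      by (simp add: filterlim_at)
    then have "filterlim (\<lambda>n. ln (exp (Re (z n)))) at_bot sequentially"
      by (rule filterlim_compose[OF ln_at_0])
    then have m: "filterlim (\<lambda>n. - Re (z n)) at_top sequentially"
      by (simp add: filterlim_uminus_at_top)
    have "((\<lambda>x::real. (\<bar>x\<bar> + pi) / exp x) \<longlongrightarrow> 0) at_top"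
    proof -
      have "((\<lambda>x::real. x^1 / exp x + pi * exp (-x)) \<longlongrightarrow> 0 + pi * 0) at_top"
        by (intro tendsto_intros tendsto_power_div_exp_0 filterlim_compose[OF exp_at_bot] filterlim_uminus_at_bot_at_top)
      moreover have "\<forall>\<^sub>F x::real in at_top. x^1 / exp x + pi * exp (-x) = (\<bar>x\<bar> + pi) / exp x"
        using eventually_ge_at_top[of 0] by eventually_elim (simp add: exp_minus field_simps)
      ultimately show ?thesis by (simp add: tendsto_cong)
    qed
    from filterlim_compose[OF this m]
    have "(\<lambda>n. (\<bar>Re (z n)\<bar> + pi) * exp (Re (z n))) \<longlonglongrightarrow> 0" by (simp add: exp_minus divide_inverse)
    moreover have "cmod (tsallis \<kappa> \<gamma> (z n)) \<le> (\<bar>Re (z n)\<bar> + pi) * exp (Re (z n))" for n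
      using norm_eq[of n] True \<kappa>i bd[of n] by (simp add: exp_kappa_def mult_right_mono)
    ultimately have "cmod w \<le> 0" using LIMSEQ_le[OF norm_lim] by blast
    then show False using w0 by simp
  qed
qed

lemma limit_point_in_upper_region:
  assumes l: "z \<longlonglongrightarrow> l" and cond: "existence_condition \<kappa> \<gamma>"
  shows "l \<in> upper_region \<kappa> \<gamma>"
proof -
  have "(\<lambda>n. Im (z n)) \<longlonglongrightarrow> Im l" by (intro tendsto_intros l)
  then have "Im l \<ge> 0" using zpos(1) by (intro LIMSEQ_le_const) (auto intro: less_imp_le)
  moreover have "Im l \<noteq> 0"
  proof
    assume I: "Im l = 0"
    then have lx: "l = of_real (Re l)" by (simp add: complex_eq_iff)
    have nr: "\<not> regular_at \<kappa> \<gamma> l" using finite_limit_regular[OF l I] by blast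
    have u: "kappa_base \<kappa> l \<noteq> 0" using finite_limit_kappa_base_0[OF l _ I] by blast
    have d: "1 + of_real \<gamma> * l \<noteq> 0" using finite_limit_pole[OF l _ u] by blast
    obtain k where k: "\<kappa> = ereal k" "k \<noteq> 0" "k \<notin> \<int>" "kappa_base \<kappa> l \<in> \<real>\<^sub>\<le>\<^sub>0"
      using nr u d \<kappa> by (cases rule: ereal_cases_kappa[OF \<kappa>]) (auto simp: regular_at_def)
    have b: "kappa_base \<kappa> l = of_real (1 + Re l / k)" using k lx by (metis kappa_base_of_real real_of_ereal.simps(1))
    have "1 + Re l / k \<le> 0" using k(4) unfolding b nonpos_Reals_of_real_iff .
    moreover have "1 + Re l / k \<noteq> 0" using u unfolding b by (metis of_real_0)
    ultimately have "1 + Re l / k < 0" by simp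
    moreover have "1 + \<gamma> * Re l \<noteq> 0" using d lx by (metis of_real_0 of_real_1 of_real_add of_real_mult)
    ultimately show False using finite_limit_cut[of "Re l" k] l lx k cond by metis
  qed
  ultimately show ?thesis using finite_limit_nonreal[OF l] by simp
qed

end

text \<open>
  Either infinitely many terms are bounded, and a subsequence converges, or the whole sequence tends to infinity.
\<close>

lemma tsallis_proper_on_upper_region:
  assumes \<kappa>: "\<kappa> \<noteq> 0" "\<kappa> \<noteq> -\<infinity>" and cond: "existence_condition \<kappa> \<gamma>"
    and z: "\<And>n. z n \<in> upper_region \<kappa> \<gamma>"
    and lim: "(\<lambda>n. tsallis \<kappa> \<gamma> (z n)) \<longlonglongrightarrow> w" and w: "Im w > 0"
  shows "\<exists>l\<in>upper_region \<kappa> \<gamma>. \<exists>r. strict_mono r \<and> (z \<circ> r) \<longlonglongrightarrow> l"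
proof -
  interpret upper_sequence \<kappa> \<gamma> z w using assms by unfold_locales auto
  show ?thesis
  proof (cases "\<exists>B. \<exists>\<^sub>\<infinity>n. cmod (z n) \<le> B")
    case True
    then obtain B where "infinite {n. cmod (z n) \<le> B}" by (auto simp: INFM_iff_infinite)
    then obtain r0 :: "nat \<Rightarrow> nat" where r0: "strict_mono r0" "\<And>n. cmod (z (r0 n)) \<le> B"
      using infinite_enumerate by (metis mem_Collect_eq)
    then have "bounded (range (z \<circ> r0))" unfolding bounded_iff by auto
    then obtain l r where lr: "strict_mono r" "((z \<circ> r0) \<circ> r) \<longlonglongrightarrow> l"
      using bounded_imp_convergent_subsequence by blast
    have sm: "strict_mono (r0 \<circ> r)" using r0 lr by (simp add: strict_mono_o)
    have lim': "(z \<circ> (r0 \<circ> r)) \<longlonglongrightarrow> l" using lr(2) by (simp add: o_assoc)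
    interpret s: upper_sequence \<kappa> \<gamma> "z \<circ> (r0 \<circ> r)" w by (rule subsequence[OF sm])
    show ?thesis using s.limit_point_in_upper_region[OF lim' cond] sm lim' by blast
  next
    case False
    then have "\<forall>B. \<forall>\<^sub>F n in sequentially. B < cmod (z n)"
      by (simp add: not_le frequently_def cofinite_eq_sequentially)
    then have "filterlim (\<lambda>n. cmod (z n)) at_top sequentially"
      by (simp add: filterlim_at_top_dense)
    then show ?thesis
      using no_infinite_limit_finite_kappa no_infinite_limit_infinite_kappa
      by (cases rule: ereal_cases_kappa[OF \<kappa>]) auto
  qed
qed

section \<open>Critical points and the behaviour near the real axis\<close>

lemma condition_imp_discriminant:
  assumes "existence_condition \<kappa> \<gamma>"
  shows "\<gamma> \<le> 1 / 4 * (1 + 1 / real_of_ereal \<kappa>)\<^sup>2"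
proof -
  have nn: "0 \<le> 1 / 4 * (1 + 1 / real_of_ereal \<kappa>)\<^sup>2" by simp
  consider "\<gamma> \<le> 1 / 4 * (1 + 1 / real_of_ereal \<kappa>)\<^sup>2" | "\<kappa> = \<infinity>" "\<gamma> \<le> 1/4" | "\<gamma> \<le> 0"
    | "\<kappa> < 0" "-1 < \<kappa>" "\<gamma> \<le> 1 / real_of_ereal \<kappa>"
    using assms unfolding existence_condition_def by auto
  then show ?thesis
  proof cases
    case 3
    then show ?thesis using nn by linarith
  next
    case 4
    then obtain k where "\<kappa> = ereal k" "k < 0" by (cases \<kappa>) auto
    with 4 have "\<gamma> \<le> 1 / k" "1 / k < 0" by auto
    then show ?thesis using nn by linarith
  qed (use nn in auto)
qed

text \<open>
  Nonreal zeros of a real quadratic polynomial occur in conjugate pairs, which requires a negative discriminant.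
\<close>

lemma critical_poly_nonzero_nonreal:
  assumes "\<gamma> \<le> 1 / 4 * (1 + 1 / real_of_ereal \<kappa>)\<^sup>2" "Im z \<noteq> 0"
  shows "critical_poly \<kappa> \<gamma> z \<noteq> 0"
proof
  assume c: "critical_poly \<kappa> \<gamma> z = 0"
  define b where "b = 1 + 1 / real_of_ereal \<kappa>"
  define x where "x = Re z"
  define y where "y = Im z"
  have c': "critical_poly \<kappa> \<gamma> z = of_real \<gamma> * z\<^sup>2 + of_real b * z + 1"
    by (simp add: critical_poly_def b_def)
  have "Im (critical_poly \<kappa> \<gamma> z) = y * (2 * \<gamma> * x + b)"
    unfolding c' by (simp add: x_def y_def power2_eq_square algebra_simps)
  then have b: "b = - 2 * \<gamma> * x" using c assms(2) by (simp add: y_def)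
  have "Re (critical_poly \<kappa> \<gamma> z) = \<gamma> * (x\<^sup>2 - y\<^sup>2) + b * x + 1"
    unfolding c' by (simp add: x_def y_def power2_eq_square algebra_simps)
  then have "\<gamma> * (x\<^sup>2 + y\<^sup>2) = 1" using c unfolding b by (simp add: power2_eq_square algebra_simps)
  then have "\<gamma> * 1 = \<gamma>\<^sup>2 * (x\<^sup>2 + y\<^sup>2)" by (metis mult.assoc power2_eq_square)
  moreover have "\<gamma> \<le> \<gamma>\<^sup>2 * x\<^sup>2" using assms(1) unfolding b_def[symmetric] b by (simp add: power_mult_distrib)
  ultimately have "\<gamma>\<^sup>2 * y\<^sup>2 \<le> 0" by (simp add: distrib_left)
  moreover have "\<gamma> \<noteq> 0" using \<open>\<gamma> * (x\<^sup>2 + y\<^sup>2) = 1\<close> by auto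
  ultimately show False using assms(2) by (simp add: y_def mult_le_0_iff)
qed

lemma deriv_tsallis:
  assumes \<kappa>: "\<kappa> \<noteq> 0" "\<kappa> \<noteq> -\<infinity>" and reg: "regular_at \<kappa> \<gamma> z"
  shows "deriv (tsallis \<kappa> \<gamma>) z = exp_kappa \<kappa> z * critical_poly \<kappa> \<gamma> z / ((1 + of_real \<gamma> * z)\<^sup>2 * kappa_base \<kappa> z)"
    and "deriv (tsallis \<kappa> \<gamma>) z = 0 \<longleftrightarrow> critical_poly \<kappa> \<gamma> z = 0"
proof -
  show *: "deriv (tsallis \<kappa> \<gamma>) z = exp_kappa \<kappa> z * critical_poly \<kappa> \<gamma> z / ((1 + of_real \<gamma> * z)\<^sup>2 * kappa_base \<kappa> z)"
    using tsallis_has_derivative[OF assms] by (rule DERIV_imp_deriv)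
  show "deriv (tsallis \<kappa> \<gamma>) z = 0 \<longleftrightarrow> critical_poly \<kappa> \<gamma> z = 0"
    using reg exp_kappa_nonzero[OF \<kappa>, of z] unfolding * regular_at_def by simp
qed

text \<open>
  On a vertical segment starting at a real point, the derivative of \<open>Im f\<close> is \<open>Re f'\<close>.
\<close>

lemma Im_pos_of_derivative_pos:
  fixes f :: "complex \<Rightarrow> complex" and x :: real
  assumes hol: "f holomorphic_on S" and "open S" "of_real x \<in> S"
    and pos: "Re (deriv f (of_real x)) > 0"
    and real: "\<And>t. of_real t \<in> S \<Longrightarrow> Im (f (of_real t)) = 0"
  shows "\<exists>r>0. ball (of_real x) r \<subseteq> S \<and> (\<forall>z\<in>ball (of_real x) r. Im z > 0 \<longrightarrow> Im (f z) > 0)"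
proof -
  have "continuous_on S (deriv f)"
    by (simp add: assms holomorphic_deriv holomorphic_on_imp_continuous_on)
  then have "isCont (deriv f) (of_real x)" using assms continuous_on_eq_continuous_at by blast
  then have "isCont (\<lambda>z. Re (deriv f z)) (of_real x)" by (simp add: isCont_def tendsto_Re)
  then have "((\<lambda>z. Re (deriv f z)) \<longlongrightarrow> Re (deriv f (of_real x))) (nhds (of_real x))"
    using tendsto_at_iff_tendsto_nhds[of "\<lambda>z. Re (deriv f z)" "of_real x"] by (simp only: isCont_def)
  then have "\<forall>\<^sub>F z in nhds (of_real x). Re (deriv f z) > 0" by (rule order_tendstoD(1)) (rule pos)
  moreover have "\<forall>\<^sub>F z in nhds (of_real x). z \<in> S" using assms eventually_nhds_in_open by blast
  ultimately have "\<forall>\<^sub>F z in nhds (of_real x). Re (deriv f z) > 0 \<and> z \<in> S" by eventually_elim simp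
  then obtain r where r: "r > 0" "\<And>z. z \<in> ball (of_real x) r \<Longrightarrow> Re (deriv f z) > 0 \<and> z \<in> S"
    by (auto simp: eventually_nhds_metric dist_commute)
  have "Im (f z) > 0" if z: "z \<in> ball (of_real x) r" "Im z > 0" for z
  proof -
    define p where "p t = of_real (Re z) + \<i> * of_real t" for t
    have pb: "p t \<in> ball (of_real x) r" if "0 \<le> t" "t \<le> Im z" for t
    proof -
      have "cmod (of_real x - p t) \<le> cmod (of_real x - z)"
        using that unfolding p_def cmod_def by (intro real_sqrt_le_mono) (auto intro!: power_mono)
      then show ?thesis using z by (simp add: dist_norm)
    qed
    have "Im (f (p 0)) < Im (f (p (Im z)))"
    proof (rule DERIV_pos_imp_increasing[OF z(2)])
      fix t assume t: "0 \<le> t" "t \<le> Im z"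
      have 1: "(p has_vector_derivative \<i>) (at t)"
        unfolding p_def by (auto intro!: derivative_eq_intros simp: has_vector_derivative_def scaleR_conv_of_real mult.commute)
      have 2: "(f has_field_derivative deriv f (p t)) (at (p t))"
        using hol \<open>open S\<close> r(2)[OF pb[OF t]] holomorphic_derivI by blast
      have "((\<lambda>t. f (p t)) has_vector_derivative \<i> * deriv f (p t)) (at t)"
        using field_vector_diff_chain_at[OF 1 2] by (simp add: o_def)
      from bounded_linear.has_vector_derivative[OF bounded_linear_Im this]
      have "((\<lambda>t. Im (f (p t))) has_real_derivative Re (deriv f (p t))) (at t)"
        by (simp add: has_real_derivative_iff_has_vector_derivative)
      then show "\<exists>y. ((\<lambda>t. Im (f (p t))) has_real_derivative y) (at t) \<and> 0 < y"
        using r(2)[OF pb[OF t]] by blast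
    qed
    moreover have "p (Im z) = z" by (simp add: p_def complex_eq_iff)
    moreover have "Im (f (p 0)) = 0"
      using real[of "Re z"] r(2)[OF pb[of 0]] z by (simp add: p_def)
    ultimately show ?thesis by simp
  qed
  then show ?thesis using r by blast
qed

text \<open>
  At these real points \<open>f\<close> has positive derivative, and the upper side of the real axis belongs to the part
  \<open>\<kappa>\<theta> < \<pi>\<close> of the upper half-plane: there \<open>\<kappa>\<theta>\<close> tends to \<open>0\<close>, or \<open>\<bar>\<kappa>\<bar> = 1\<close>.
\<close>

definition increasing_point :: "ereal \<Rightarrow> real \<Rightarrow> real \<Rightarrow> bool" where
  "increasing_point \<kappa> \<gamma> x \<longleftrightarrow> regular_at \<kappa> \<gamma> (of_real x) \<and> Re (critical_poly \<kappa> \<gamma> (of_real x)) > 0 \<and>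
     (1 + x / real_of_ereal \<kappa> > 0 \<or> \<bar>real_of_ereal \<kappa>\<bar> = 1)"

lemma increasing_point_0: "increasing_point \<kappa> \<gamma> 0"
  unfolding increasing_point_def by (simp add: critical_poly_def)

lemma regular_real_value:
  assumes "\<kappa> \<noteq> 0" "\<kappa> \<noteq> -\<infinity>" "regular_at \<kappa> \<gamma> (of_real x)"
  shows "Im (tsallis \<kappa> \<gamma> (of_real x)) = 0"
  using tsallis_real[OF assms] by (simp add: complex_is_Real_iff)

lemma half_ball_upper_region:
  assumes \<kappa>: "\<kappa> \<noteq> 0" "\<kappa> \<noteq> -\<infinity>" and good: "increasing_point \<kappa> \<gamma> x"
  shows "\<exists>r>0. (\<forall>z\<in>ball (of_real x) r. regular_at \<kappa> \<gamma> z) \<and>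
            (\<forall>z\<in>ball (of_real x) r. Im z > 0 \<longrightarrow> z \<in> upper_region \<kappa> \<gamma>)"
proof -
  define K where "K = real_of_ereal \<kappa>"
  define u where "u = 1 + x / K"
  have reg: "regular_at \<kappa> \<gamma> (of_real x)" and c: "Re (critical_poly \<kappa> \<gamma> (of_real x)) > 0"
    and uK: "u > 0 \<or> \<bar>K\<bar> = 1"
    using good by (auto simp: increasing_point_def u_def K_def)
  have b: "kappa_base \<kappa> (of_real x) = of_real u" by (simp add: kappa_base_of_real u_def K_def)
  have u0: "u \<noteq> 0" using reg b by (auto simp: regular_at_def)
  have e: "Re (exp_kappa \<kappa> (of_real x)) / u > 0"
    using \<kappa>
  proof (cases rule: ereal_cases_kappa)
    case 1
    then show ?thesis by (simp add: exp_kappa_def u_def K_def exp_of_real)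
  next
    case (2 k)
    have ek: "exp_kappa \<kappa> (of_real x) = of_real u powr of_real k"
      using exp_kappa_powr[of k "of_real x"] 2 u0 b by simp
    show ?thesis
    proof (cases "u > 0")
      case True then show ?thesis unfolding ek by (simp add: powr_of_real)
    next
      case False
      then have "k = 1 \<or> k = -1" using uK 2 by (auto simp: K_def abs_if split: if_splits)
      then show ?thesis
      proof
        assume "k = -1"
        then have "exp_kappa \<kappa> (of_real x) = of_real (1 / u)"
          unfolding ek using u0 by (simp add: powr_minus divide_inverse)
        then show ?thesis using u0 by (simp add: zero_less_divide_iff zero_less_mult_iff) linarith
      qed (use u0 ek in simp)
    qed
  qed
  have dg: "1 + \<gamma> * x \<noteq> 0"
    using reg unfolding regular_at_def by (metis of_real_0 of_real_1 of_real_add of_real_mult)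
  have er: "exp_kappa \<kappa> (of_real x) = of_real (Re (exp_kappa \<kappa> (of_real x)))"
    using exp_kappa_real[OF \<kappa> reg] by simp
  have cr: "critical_poly \<kappa> \<gamma> (of_real x) = of_real (Re (critical_poly \<kappa> \<gamma> (of_real x)))"
    by (simp add: critical_poly_real)
  have "deriv (tsallis \<kappa> \<gamma>) (of_real x) =
      of_real (Re (exp_kappa \<kappa> (of_real x)) / u * (Re (critical_poly \<kappa> \<gamma> (of_real x)) / (1 + \<gamma> * x)\<^sup>2))"
    unfolding deriv_tsallis(1)[OF \<kappa> reg] b by (subst er, subst cr) simp
  then have "Re (deriv (tsallis \<kappa> \<gamma>) (of_real x)) =
      Re (exp_kappa \<kappa> (of_real x)) / u * (Re (critical_poly \<kappa> \<gamma> (of_real x)) / (1 + \<gamma> * x)\<^sup>2)"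
    by (simp only: Re_complex_of_real)
  also have "\<dots> > 0" using dg by (intro mult_pos_pos e divide_pos_pos c) simp
  finally have pos: "Re (deriv (tsallis \<kappa> \<gamma>) (of_real x)) > 0" .
  have "tsallis \<kappa> \<gamma> holomorphic_on {z. regular_at \<kappa> \<gamma> z}"
    by (rule tsallis_holomorphic[OF \<kappa>]) simp
  from Im_pos_of_derivative_pos[OF this open_regular _ pos] reg regular_real_value[OF \<kappa>]
  obtain r where r: "r > 0" "ball (of_real x) r \<subseteq> {z. regular_at \<kappa> \<gamma> z}"
    "\<forall>z\<in>ball (of_real x) r. Im z > 0 \<longrightarrow> Im (tsallis \<kappa> \<gamma> z) > 0" by auto
  have "\<exists>s>0. \<forall>z\<in>ball (of_real x) s. Im z > 0 \<longrightarrow> kappa_theta \<kappa> (Re z) (Im z) < pi"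
  proof (cases "u > 0")
    case True
    have "\<kappa> = \<infinity> \<or> kappa_base \<kappa> (of_real x) \<notin> \<real>\<^sub>\<le>\<^sub>0" using True unfolding b nonpos_Reals_of_real_iff by simp
    from isCont_kappa_theta[OF \<kappa> this]
    have "((\<lambda>z. kappa_theta \<kappa> (Re z) (Im z)) \<longlongrightarrow> kappa_theta \<kappa> x 0) (nhds (of_real x))"
      using tendsto_at_iff_tendsto_nhds[of "\<lambda>z. kappa_theta \<kappa> (Re z) (Im z)" "of_real x"] by (simp add: isCont_def)
    moreover have "kappa_theta \<kappa> x 0 = 0"
    proof (cases rule: ereal_cases_kappa[OF \<kappa>])
      case (2 k)
      have "Complex x 0 = of_real x" by (simp add: complex_eq_iff)
      then show ?thesis using kappa_theta_finite[of k "of_real x"] 2 b True by (simp add: Arg_of_real)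
    qed (simp add: kappa_theta_infinity)
    ultimately have "\<forall>\<^sub>F z in nhds (of_real x). kappa_theta \<kappa> (Re z) (Im z) < pi"
      by (intro order_tendstoD(2)) auto
    then show ?thesis by (auto simp: eventually_nhds_metric dist_commute)
  next
    case False
    then have "\<bar>K\<bar> = 1" using uK by simp
    then show ?thesis using kappa_theta_less_pi \<kappa>
      by (cases rule: ereal_cases_kappa[OF \<kappa>]) (auto simp: K_def intro!: exI[of _ "1::real"])
  qed
  then obtain s where s: "s > 0" "\<forall>z\<in>ball (of_real x) s. Im z > 0 \<longrightarrow> kappa_theta \<kappa> (Re z) (Im z) < pi" by blast
  show ?thesis
    by (rule exI[of _ "min r s"]) (use r s in \<open>auto simp: upper_region_def\<close>)
qed

text \<open>
  The sign in the lower half of the ball follows from that in the upper half by reflection. A local inverse of \<open>f\<close>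
  at the centre therefore respects the two sides of the real axis.
\<close>

lemma sign_Im_tsallis:
  assumes \<kappa>: "\<kappa> \<noteq> 0" "\<kappa> \<noteq> -\<infinity>"
    and reg: "\<And>z. z \<in> ball (of_real x) r \<Longrightarrow> regular_at \<kappa> \<gamma> z"
    and up: "\<And>z. z \<in> ball (of_real x) r \<Longrightarrow> Im z > 0 \<Longrightarrow> z \<in> upper_region \<kappa> \<gamma>"
    and z: "z \<in> ball (of_real x) r"
  shows "sgn (Im (tsallis \<kappa> \<gamma> z)) = sgn (Im z)"
proof -
  consider "Im z > 0" | "Im z = 0" | "Im z < 0" by linarith
  then show ?thesis
  proof cases
    case 1 then show ?thesis using up[OF z] by (simp add: upper_region_def)
  next
    case 2
    then have "z \<in> \<real>" by (simp add: complex_is_Real_iff)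
    then show ?thesis using 2 tsallis_real[OF \<kappa> reg[OF z]] by (simp add: complex_is_Real_iff)
  next
    case 3
    have "cnj (of_real x - z) = of_real x - cnj z" by simp
    then have "cmod (of_real x - cnj z) = cmod (of_real x - z)" by (metis complex_mod_cnj)
    then have "cnj z \<in> ball (of_real x) r" using z by (simp add: dist_norm)
    then have "Im (tsallis \<kappa> \<gamma> (cnj z)) > 0" using up[of "cnj z"] 3 by (simp add: upper_region_def)
    then show ?thesis using 3 tsallis_cnj[OF \<kappa> reg[OF z]] by simp
  qed
qed

lemma open_upper_region:
  assumes \<kappa>: "\<kappa> \<noteq> 0" "\<kappa> \<noteq> -\<infinity>"
  shows "open (upper_region \<kappa> \<gamma>)"
    and "open {z. Im z > 0 \<and> kappa_theta \<kappa> (Re z) (Im z) > pi}"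
proof -
  let ?H = "{z. Im z > 0}"
  have oH: "open ?H" by (rule open_halfspace_Im_gt)
  have c1: "continuous_on ?H (\<lambda>z. kappa_theta \<kappa> (Re z) (Im z))"
  proof (rule continuous_at_imp_continuous_on, safe)
    fix z assume "Im z > 0"
    then have "\<kappa> = \<infinity> \<or> kappa_base \<kappa> z \<notin> \<real>\<^sub>\<le>\<^sub>0"
      using Im_kappa_base[of \<kappa> z] by (cases rule: ereal_cases_kappa[OF \<kappa>]) (auto simp: complex_nonpos_Reals_iff)
    then show "isCont (\<lambda>z. kappa_theta \<kappa> (Re z) (Im z)) z" by (rule isCont_kappa_theta[OF \<kappa>])
  qed
  have "tsallis \<kappa> \<gamma> holomorphic_on ?H" using regular_nonreal[OF \<kappa>] by (intro tsallis_holomorphic[OF \<kappa>]) auto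
  then have c2: "continuous_on ?H (\<lambda>z. Im (tsallis \<kappa> \<gamma> z))"
    by (intro continuous_intros holomorphic_on_imp_continuous_on)
  have "upper_region \<kappa> \<gamma> = (?H \<inter> (\<lambda>z. kappa_theta \<kappa> (Re z) (Im z)) -` {..<pi}) \<inter> (?H \<inter> (\<lambda>z. Im (tsallis \<kappa> \<gamma> z)) -` {0<..})"
    by (auto simp: upper_region_def)
  then show "open (upper_region \<kappa> \<gamma>)"
    using continuous_open_preimage[OF c1 oH open_lessThan] continuous_open_preimage[OF c2 oH open_greaterThan]
    by auto
  have "{z. Im z > 0 \<and> kappa_theta \<kappa> (Re z) (Im z) > pi} = ?H \<inter> (\<lambda>z. kappa_theta \<kappa> (Re z) (Im z)) -` {pi<..}" by auto
  then show "open {z. Im z > 0 \<and> kappa_theta \<kappa> (Re z) (Im z) > pi}"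
    using continuous_open_preimage[OF c1 oH open_greaterThan] by auto
qed

lemma increasing_point_local_inverse:
  assumes \<kappa>: "\<kappa> \<noteq> 0" "\<kappa> \<noteq> -\<infinity>" and good: "increasing_point \<kappa> \<gamma> x" and "s > 0"
  obtains V h where "open V" "of_real x \<in> V" "V \<subseteq> ball (of_real x) s" "\<forall>v\<in>V. regular_at \<kappa> \<gamma> v"
    "open (tsallis \<kappa> \<gamma> ` V)" "h holomorphic_on tsallis \<kappa> \<gamma> ` V"
    "\<forall>v\<in>V. h (tsallis \<kappa> \<gamma> v) = v"
    "\<forall>v\<in>V. sgn (Im (tsallis \<kappa> \<gamma> v)) = sgn (Im v)"
    "\<forall>v\<in>V. Im v > 0 \<longrightarrow> v \<in> upper_region \<kappa> \<gamma>"
proof -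
  obtain r where r: "r > 0" "\<And>z. z\<in>ball (of_real x) r \<Longrightarrow> regular_at \<kappa> \<gamma> z"
     "\<And>z. z\<in>ball (of_real x) r \<Longrightarrow> Im z > 0 \<Longrightarrow> z \<in> upper_region \<kappa> \<gamma>"
    using half_ball_upper_region[OF \<kappa> good] by blast
  define S where "S = ball (complex_of_real x) (min r s)"
  have hol: "tsallis \<kappa> \<gamma> holomorphic_on S"
    by (rule tsallis_holomorphic[OF \<kappa>]) (auto simp: S_def intro!: r(2))
  have reg: "regular_at \<kappa> \<gamma> (of_real x)" and "critical_poly \<kappa> \<gamma> (of_real x) \<noteq> 0"
    using good by (auto simp: increasing_point_def)
  then have dnz: "deriv (tsallis \<kappa> \<gamma>) (of_real x) \<noteq> 0" using deriv_tsallis(2)[OF \<kappa> reg] by simp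
  have xS: "of_real x \<in> S" "open S" using r(1) \<open>s > 0\<close> by (auto simp: S_def)
  obtain V h where V: "open V" "of_real x \<in> V" "V \<subseteq> S" "open (tsallis \<kappa> \<gamma> ` V)" "inj_on (tsallis \<kappa> \<gamma>) V"
      "h holomorphic_on tsallis \<kappa> \<gamma> ` V" "\<And>z. z \<in> V \<Longrightarrow> h (tsallis \<kappa> \<gamma> z) = z"
    using holomorphic_local_inverse[OF hol xS(2,1) dnz] by blast
  have "V \<subseteq> ball (of_real x) s" "V \<subseteq> ball (of_real x) r" using V(3) by (auto simp: S_def)
  then show ?thesis
    using V r(2,3) sign_Im_tsallis[OF \<kappa> r(2,3)] by (intro that[of V h] ballI impI) blast+
qed

section \<open>The section over the upper half-plane and the component Omega\<close>

lemma connected_clopen_cases: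
  assumes "connected A" "open U" "open V" "A \<subseteq> U \<union> V" "U \<inter> V = {}"
  shows "A \<subseteq> U \<or> A \<inter> U = {}"
  using connectedD[OF assms(1-3)] assms(4,5) by blast

lemma ball_cnj_iff: "cnj z \<in> ball (cnj p) r \<longleftrightarrow> z \<in> ball p r"
proof -
  have "cnj (p - z) = cnj p - cnj z" by simp
  then have "cmod (cnj p - cnj z) = cmod (p - z)" by (metis complex_mod_cnj)
  then show ?thesis by (simp add: dist_norm)
qed

lemma ball_real_cnj_iff: "cnj z \<in> ball (of_real x) r \<longleftrightarrow> z \<in> ball (of_real x) r"
  using ball_cnj_iff[of z "of_real x" r] by simp

lemma ball_upper_half_convex: "convex (ball p r \<inter> {z. Im z > 0})"
  by (intro convex_Int convex_ball convex_halfspace_Im_gt)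

lemma upper_half_islimpt: "complex_of_real x islimpt {z. Im z > 0}"
  unfolding islimpt_approachable
proof (intro allI impI)
  fix e :: real assume "e > 0"
  then show "\<exists>z\<in>{z. Im z > 0}. z \<noteq> of_real x \<and> dist z (of_real x) < e"
    by (intro bexI[of _ "of_real x + \<i> * of_real (e/2)"]) (auto simp: dist_norm norm_mult complex_eq_iff)
qed

lemma upper_half_at_within_nontrivial: "at (complex_of_real x) within {z. Im z > 0} \<noteq> bot"
  using upper_half_islimpt by (simp add: trivial_limit_within)

text \<open>
  A right inverse of \<open>f\<close> on the upper half-plane that continues the local inverse at \<open>0\<close>. The last
  assumption says that near \<open>0\<close> it is also a left inverse.
\<close>

locale tsallis_section =
  fixes \<kappa> :: ereal and \<gamma> :: real and g :: "complex \<Rightarrow> complex"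
  assumes \<kappa>: "\<kappa> \<noteq> 0" "\<kappa> \<noteq> -\<infinity>"
    and cond: "existence_condition \<kappa> \<gamma>"
    and g_hol: "g holomorphic_on {w. Im w > 0}"
    and g_upper: "\<And>w. Im w > 0 \<Longrightarrow> g w \<in> upper_region \<kappa> \<gamma>"
    and g_inv: "\<And>w. Im w > 0 \<Longrightarrow> tsallis \<kappa> \<gamma> (g w) = w"
    and g_0: "(g \<longlongrightarrow> 0) (at 0 within {w. Im w > 0})"
    and near_0: "\<exists>r>0. \<forall>z\<in>ball 0 r. Im z > 0 \<longrightarrow> g (tsallis \<kappa> \<gamma> z) = z"

text \<open>
  The section of the covering is chosen through a point \<open>z0\<close> close to \<open>0\<close>. It then agrees with the local inverse \<open>h\<close>
  near \<open>f z0\<close>, because \<open>f\<close> is injective near \<open>z0\<close>, and by the identity theorem on a half-disc at \<open>0\<close>.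
\<close>

lemma tsallis_section_exists:
  assumes \<kappa>: "\<kappa> \<noteq> 0" "\<kappa> \<noteq> -\<infinity>" and cond: "existence_condition \<kappa> \<gamma>"
  shows "\<exists>g. tsallis_section \<kappa> \<gamma> g"
proof -
  let ?f = "tsallis \<kappa> \<gamma>" and ?H = "{w. Im w > (0::real)}"
  obtain V h where V: "open V" "of_real 0 \<in> V" "V \<subseteq> ball (of_real 0) 1" "\<forall>v\<in>V. regular_at \<kappa> \<gamma> v"
    and fV: "open (?f ` V)" "h holomorphic_on ?f ` V" "\<forall>v\<in>V. h (?f v) = v"
    and sgnV: "\<forall>v\<in>V. sgn (Im (?f v)) = sgn (Im v)"
    and upV: "\<forall>v\<in>V. Im v > 0 \<longrightarrow> v \<in> upper_region \<kappa> \<gamma>"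
    by (rule increasing_point_local_inverse[OF \<kappa> increasing_point_0[of \<kappa> \<gamma>] zero_less_one])
  have V_0: "0 \<in> V" using V(2) by simp
  have "0 \<in> ?f ` V" using V_0 by (intro image_eqI[of _ _ 0]) simp_all
  then obtain \<epsilon> where \<epsilon>: "\<epsilon> > 0" "ball 0 \<epsilon> \<subseteq> ?f ` V"
    using fV(1) unfolding open_contains_ball by blast
  define w0 where "w0 = \<i> * of_real (\<epsilon> / 2)"
  have w0: "w0 \<in> ball 0 \<epsilon>" "Im w0 > 0" using \<epsilon> by (auto simp: w0_def norm_mult)
  then obtain z0 where z0: "z0 \<in> V" "?f z0 = w0" using \<epsilon> by auto
  have "Im z0 > 0" using bspec[OF sgnV z0(1)] w0(2) z0(2) by (simp add: sgn_if split: if_splits)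
  then have z0u: "z0 \<in> upper_region \<kappa> \<gamma>" using upV z0 by blast
  have regH: "regular_at \<kappa> \<gamma> z" if "z \<in> upper_region \<kappa> \<gamma>" for z
    using that by (intro regular_nonreal[OF \<kappa>]) (auto simp: upper_region_def)
  have hol: "?f holomorphic_on upper_region \<kappa> \<gamma>"
    by (rule tsallis_holomorphic[OF \<kappa>]) (rule regH)
  have dnz: "deriv ?f z \<noteq> 0" if "z \<in> upper_region \<kappa> \<gamma>" for z
  proof -
    have "Im z \<noteq> 0" using that by (auto simp: upper_region_def)
    then have "critical_poly \<kappa> \<gamma> z \<noteq> 0" by (rule critical_poly_nonzero_nonreal[OF condition_imp_discriminant[OF cond]])
    then show ?thesis using deriv_tsallis(2)[OF \<kappa> regH[OF that]] by simp
  qed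
  have im: "?f ` upper_region \<kappa> \<gamma> \<subseteq> ?H" by (auto simp: upper_region_def)
  have proper: "\<exists>l\<in>upper_region \<kappa> \<gamma>. \<exists>r. strict_mono r \<and> (z \<circ> r) \<longlonglongrightarrow> l"
    if "\<And>n::nat. z n \<in> upper_region \<kappa> \<gamma>" "(\<lambda>n. ?f (z n)) \<longlonglongrightarrow> w" "w \<in> ?H" for z w
    using tsallis_proper_on_upper_region[OF \<kappa> cond that(1,2)] that(3) by simp
  obtain g where g: "g holomorphic_on ?H" "g ` ?H \<subseteq> upper_region \<kappa> \<gamma>" "g (?f z0) = z0"
      "\<forall>w\<in>?H. ?f (g w) = w"
    by (rule proper_local_biholomorphism_section[OF open_upper_region(1)[OF \<kappa>] hol open_halfspace_Im_gt
        convex_halfspace_Im_gt im z0u dnz proper])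
  define A where "A = ball 0 \<epsilon> \<inter> ?H"
  have A: "open A" "connected A" "w0 \<in> A"
    using w0 ball_upper_half_convex[of 0 \<epsilon>] by (auto simp: A_def convex_connected open_halfspace_Im_gt open_Int)
  have gA: "g holomorphic_on A" by (rule holomorphic_on_subset[OF g(1)]) (auto simp: A_def)
  have hA: "h holomorphic_on A" by (rule holomorphic_on_subset[OF fV(2)]) (use \<epsilon>(2) in \<open>auto simp: A_def\<close>)
  have oAV: "open (A \<inter> g -` V)"
    by (rule continuous_open_preimage[OF holomorphic_on_imp_continuous_on[OF gA] A(1) V(1)])
  have gh: "g w = h w" if "w \<in> A" for w
  proof (rule analytic_continuation_open[OF oAV A(1) _ A(2) _ gA hA _ that])
    show "A \<inter> g -` V \<noteq> {}" using A(3) g(3) z0 by auto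
    show "g v = h v" if "v \<in> A \<inter> g -` V" for v
    proof -
      have "?f (g v) = v" using that g(4) by (auto simp: A_def)
      then show ?thesis using bspec[OF fV(3), of "g v"] that by auto
    qed
  qed auto
  have "isCont h 0"
    using fV(1,2) \<open>0 \<in> ?f ` V\<close> holomorphic_on_imp_continuous_on continuous_on_eq_continuous_at by blast
  moreover have h0: "h 0 = 0" using bspec[OF fV(3) V_0] by simp
  ultimately have "(h \<longlongrightarrow> 0) (at 0 within ?H)"
    using continuous_at_imp_continuous_at_within[of 0 h ?H] by (simp add: continuous_within)
  moreover have "\<forall>\<^sub>F w in at 0 within ?H. h w = g w"
    using \<epsilon>(1) gh unfolding eventually_at by (intro exI[of _ \<epsilon>]) (auto simp: A_def)
  ultimately have g0: "(g \<longlongrightarrow> 0) (at 0 within ?H)" by (simp add: tendsto_cong)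
  have "\<exists>r>0. \<forall>z\<in>ball 0 r. Im z > 0 \<longrightarrow> g (?f z) = z"
  proof -
    have "?f holomorphic_on V" by (rule tsallis_holomorphic[OF \<kappa>]) (use V(4) in blast)
    then have "open (V \<inter> ?f -` ball 0 \<epsilon>)"
      using V(1) by (intro continuous_open_preimage holomorphic_on_imp_continuous_on) auto
    moreover have "0 \<in> V \<inter> ?f -` ball 0 \<epsilon>" using V_0 \<epsilon> by simp
    ultimately obtain r where r: "r > 0" "ball 0 r \<subseteq> V \<inter> ?f -` ball 0 \<epsilon>"
      unfolding open_contains_ball by blast
    have "g (?f z) = z" if "z \<in> ball 0 r" "Im z > 0" for z
    proof -
      have zV: "z \<in> V" "?f z \<in> ball 0 \<epsilon>" using that r by auto
      then have "?f z \<in> A" using bspec[OF sgnV zV(1)] that(2) by (auto simp: A_def sgn_if split: if_splits)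
      then show ?thesis using gh bspec[OF fV(3) zV(1)] by simp
    qed
    then show ?thesis using r(1) by blast
  qed
  then have "tsallis_section \<kappa> \<gamma> g"
    using \<kappa> cond g g0 by unfold_locales auto
  then show ?thesis by blast
qed

context tsallis_section
begin

abbreviation "f \<equiv> tsallis \<kappa> \<gamma>"
abbreviation "H \<equiv> {w. Im w > (0::real)}"

definition sheet :: "complex set" where "sheet = g ` H"

text \<open>
  This presents the sheet as the solution set of an equation between continuous functions, so it is relatively closed
  in the upper region; it is open as the image of an injective holomorphic map.
\<close>

lemma sheet_iff: "z \<in> sheet \<longleftrightarrow> z \<in> upper_region \<kappa> \<gamma> \<and> g (f z) = z"
proof
  assume "z \<in> sheet"
  then obtain w where "Im w > 0" "z = g w" by (auto simp: sheet_def)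
  then show "z \<in> upper_region \<kappa> \<gamma> \<and> g (f z) = z" using g_upper g_inv by simp
next
  assume "z \<in> upper_region \<kappa> \<gamma> \<and> g (f z) = z"
  then show "z \<in> sheet" unfolding sheet_def upper_region_def by (metis (mono_tags, lifting) imageI mem_Collect_eq)
qed

lemma sheet_Im_pos: "z \<in> sheet \<Longrightarrow> Im z > 0" by (simp add: sheet_iff upper_region_def)

lemma open_sheet: "open sheet"
  unfolding sheet_def
proof (rule open_mapping_thm3[OF g_hol open_halfspace_Im_gt])
  show "inj_on g H" by (rule inj_on_inverseI[of _ f]) (use g_inv in auto)
qed

lemma open_upper_minus_sheet: "open (upper_region \<kappa> \<gamma> - sheet)"
proof -
  have hol: "f holomorphic_on upper_region \<kappa> \<gamma>"
    by (rule tsallis_holomorphic[OF \<kappa>], rule regular_nonreal[OF \<kappa>]) (auto simp: upper_region_def)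
  have "continuous_on (upper_region \<kappa> \<gamma>) (\<lambda>z. g (f z))"
    by (rule continuous_on_compose2[OF holomorphic_on_imp_continuous_on[OF g_hol] holomorphic_on_imp_continuous_on[OF hol]])
      (auto simp: upper_region_def)
  then have "continuous_on (upper_region \<kappa> \<gamma>) (\<lambda>z. g (f z) - z)" by (intro continuous_intros)
  from continuous_open_preimage[OF this open_upper_region(1)[OF \<kappa>], of "-{0}"]
  have "open (upper_region \<kappa> \<gamma> \<inter> (\<lambda>z. g (f z) - z) -` (-{0}))" by (simp add: open_Compl)
  moreover have "upper_region \<kappa> \<gamma> - sheet = upper_region \<kappa> \<gamma> \<inter> (\<lambda>z. g (f z) - z) -` (-{0})"
    by (auto simp: sheet_iff)
  ultimately show ?thesis by simp
qed

definition sym_sheet :: "complex set" where "sym_sheet = {z. z \<in> sheet \<or> cnj z \<in> sheet}"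

text \<open>
  Both sets are open, they are disjoint, and together they turn out to cover the positive region, so that the component
  \<open>\<Omega>\<close> lies in one of them. Real points enter through the behaviour of the nonreal points near them; they belong to no sheet.
\<close>

definition inside :: "complex set" where "inside = {p. \<exists>r>0. \<forall>z\<in>ball p r. Im z \<noteq> 0 \<longrightarrow> z \<in> sym_sheet}"
definition outside :: "complex set" where "outside = {p. \<exists>r>0. \<forall>z\<in>ball p r. z \<notin> sym_sheet}"

lemma sym_sheet_cnj: "cnj z \<in> sym_sheet \<longleftrightarrow> z \<in> sym_sheet" by (auto simp: sym_sheet_def)

lemma open_local_ball_condition:
  "open {p::complex. \<exists>r>0. \<forall>z\<in>ball p r. P z}"
proof -
  have "{p::complex. \<exists>r>0. \<forall>z\<in>ball p r. P z} = interior {z. P z}"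
    by (rule set_eqI) (simp add: mem_interior subset_eq)
  then show ?thesis by simp
qed

lemma open_inside: "open inside" and open_outside: "open outside"
  unfolding inside_def outside_def by (rule open_local_ball_condition)+

lemma inside_outside_disjoint: "inside \<inter> outside = {}"
proof (rule ccontr)
  assume "inside \<inter> outside \<noteq> {}"
  then obtain p r s where r: "r > 0" "\<forall>z\<in>ball p r. Im z \<noteq> 0 \<longrightarrow> z \<in> sym_sheet"
    and s: "s > 0" "\<forall>z\<in>ball p s. z \<notin> sym_sheet" by (auto simp: inside_def outside_def)
  define t where "t = min r s / 2"
  define z where "z = (if Im p = 0 then p + \<i> * of_real t else p)"
  have t: "t > 0" "t < r" "t < s" using r s by (auto simp: t_def)
  then have "Im z \<noteq> 0" "z \<in> ball p r" "z \<in> ball p s"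
    by (auto simp: z_def dist_norm norm_mult)
  then show False using r s by blast
qed

lemma inside_cnj: "cnj p \<in> inside \<longleftrightarrow> p \<in> inside"
proof -
  have "cnj p \<in> inside" if p: "p \<in> inside" for p
  proof -
    obtain r where r: "r > 0" "\<And>z. z\<in>ball p r \<Longrightarrow> Im z \<noteq> 0 \<Longrightarrow> z \<in> sym_sheet" using p by (auto simp: inside_def)
    have "z \<in> sym_sheet" if "z \<in> ball (cnj p) r" "Im z \<noteq> 0" for z
      using r(2)[of "cnj z"] that ball_cnj_iff[of "cnj z" p r] sym_sheet_cnj[of z] by simp
    then show ?thesis using r(1) unfolding inside_def by blast
  qed
  from this[of p] this[of "cnj p"] show ?thesis by auto
qed

lemma outside_cnj: "cnj p \<in> outside \<longleftrightarrow> p \<in> outside"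
proof -
  have "cnj p \<in> outside" if p: "p \<in> outside" for p
  proof -
    obtain r where r: "r > 0" "\<And>z. z\<in>ball p r \<Longrightarrow> z \<notin> sym_sheet" using p by (auto simp: outside_def)
    have "z \<notin> sym_sheet" if "z \<in> ball (cnj p) r" for z
      using r(2)[of "cnj z"] that ball_cnj_iff[of "cnj z" p r] sym_sheet_cnj[of z] by simp
    then show ?thesis using r(1) unfolding outside_def by blast
  qed
  from this[of p] this[of "cnj p"] show ?thesis by auto
qed

lemma outsideI:
  assumes "open U" "p \<in> U" "\<And>z. z \<in> U \<Longrightarrow> Im z > 0 \<Longrightarrow> z \<notin> sheet"  "Im p > 0"
  shows "p \<in> outside"
proof -
  have "open (U \<inter> H)" using assms by (intro open_Int open_halfspace_Im_gt)
  then obtain r where r: "r > 0" "ball p r \<subseteq> U \<inter> H"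
    using assms unfolding open_contains_ball by blast
  have "z \<notin> sym_sheet" if "z \<in> ball p r" for z
  proof -
    have z: "z \<in> U" "Im z > 0" using r(2) that by auto
    then show ?thesis using assms(3) sheet_Im_pos[of "cnj z"] by (auto simp: sym_sheet_def)
  qed
  then show ?thesis using r(1) unfolding outside_def by blast
qed

lemma outside_realI:
  assumes "r > 0" "\<And>z. z \<in> ball (of_real x) r \<Longrightarrow> z \<notin> sheet"
  shows "of_real x \<in> outside"
  unfolding outside_def using assms ball_real_cnj_iff[of _ x r] by (auto simp: sym_sheet_def)

lemma inside_realI:
  assumes "r > 0" "\<And>z. z \<in> ball (of_real x) r \<Longrightarrow> Im z > 0 \<Longrightarrow> z \<in> sheet"
  shows "of_real x \<in> inside"
proof -
  have "z \<in> sym_sheet" if "z \<in> ball (of_real x) r" "Im z \<noteq> 0" for z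
    using assms(2)[of z] assms(2)[of "cnj z"] that ball_real_cnj_iff[of z x r]
    by (cases "Im z > 0") (auto simp: sym_sheet_def)
  then show ?thesis using assms(1) unfolding inside_def by blast
qed

lemma zero_inside: "0 \<in> inside"
proof -
  obtain r where r: "r > 0" "\<And>z. z\<in>ball 0 r \<Longrightarrow> Im z > 0 \<Longrightarrow> g (f z) = z" using near_0 by blast
  obtain s where s: "s > 0" "\<And>z. z\<in>ball (of_real 0) s \<Longrightarrow> Im z > 0 \<Longrightarrow> z \<in> upper_region \<kappa> \<gamma>"
    using half_ball_upper_region[OF \<kappa> increasing_point_0] by blast
  have "of_real 0 \<in> inside"
    by (rule inside_realI[of "min r s"]) (use r s in \<open>auto simp: sheet_iff\<close>)
  then show ?thesis by simp
qed

text \<open>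
  A point with \<open>\<kappa>\<theta> < \<pi>\<close> lies in one of two open sets, the sheet and its complement in the upper region; the
  points with \<open>\<kappa>\<theta> > \<pi>\<close> form an open set disjoint from the sheet.
\<close>

lemma upper_positive_region_cases:
  assumes p: "p \<in> positive_region \<kappa> \<gamma>" and "Im p > 0"
  shows "p \<in> inside \<or> p \<in> outside"
proof -
  have "kappa_theta \<kappa> (Re p) (Im p) \<noteq> pi" using positive_region_kappa_theta[OF \<kappa> assms] .
  then consider "kappa_theta \<kappa> (Re p) (Im p) < pi" | "kappa_theta \<kappa> (Re p) (Im p) > pi" by linarith
  then show ?thesis
  proof cases
    case 1
    then have up: "p \<in> upper_region \<kappa> \<gamma>" using positive_region_upper_iff[OF \<kappa> assms(2)] p by blast
    show ?thesis
    proof (cases "p \<in> sheet")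
      case True
      then obtain r where "r > 0" "ball p r \<subseteq> sheet" using open_sheet unfolding open_contains_ball by blast
      then have "p \<in> inside" unfolding inside_def by (auto simp: sym_sheet_def)
      then show ?thesis by simp
    next
      case False
      have "p \<in> outside"
        by (rule outsideI[OF open_upper_minus_sheet]) (use up False assms in auto)
      then show ?thesis by simp
    qed
  next
    case 2
    have "p \<in> outside"
      by (rule outsideI[OF open_upper_region(2)[OF \<kappa>]]) (use 2 assms in \<open>auto simp: sheet_iff upper_region_def\<close>)
    then show ?thesis by simp
  qed
qed

text \<open>
  The upper half of a small ball is a connected subset of the upper region, so it cannot meet both the sheet and its
  complement.
\<close>

lemma increasing_point_cases:
  assumes "increasing_point \<kappa> \<gamma> x"
  shows "of_real x \<in> inside \<or> of_real x \<in> outside"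
proof -
  obtain r where r: "r > 0" "\<And>z. z\<in>ball (of_real x) r \<Longrightarrow> Im z > 0 \<Longrightarrow> z \<in> upper_region \<kappa> \<gamma>"
    using half_ball_upper_region[OF \<kappa> assms] by blast
  have "connected (ball (complex_of_real x) r \<inter> H)" using ball_upper_half_convex convex_connected by blast
  from connected_clopen_cases[OF this open_sheet open_upper_minus_sheet]
  have "ball (of_real x) r \<inter> H \<subseteq> sheet \<or> (ball (of_real x) r \<inter> H) \<inter> sheet = {}" using r(2) by blast
  then show ?thesis
  proof
    assume "ball (of_real x) r \<inter> H \<subseteq> sheet"
    then have "z \<in> sheet" if "z \<in> ball (of_real x) r" "Im z > 0" for z using that by blast
    then have "of_real x \<in> inside" by (rule inside_realI[OF r(1)])
    then show ?thesis by simp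
  next
    assume "(ball (of_real x) r \<inter> H) \<inter> sheet = {}"
    then show ?thesis using outside_realI[OF r(1), of x] sheet_Im_pos by blast
  qed
qed

text \<open>
  At \<open>z = -\<kappa>\<close>, for an odd integer \<open>\<kappa> \<ge> 3\<close> with \<open>\<gamma>\<kappa> > 1\<close>, the positive region contains this single real point, where
  different sectors of the upper half-plane meet; connectedness alone does not keep \<open>\<Omega>\<close> away from it. But \<open>f \<rightarrow> 0\<close>
  at this point, while on the sheet \<open>z = g(f(z))\<close> tends to \<open>0\<close> when \<open>f(z)\<close> does.
\<close>

lemma root_of_kappa_base_outside:
  assumes p: "of_real x \<in> positive_region \<kappa> \<gamma>" and b: "kappa_base \<kappa> (of_real x) = 0"
  shows "of_real x \<in> outside"
proof (rule ccontr)
  assume no: "of_real x \<notin> outside"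
  obtain k where k: "\<kappa> = ereal k" "k \<noteq> 0"
    using \<kappa> b by (cases rule: ereal_cases_kappa[OF \<kappa>]) auto
  have "(of_real (1 + x / k) :: complex) = 0" using b k by (simp add: kappa_base_of_real)
  then have x: "x = - k" using k by (simp add: field_simps add_eq_0_iff flip: of_real_add of_real_divide)
  have dom: "of_real x \<in> tsallis_dom \<kappa> \<gamma>" using p by (simp add: positive_region_def)
  have "k \<in> \<int> \<and> k > 0"
  proof (rule ccontr)
    assume "\<not> (k \<in> \<int> \<and> k > 0)"
    then show False using dom k unfolding x tsallis_dom_def by (auto simp: Let_def split: if_splits)
  qed
  then obtain m :: nat where m: "k = real m" "m > 0"
    by (metis Ints_cases of_int_0_less_iff of_int_of_nat_eq of_nat_0_less_iff zero_less_imp_eq_int)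
  have d: "1 + of_real \<gamma> * complex_of_real x \<noteq> 0"
  proof
    assume d0: "1 + of_real \<gamma> * complex_of_real x = 0"
    then have "\<gamma> \<noteq> 0" by auto
    have "of_real (1 + \<gamma> * x) = (0::complex)" using d0 by simp
    then have "1 + \<gamma> * x = 0" by (metis of_real_eq_0_iff)
    then have "x = - 1 / \<gamma>" using \<open>\<gamma> \<noteq> 0\<close> by (simp add: field_simps)
    then show False using dom \<open>\<gamma> \<noteq> 0\<close> by (auto simp: tsallis_dom_def pole_set_def)
  qed
  have "\<forall>n::nat. \<exists>z. z \<in> ball (of_real x) (1 / real (Suc n)) \<and> z \<in> sheet"
    using no outside_realI[of "1 / real (Suc n)" x for n]
    by (metis of_nat_0_less_iff zero_less_Suc zero_less_divide_1_iff)
  then obtain z where z: "\<And>n::nat. z n \<in> ball (of_real x) (1 / real (Suc n))" "\<And>n. z n \<in> sheet" by metis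
  have zx: "z \<longlonglongrightarrow> of_real x"
  proof (rule metric_tendsto_imp_tendsto[OF LIMSEQ_inverse_real_of_nat])
    show "\<forall>\<^sub>F n in sequentially. dist (z n) (of_real x) \<le> dist (inverse (real (Suc n))) 0"
      using z(1) by (auto simp: dist_commute inverse_eq_divide less_imp_le)
  qed
  have feq: "f v = v / (1 + of_real \<gamma> * v) * kappa_base \<kappa> v ^ m" for v
    using k m by (simp add: tsallis_def exp_kappa_def kappa_base_def)
  have "(\<lambda>n. f (z n)) \<longlonglongrightarrow> of_real x / (1 + of_real \<gamma> * of_real x) * kappa_base \<kappa> (of_real x) ^ m"
    unfolding feq by (intro tendsto_intros zx isCont_tendsto_compose[OF isCont_kappa_base zx] d)
  then have f0: "(\<lambda>n. f (z n)) \<longlonglongrightarrow> 0" using b m(2) by (simp add: zero_power)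
  have fz: "f (z n) \<in> H" for n using z(2)[of n] by (auto simp: sheet_iff upper_region_def)
  have "f (z n) \<noteq> 0" for n using fz[of n] by auto
  then have "filterlim (\<lambda>n. f (z n)) (at 0 within H) sequentially"
    unfolding filterlim_at using f0 fz by auto
  from filterlim_compose[OF g_0 this] have "(\<lambda>n. g (f (z n))) \<longlonglongrightarrow> 0" .
  moreover have "g (f (z n)) = z n" for n using z(2) sheet_iff by blast
  ultimately have "z \<longlonglongrightarrow> 0" by simp
  then have "complex_of_real x = 0" using zx LIMSEQ_unique by blast
  then show False using x k by simp
qed

text \<open>
  A real point with \<open>u < 0\<close> occurs only for an integer \<open>\<kappa>\<close>. If \<open>\<bar>\<kappa>\<bar> \<ge> 2\<close>, the sector condition gives \<open>Re u \<ge> 0\<close> on the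
  sheet, so the sheet stays away from this point.
\<close>

lemma real_positive_region_cases:
  assumes p: "of_real x \<in> positive_region \<kappa> \<gamma>"
  shows "increasing_point \<kappa> \<gamma> x \<or> of_real x \<in> outside"
proof (cases "kappa_base \<kappa> (of_real x) = 0")
  case True then show ?thesis using root_of_kappa_base_outside[OF p] by simp
next
  case False
  define u where "u = 1 + x / real_of_ereal \<kappa>"
  have b: "kappa_base \<kappa> (of_real x) = of_real u" by (simp add: kappa_base_of_real u_def)
  have reg: "regular_at \<kappa> \<gamma> (of_real x)" "Re (critical_poly \<kappa> \<gamma> (of_real x)) > 0"
    using p positive_region_real[OF \<kappa> False] by auto
  show ?thesis
  proof (cases "u > 0 \<or> \<bar>real_of_ereal \<kappa>\<bar> = 1")
    case True then show ?thesis using reg by (simp add: increasing_point_def u_def)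
  next
    case no: False
    have "u \<noteq> 0" using False b by auto
    then have u: "u < 0" using no by simp
    obtain k where k: "\<kappa> = ereal k" "k \<noteq> 0"
      using \<kappa> u by (cases rule: ereal_cases_kappa[OF \<kappa>]) (auto simp: u_def)
    have "complex_of_real u \<in> \<real>\<^sub>\<le>\<^sub>0" using u by simp
    then have "k \<in> \<int>" using reg(1) k b by (auto simp: regular_at_def)
    then obtain n where n: "k = of_int n" by (elim Ints_cases)
    have "\<bar>n\<bar> \<noteq> 1" using no k n by auto
    then have "\<bar>n\<bar> \<ge> 2" using k n by auto
    then have k2: "\<bar>k\<bar> \<ge> 2" using n by linarith
    have "\<forall>\<^sub>F z in nhds (of_real x). Re (kappa_base \<kappa> z) < 0"
    proof (rule order_tendstoD(2))
      show "((\<lambda>z. Re (kappa_base \<kappa> z)) \<longlongrightarrow> u) (nhds (of_real x))"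
        using tendsto_Re[OF isCont_kappa_base[of "of_real x" \<kappa>, unfolded isCont_def tendsto_at_iff_tendsto_nhds]] b by simp
    qed (rule u)
    then obtain r where r: "r > 0" "\<And>z. z \<in> ball (of_real x) r \<Longrightarrow> Re (kappa_base \<kappa> z) < 0"
      by (auto simp: eventually_nhds_metric dist_commute)
    have "z \<notin> sheet" if "z \<in> ball (of_real x) r" for z
    proof
      assume "z \<in> sheet"
      then have "kappa_theta \<kappa> (Re z) (Im z) < pi" "Im z > 0" by (auto simp: sheet_iff upper_region_def)
      then have "cmod (kappa_base \<kappa> z) * cos (pi / \<bar>k\<bar>) \<le> Re (kappa_base \<kappa> z)"
        using upper_region_cone[of k z] k k2 by simp
      moreover have "cos (pi / \<bar>k\<bar>) \<ge> 0"
        using k2 by (intro cos_ge_zero) (auto simp: field_simps intro: order_trans[of _ 0])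
      ultimately show False using r(2)[OF that] by (smt (verit) mult_nonneg_nonneg norm_ge_zero)
    qed
    then show ?thesis using outside_realI[OF r(1)] by blast
  qed
qed

lemma Omega_subset_inside: "Omega \<kappa> \<gamma> \<subseteq> inside"
proof -
  let ?E = "positive_region \<kappa> \<gamma>"
  have Om: "Omega \<kappa> \<gamma> = connected_component_set ?E 0"
    by (simp add: Omega_def positive_region_def)
  have cover: "p \<in> inside \<or> p \<in> outside" if p: "p \<in> ?E" for p
  proof -
    consider "Im p > 0" | "Im p < 0" | "Im p = 0" by linarith
    then show ?thesis
    proof cases
      case 1 then show ?thesis using upper_positive_region_cases[OF p] by blast
    next
      case 2
      then show ?thesis using upper_positive_region_cases[OF positive_region_cnj[OF \<kappa> p]]
        by (simp add: inside_cnj outside_cnj)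
    next
      case 3
      then have "p = of_real (Re p)" by (simp add: complex_eq_iff)
      then show ?thesis using real_positive_region_cases[of "Re p"] increasing_point_cases[of "Re p"] p by metis
    qed
  qed
  have sub: "Omega \<kappa> \<gamma> \<subseteq> inside \<union> outside"
    unfolding Om using connected_component_subset cover by blast
  have "connected (Omega \<kappa> \<gamma>)" unfolding Om by (rule connected_connected_component)
  from connected_clopen_cases[OF this open_inside open_outside sub inside_outside_disjoint]
  have "Omega \<kappa> \<gamma> \<subseteq> inside \<or> Omega \<kappa> \<gamma> \<inter> inside = {}" .
  moreover have "Omega \<kappa> \<gamma> = {} \<or> 0 \<in> Omega \<kappa> \<gamma>"
    unfolding Om using connected_component_eq_empty by (metis connected_component_refl_eq mem_Collect_eq)
  ultimately show ?thesis using zero_inside by blast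
qed

lemma Omega_real_good:
  assumes "of_real x \<in> Omega \<kappa> \<gamma>"
  shows "increasing_point \<kappa> \<gamma> x \<and> of_real x \<in> inside"
proof -
  have "of_real x \<in> positive_region \<kappa> \<gamma>"
    using assms connected_component_subset unfolding Omega_def positive_region_def by blast
  then show ?thesis using Omega_subset_inside inside_outside_disjoint real_positive_region_cases assms by blast
qed

text \<open>
  The local inverse preserves the sides of the real axis, and on each side the nearby points belong to the sheet
  or to its mirror image, where \<open>g\<close> or its reflection inverts \<open>f\<close>.
\<close>

lemma local_inverse_agrees:
  assumes good: "increasing_point \<kappa> \<gamma> x" and inn: "of_real x \<in> inside"
  obtains V h where "open V" "of_real x \<in> V" "\<forall>v\<in>V. regular_at \<kappa> \<gamma> v"
    "open (f ` V)" "h holomorphic_on f ` V" "\<forall>v\<in>V. h (f v) = v"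
    "\<forall>w\<in>f ` V. Im w > 0 \<longrightarrow> h w = g w"
    "\<forall>w\<in>f ` V. Im w < 0 \<longrightarrow> h w = cnj (g (cnj w))"
proof -
  obtain r where r: "r > 0" "\<And>z. z \<in> ball (of_real x) r \<Longrightarrow> Im z \<noteq> 0 \<Longrightarrow> z \<in> sym_sheet"
    using inn by (auto simp: inside_def)
  obtain V h where V: "open V" "of_real x \<in> V" "V \<subseteq> ball (of_real x) r" "\<forall>v\<in>V. regular_at \<kappa> \<gamma> v"
    and fV: "open (f ` V)" "h holomorphic_on f ` V" "\<forall>v\<in>V. h (f v) = v"
    and sgnV: "\<forall>v\<in>V. sgn (Im (f v)) = sgn (Im v)"
    and "\<forall>v\<in>V. Im v > 0 \<longrightarrow> v \<in> upper_region \<kappa> \<gamma>"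
    by (rule increasing_point_local_inverse[OF \<kappa> good r(1)])
  show ?thesis
  proof (rule that[OF V(1,2,4) fV]; intro ballI impI)
    fix w assume w: "w \<in> f ` V" "Im w > 0"
    then obtain v where v: "v \<in> V" "w = f v" by blast
    then have "Im v > 0" using bspec[OF sgnV v(1)] w(2) by (simp add: sgn_if split: if_splits)
    then have "v \<in> sym_sheet" using r(2)[of v] v V(3) by auto
    then have "v \<in> sheet" using sheet_Im_pos[of "cnj v"] \<open>Im v > 0\<close> by (auto simp: sym_sheet_def)
    then show "h w = g w" using fV(3) v sheet_iff by simp
  next
    fix w assume w: "w \<in> f ` V" "Im w < 0"
    then obtain v where v: "v \<in> V" "w = f v" by blast
    then have "Im v < 0" using bspec[OF sgnV v(1)] w(2) by (simp add: sgn_if split: if_splits)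
    then have "v \<in> sym_sheet" using r(2)[of v] v V(3) by auto
    then have "cnj v \<in> sheet" using sheet_Im_pos[of v] \<open>Im v < 0\<close> by (auto simp: sym_sheet_def)
    then have "g (f (cnj v)) = cnj v" by (simp add: sheet_iff)
    moreover have "f (cnj v) = cnj w" using tsallis_cnj[OF \<kappa> bspec[OF V(4) v(1)]] v(2) by simp
    ultimately show "h w = cnj (g (cnj w))" using bspec[OF fV(3) v(1)] v(2) by simp
  qed
qed

end

section \<open>Existence and uniqueness of the main branch\<close>

lemma local_inverseI:
  assumes \<kappa>: "\<kappa> \<noteq> 0" "\<kappa> \<noteq> -\<infinity>" and V: "open V" "0 \<in> V" "\<forall>v\<in>V. regular_at \<kappa> \<gamma> v"
    and fV: "open (tsallis \<kappa> \<gamma> ` V)" "h holomorphic_on tsallis \<kappa> \<gamma> ` V"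
    and inv: "\<forall>v\<in>V. h (tsallis \<kappa> \<gamma> v) = v"
  shows "local_inverse \<kappa> \<gamma> h"
  unfolding local_inverse_def
proof (rule exI[of _ "tsallis \<kappa> \<gamma> ` V"], rule exI[of _ V], intro conjI ballI)
  show 0: "0 \<in> tsallis \<kappa> \<gamma> ` V" using V(2) by (intro image_eqI[of _ _ 0]) simp_all
  show "V \<subseteq> tsallis_dom \<kappa> \<gamma>"
    using V(3) mem_tsallis_dom_iff[OF \<kappa>] by (auto simp: regular_at_def)
  show "h 0 = 0" using bspec[OF inv V(2)] by simp
  show "h ` tsallis \<kappa> \<gamma> ` V = V" using inv by force
qed (use V fV inv in auto)

text \<open>
  Both functions take values near \<open>0\<close>, where \<open>f\<close> is injective.
\<close>

lemma local_inverse_unique: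
  assumes \<kappa>: "\<kappa> \<noteq> 0" "\<kappa> \<noteq> -\<infinity>" and w: "local_inverse \<kappa> \<gamma> w1" "local_inverse \<kappa> \<gamma> w2"
  shows "\<forall>\<^sub>F z in nhds 0. w1 z = w2 z"
proof -
  obtain V h where V: "open V" "of_real 0 \<in> V" "V \<subseteq> ball (of_real 0) 1" "\<forall>v\<in>V. regular_at \<kappa> \<gamma> v"
    and fV: "open (tsallis \<kappa> \<gamma> ` V)" "h holomorphic_on tsallis \<kappa> \<gamma> ` V" "\<forall>v\<in>V. h (tsallis \<kappa> \<gamma> v) = v"
    and "\<forall>v\<in>V. sgn (Im (tsallis \<kappa> \<gamma> v)) = sgn (Im v)"
    and "\<forall>v\<in>V. Im v > 0 \<longrightarrow> v \<in> upper_region \<kappa> \<gamma>"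
    by (rule increasing_point_local_inverse[OF \<kappa> increasing_point_0[of \<kappa> \<gamma>] zero_less_one])
  have *: "\<forall>\<^sub>F z in nhds 0. w z = h z" if w: "local_inverse \<kappa> \<gamma> w" for w
  proof -
    obtain U where U: "open U" "0 \<in> U" "w holomorphic_on U" "w 0 = 0" "\<forall>z\<in>U. tsallis \<kappa> \<gamma> (w z) = z"
      using w unfolding local_inverse_def by blast
    have "isCont w 0"
      using U holomorphic_on_imp_continuous_on continuous_on_eq_continuous_at by blast
    then have "(w \<longlongrightarrow> w 0) (nhds 0)" by (simp add: isCont_def tendsto_at_iff_tendsto_nhds)
    then have "\<forall>\<^sub>F z in nhds 0. w z \<in> V"
      by (rule topological_tendstoD) (use V U in auto)
    moreover have "\<forall>\<^sub>F z in nhds 0. z \<in> U" using U eventually_nhds_in_open by blast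
    ultimately show ?thesis
    proof eventually_elim
      case (elim z)
      then show ?case using bspec[OF fV(3), of "w z"] U(5) by simp
    qed
  qed
  show ?thesis using *[OF w(1)] *[OF w(2)] by eventually_elim simp
qed

lemma slit_real: "closure (slit \<kappa> \<gamma>) \<subseteq> \<real>"
  by (rule closure_minimal) (auto simp: slit_def closed_complex_Reals)

lemma slit_Im: "w \<in> closure (slit \<kappa> \<gamma>) \<Longrightarrow> Im w = 0"
  using slit_real complex_is_Real_iff by blast

lemma open_branch_domain: "open (UNIV - closure (slit \<kappa> \<gamma>))"
  by (simp add: open_Diff)

text \<open>
  A disc around \<open>0\<close> lies in the positive region, hence in \<open>\<Omega>\<close>, and \<open>f\<close> maps its real points onto a neighbourhood of
  \<open>0\<close> in \<open>\<real>\<close>.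
\<close>

lemma zero_in_branch_domain:
  assumes \<kappa>: "\<kappa> \<noteq> 0" "\<kappa> \<noteq> -\<infinity>"
  shows "0 \<notin> closure (slit \<kappa> \<gamma>)"
proof -
  let ?E = "positive_region \<kappa> \<gamma>"
  obtain r where r: "r > 0" "\<forall>z\<in>ball (of_real 0) r. regular_at \<kappa> \<gamma> z"
     "\<forall>z\<in>ball (of_real 0) r. Im z > 0 \<longrightarrow> z \<in> upper_region \<kappa> \<gamma>"
    using half_ball_upper_region[OF \<kappa> increasing_point_0] by blast
  have "isCont (critical_poly \<kappa> \<gamma>) 0" unfolding critical_poly_def by (intro continuous_intros)
  then have "isCont (\<lambda>z. Re (critical_poly \<kappa> \<gamma> z)) 0" by (simp add: isCont_def tendsto_Re)
  then have "((\<lambda>z. Re (critical_poly \<kappa> \<gamma> z)) \<longlongrightarrow> Re (critical_poly \<kappa> \<gamma> 0)) (nhds 0)"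
    using tendsto_at_iff_tendsto_nhds[of "\<lambda>z. Re (critical_poly \<kappa> \<gamma> z)" 0] by (simp only: isCont_def)
  then have "\<forall>\<^sub>F z in nhds 0. Re (critical_poly \<kappa> \<gamma> z) > 0"
    by (rule order_tendstoD(1)) (simp add: critical_poly_def)
  then obtain s where s: "s > 0" "\<And>z. z \<in> ball 0 s \<Longrightarrow> Re (critical_poly \<kappa> \<gamma> z) > 0"
    by (auto simp: eventually_nhds_metric dist_commute)
  have up: "z \<in> ?E" if "z \<in> ball 0 r" "Im z > 0" for z
  proof -
    have "z \<in> upper_region \<kappa> \<gamma>" using r(3) that by simp
    then show ?thesis using positive_region_upper_iff[OF \<kappa> that(2), of \<gamma>]
      by (auto simp: upper_region_def)
  qed
  have sub: "ball 0 (min r s) \<subseteq> ?E"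
  proof
    fix z :: complex assume z: "z \<in> ball 0 (min r s)"
    consider "Im z > 0" | "Im z < 0" | "Im z = 0" by linarith
    then show "z \<in> ?E"
    proof cases
      case 1 then show ?thesis using up z by simp
    next
      case 2
      then have "cnj z \<in> ?E" using up[of "cnj z"] z by simp
      then show ?thesis using positive_region_cnj[OF \<kappa>, of "cnj z" \<gamma>] by simp
    next
      case 3
      then have zr: "z = of_real (Re z)" by (simp add: complex_eq_iff)
      have 1: "regular_at \<kappa> \<gamma> z" "Re (critical_poly \<kappa> \<gamma> z) > 0" using r(2) s(2) z by simp_all
      then have "kappa_base \<kappa> z \<noteq> 0" by (simp add: regular_at_def)
      then show ?thesis using positive_region_real[OF \<kappa>, of "Re z" \<gamma>] zr 1 by simp
    qed
  qed
  have Om: "ball 0 (min r s) \<subseteq> Omega \<kappa> \<gamma>"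
    unfolding Omega_def positive_region_def[symmetric]
    by (rule connected_component_maximal) (use r s sub in auto)
  have rs: "min r s > 0" using r s by simp
  obtain V h where V: "open V" "of_real 0 \<in> V" "V \<subseteq> ball (of_real 0) (min r s)" "\<forall>v\<in>V. regular_at \<kappa> \<gamma> v"
    and fV: "open (tsallis \<kappa> \<gamma> ` V)" "h holomorphic_on tsallis \<kappa> \<gamma> ` V" "\<forall>v\<in>V. h (tsallis \<kappa> \<gamma> v) = v"
    and sgnV: "\<forall>v\<in>V. sgn (Im (tsallis \<kappa> \<gamma> v)) = sgn (Im v)"
    and "\<forall>v\<in>V. Im v > 0 \<longrightarrow> v \<in> upper_region \<kappa> \<gamma>"
    by (rule increasing_point_local_inverse[OF \<kappa> increasing_point_0[of \<kappa> \<gamma>] rs])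
  have "tsallis \<kappa> \<gamma> ` V \<inter> slit \<kappa> \<gamma> = {}"
  proof (rule ccontr)
    assume "\<not> ?thesis"
    then obtain v where v: "v \<in> V" "tsallis \<kappa> \<gamma> v \<in> slit \<kappa> \<gamma>" by blast
    then have "Im (tsallis \<kappa> \<gamma> v) = 0" by (simp add: slit_def complex_is_Real_iff)
    then have "Im v = 0" using bspec[OF sgnV v(1)] by (simp add: sgn_if split: if_splits)
    then have "v \<in> Omega \<kappa> \<gamma> \<inter> \<real>" using V(3) v(1) Om by (auto simp: complex_is_Real_iff)
    then show False using v(2) by (simp add: slit_def)
  qed
  then have "tsallis \<kappa> \<gamma> ` V \<inter> closure (slit \<kappa> \<gamma>) = {}"
    using open_Int_closure_eq_empty[OF fV(1)] by blast
  moreover have "0 \<in> tsallis \<kappa> \<gamma> ` V" using V(2) by (intro image_eqI[of _ _ 0]) simp_all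
  ultimately show ?thesis by blast
qed

text \<open>
  The domain is the union of the closed upper half-plane without the slit and its mirror image. Each is connected, as it lies
  between an open half-plane and its closure, and they meet at \<open>0\<close>.
\<close>

lemma connected_branch_domain:
  assumes \<kappa>: "\<kappa> \<noteq> 0" "\<kappa> \<noteq> -\<infinity>"
  shows "connected (UNIV - closure (slit \<kappa> \<gamma>))"
proof -
  let ?P = "UNIV - closure (slit \<kappa> \<gamma>)"
  let ?A = "?P \<inter> {w. Im w \<ge> 0}"
  have A: "connected ?A"
  proof (rule connected_intermediate_closure)
    show "connected {w. Im w > 0}" by (rule convex_connected) (rule convex_halfspace_Im_gt)
    show "{w. Im w > 0} \<subseteq> ?A" using slit_Im by force
    show "?A \<subseteq> closure {w. Im w > 0}"
    proof
      fix w assume w: "w \<in> ?A"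
      show "w \<in> closure {w. Im w > 0}"
      proof (cases "Im w = 0")
        case True
        then have "w = of_real (Re w)" by (simp add: complex_eq_iff)
        then show ?thesis using upper_half_islimpt[of "Re w"] by (simp add: closure_def)
      next
        case False
        then have "w \<in> {w. Im w > 0}" using w by simp
        then show ?thesis by (rule subsetD[OF closure_subset])
      qed
    qed
  qed
  have cA: "connected (cnj ` ?A)"
    by (rule connected_continuous_image[OF _ A]) (intro continuous_intros)
  have z0: "0 \<in> ?A" using zero_in_branch_domain[OF \<kappa>] by simp
  then have "cnj 0 \<in> cnj ` ?A" by (rule imageI)
  with z0 have "?A \<inter> cnj ` ?A \<noteq> {}" by (metis complex_cnj_zero disjoint_iff)
  then have "connected (?A \<union> cnj ` ?A)" using A cA by (intro connected_Un)
  moreover have "w \<in> ?A \<union> cnj ` ?A \<longleftrightarrow> w \<in> ?P" for w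
  proof -
    have m: "w \<in> cnj ` ?A \<longleftrightarrow> cnj w \<in> ?A" by (metis (no_types, lifting) complex_cnj_cnj image_iff)
    have c: "cnj w = w" if "w \<in> closure (slit \<kappa> \<gamma>) \<or> cnj w \<in> closure (slit \<kappa> \<gamma>)"
      using that slit_Im[of w] slit_Im[of "cnj w"] by (auto simp: complex_eq_iff)
    then have "cnj w \<in> closure (slit \<kappa> \<gamma>) \<longleftrightarrow> w \<in> closure (slit \<kappa> \<gamma>)" by metis
    then have "cnj w \<in> ?A \<longleftrightarrow> w \<in> ?P \<and> Im w \<le> 0" by simp
    then show ?thesis unfolding Un_iff m using linear[of 0 "Im w"] by auto
  qed
  then have "?A \<union> cnj ` ?A = ?P" by blast
  ultimately show ?thesis by simp
qed

lemma main_branch_unique: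
  assumes \<kappa>: "\<kappa> \<noteq> 0" "\<kappa> \<noteq> -\<infinity>" and W: "main_branch \<kappa> \<gamma> W1" "main_branch \<kappa> \<gamma> W2"
  shows "W1 = W2"
proof (rule extensionalityI[of W1 "UNIV - closure (slit \<kappa> \<gamma>)"])
  let ?P = "UNIV - closure (slit \<kappa> \<gamma>)"
  show "W1 \<in> extensional ?P" "W2 \<in> extensional ?P" using W by (auto simp: main_branch_def)
  fix z assume z: "z \<in> ?P"
  obtain w1 w2 where w: "local_inverse \<kappa> \<gamma> w1" "\<forall>\<^sub>F z in nhds 0. W1 z = w1 z"
    "local_inverse \<kappa> \<gamma> w2" "\<forall>\<^sub>F z in nhds 0. W2 z = w2 z" using W unfolding main_branch_def by blast
  from w(2,4) local_inverse_unique[OF \<kappa> w(1,3)]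
  have "\<forall>\<^sub>F z in nhds 0. W1 z = W2 z" by eventually_elim simp
  then obtain S where S: "open S" "0 \<in> S" "\<forall>z\<in>S. W1 z = W2 z" unfolding eventually_nhds by blast
  show "W1 z = W2 z"
  proof (rule analytic_continuation_open[of "S \<inter> ?P" ?P W1 W2])
    show "open (S \<inter> ?P)" using S open_branch_domain by blast
    show "S \<inter> ?P \<noteq> {}" using S(2) zero_in_branch_domain[OF \<kappa>] by blast
  qed (use S z W open_branch_domain connected_branch_domain[OF \<kappa>] in \<open>auto simp: main_branch_def\<close>)
qed

context tsallis_section
begin

text \<open>
  On the real axis the value is the boundary value of \<open>g\<close>, so it does not depend on the choice of a point of \<open>\<Omega> \<inter> \<real>\<close> with the
  given image.
\<close>

definition branch :: "complex \<Rightarrow> complex" where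
  "branch w = (if w \<in> closure (slit \<kappa> \<gamma>) then undefined
     else if Im w > 0 then g w else if Im w < 0 then cnj (g (cnj w))
     else Lim (at w within H) g)"

lemma branch_near_real:
  assumes good: "increasing_point \<kappa> \<gamma> x" and inn: "of_real x \<in> inside"
  obtains V h where "open V" "of_real x \<in> V" "\<forall>v\<in>V. regular_at \<kappa> \<gamma> v"
    "open (f ` V)" "h holomorphic_on f ` V" "\<forall>v\<in>V. h (f v) = v"
    "\<forall>w\<in>f ` V. w \<notin> closure (slit \<kappa> \<gamma>) \<longrightarrow> branch w = h w"
proof -
  obtain V h where V: "open V" "of_real x \<in> V" "\<forall>v\<in>V. regular_at \<kappa> \<gamma> v"
    and fV: "open (f ` V)" "h holomorphic_on f ` V" "\<forall>v\<in>V. h (f v) = v"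
    and up: "\<forall>w\<in>f ` V. Im w > 0 \<longrightarrow> h w = g w"
    and low: "\<forall>w\<in>f ` V. Im w < 0 \<longrightarrow> h w = cnj (g (cnj w))"
    by (rule local_inverse_agrees[OF good inn])
  show ?thesis
  proof (rule that[OF V fV]; intro ballI impI)
    fix w assume w: "w \<in> f ` V" "w \<notin> closure (slit \<kappa> \<gamma>)"
    consider "Im w > 0" | "Im w < 0" | "Im w = 0" by linarith
    then show "branch w = h w"
    proof cases
      case 3
      then have wr: "w = of_real (Re w)" by (simp add: complex_eq_iff)
      have "isCont h w"
        using fV(1,2) w(1) holomorphic_on_imp_continuous_on continuous_on_eq_continuous_at by blast
      then have "(h \<longlongrightarrow> h w) (at w within H)"
        using continuous_at_imp_continuous_at_within[of w h H] by (simp add: continuous_within)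
      moreover have "\<forall>\<^sub>F v in at w within H. h v = g v"
      proof -
        have "\<forall>\<^sub>F v in at w within H. v \<in> f ` V"
          using topological_tendstoD[OF tendsto_ident_at fV(1) w(1)] by simp
        moreover have "\<forall>\<^sub>F v in at w within H. v \<in> H" by (simp add: eventually_at_filter)
        ultimately show ?thesis by eventually_elim (use up in auto)
      qed
      ultimately have "(g \<longlongrightarrow> h w) (at w within H)" by (simp add: tendsto_cong)
      moreover have "at w within H \<noteq> bot" using upper_half_at_within_nontrivial[of "Re w"] wr by simp
      ultimately have "Lim (at w within H) g = h w" by (intro tendsto_Lim)
      then show ?thesis using 3 w(2) by (simp add: branch_def)
    qed (use w up low in \<open>auto simp: branch_def\<close>)
  qed
qed

lemma branch_holomorphic: "branch holomorphic_on (UNIV - closure (slit \<kappa> \<gamma>))"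
proof -
  let ?P = "UNIV - closure (slit \<kappa> \<gamma>)"
  have loc: "branch field_differentiable (at w)"
    if "open U" "w \<in> U" "\<phi> holomorphic_on U" "\<forall>v\<in>U. branch v = \<phi> v" for U w \<phi>
  proof -
    have "(\<phi> has_field_derivative deriv \<phi> w) (at w)" using that(1-3) holomorphic_derivI by blast
    then have "(branch has_field_derivative deriv \<phi> w) (at w)"
      by (rule has_field_derivative_transform_within_open) (use that in auto)
    then show ?thesis using field_differentiable_def by blast
  qed
  have nonreal: "w \<notin> closure (slit \<kappa> \<gamma>)" if "Im w \<noteq> 0" for w using that slit_Im by blast
  have "branch field_differentiable (at w)" if w: "w \<in> ?P" for w
  proof -
    consider "Im w > 0" | "Im w < 0" | "Im w = 0" by linarith
    then show ?thesis
    proof cases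
      case 1
      show ?thesis
        by (rule loc[OF open_halfspace_Im_gt _ g_hol]) (use 1 nonreal in \<open>auto simp: branch_def\<close>)
    next
      case 2
      have "cnj ` {w. Im w < 0} \<subseteq> H" by auto
      then have "cnj \<circ> g \<circ> cnj holomorphic_on {w. Im w < 0}"
        by (intro holomorphic_on_compose_cnj_cnj open_halfspace_Im_lt holomorphic_on_subset[OF g_hol])
      from loc[OF open_halfspace_Im_lt _ this] show ?thesis
        using 2 nonreal by (auto simp: branch_def)
    next
      case 3
      then have "w \<in> \<real>" by (simp add: complex_is_Real_iff)
      moreover have "w \<notin> slit \<kappa> \<gamma>" using w closure_subset by blast
      ultimately obtain x0 where x0: "x0 \<in> Omega \<kappa> \<gamma>" "x0 \<in> \<real>" "w = f x0" by (auto simp: slit_def)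
      then obtain x where x: "x0 = of_real x" by (elim Reals_cases)
      have "increasing_point \<kappa> \<gamma> x" "of_real x \<in> inside" using Omega_real_good x0(1) x by auto
      then obtain V h where V: "open V" "of_real x \<in> V" "\<forall>v\<in>V. regular_at \<kappa> \<gamma> v"
        and fV: "open (f ` V)" "h holomorphic_on f ` V" "\<forall>v\<in>V. h (f v) = v"
        and eq: "\<forall>w\<in>f ` V. w \<notin> closure (slit \<kappa> \<gamma>) \<longrightarrow> branch w = h w"
        by (rule branch_near_real)
      show ?thesis
      proof (rule loc[of "f ` V \<inter> ?P" w h])
        show "open (f ` V \<inter> ?P)" using fV(1) open_branch_domain by blast
        show "w \<in> f ` V \<inter> ?P" using w V(2) x0(3) x by blast
        show "h holomorphic_on f ` V \<inter> ?P" using fV(2) holomorphic_on_subset by blast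
        show "\<forall>v\<in>f ` V \<inter> ?P. branch v = h v" using eq by blast
      qed
    qed
  qed
  then show ?thesis unfolding holomorphic_on_def using field_differentiable_at_within by blast
qed

lemma main_branch_branch: "main_branch \<kappa> \<gamma> branch"
  unfolding main_branch_def
proof (intro conjI branch_holomorphic)
  let ?P = "UNIV - closure (slit \<kappa> \<gamma>)"
  show "branch \<in> extensional ?P" by (auto simp: extensional_def branch_def)
  have "of_real 0 \<in> inside" using zero_inside by simp
  with increasing_point_0[of \<kappa> \<gamma>] obtain V h where V: "open V" "of_real 0 \<in> V" "\<forall>v\<in>V. regular_at \<kappa> \<gamma> v"
    and fV: "open (f ` V)" "h holomorphic_on f ` V" "\<forall>v\<in>V. h (f v) = v"
    and eq: "\<forall>w\<in>f ` V. w \<notin> closure (slit \<kappa> \<gamma>) \<longrightarrow> branch w = h w"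
    by (rule branch_near_real)
  have "local_inverse \<kappa> \<gamma> h"
    by (rule local_inverseI[OF \<kappa> V(1) _ V(3) fV]) (use V(2) in simp)
  moreover have "\<forall>\<^sub>F z in nhds 0. branch z = h z"
  proof -
    have "0 \<in> f ` V" using V(2) by (intro image_eqI[of _ _ 0]) simp_all
    then have "\<forall>\<^sub>F z in nhds 0. z \<in> f ` V" using fV(1) eventually_nhds_in_open by blast
    moreover have "\<forall>\<^sub>F z in nhds 0. z \<in> ?P"
      using zero_in_branch_domain[OF \<kappa>] open_branch_domain by (intro eventually_nhds_in_open) auto
    ultimately show ?thesis by eventually_elim (use eq in auto)
  qed
  ultimately show "\<exists>w. local_inverse \<kappa> \<gamma> w \<and> (\<forall>\<^sub>F z in nhds 0. branch z = w z)" by blast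
qed

end

theorem main_branch_exists_if:
  assumes \<kappa>: "\<kappa> \<noteq> 0" "\<kappa> \<noteq> -\<infinity>" and "existence_condition \<kappa> \<gamma>"
  shows "main_branch_exists \<kappa> \<gamma>"
proof -
  obtain g where "tsallis_section \<kappa> \<gamma> g" using tsallis_section_exists[OF assms] by blast
  then interpret tsallis_section \<kappa> \<gamma> g .
  show ?thesis unfolding main_branch_exists_def
    using main_branch_branch main_branch_unique[OF \<kappa>] by blast
qed

section \<open>Obstructions in the logarithmic coordinate\<close>

text \<open>
  The map \<open>Z\<close> is a change of coordinate, and \<open>G\<close> continues \<open>f \<circ> Z\<close> analytically from a neighbourhood of \<open>0\<close>, possibly beyond the
  domain of \<open>f\<close>. By the identity theorem, \<open>W \<circ> G = Z\<close> persists as long as \<open>G\<close> stays in the upper half-plane, where \<open>W\<close> is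
  holomorphic.
\<close>

lemma main_branch_along:
  assumes \<kappa>: "\<kappa> \<noteq> 0" "\<kappa> \<noteq> -\<infinity>" and W: "main_branch \<kappa> \<gamma> W"
    and N: "open N" "connected N" "0 \<in> closure N"
    and Z: "Z holomorphic_on UNIV" "Z 0 = 0"
    and G: "G holomorphic_on N" "\<forall>t\<in>N. Im (G t) > 0"
    and GZ: "\<forall>\<^sub>F t in nhds 0. G t = tsallis \<kappa> \<gamma> (Z t)"
  shows "\<And>t. t \<in> N \<Longrightarrow> W (G t) = Z t"
    and "W holomorphic_on {w. Im w > 0}"
    and "(W \<longlongrightarrow> 0) (nhds 0)"
proof -
  obtain w where hol: "W holomorphic_on UNIV - closure (slit \<kappa> \<gamma>)"
    and w: "local_inverse \<kappa> \<gamma> w" "\<forall>\<^sub>F z in nhds 0. W z = w z"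
    using W unfolding main_branch_def by blast
  show holH: "W holomorphic_on {w. Im w > 0}"
    by (rule holomorphic_on_subset[OF hol]) (use slit_Im in force)
  obtain U V where U: "open U" "0 \<in> U" "w holomorphic_on U" "w 0 = 0" and V: "open V" "0 \<in> V"
    and inv: "\<forall>v\<in>V. w (tsallis \<kappa> \<gamma> v) = v"
    using w(1) unfolding local_inverse_def by blast
  have "isCont w 0"
    using U holomorphic_on_imp_continuous_on continuous_on_eq_continuous_at by blast
  then have "(w \<longlongrightarrow> w 0) (nhds 0)" by (simp add: isCont_def tendsto_at_iff_tendsto_nhds)
  then show "(W \<longlongrightarrow> 0) (nhds 0)" using w(2) U(4) by (simp add: tendsto_cong)
  have "isCont Z 0"
    using Z(1) holomorphic_on_imp_continuous_on continuous_on_eq_continuous_at open_UNIV by blast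
  then have Zt: "(Z \<longlongrightarrow> 0) (nhds 0)" using Z(2) tendsto_at_iff_tendsto_nhds[of Z 0] by (simp add: isCont_def)
  have "isCont (tsallis \<kappa> \<gamma>) 0"
    using tsallis_has_derivative[OF \<kappa> regular_0] DERIV_isCont by blast
  then have "(tsallis \<kappa> \<gamma> \<longlongrightarrow> 0) (nhds 0)"
    using tendsto_at_iff_tendsto_nhds[of "tsallis \<kappa> \<gamma>" 0] by (simp add: isCont_def)
  then have fZ: "filterlim (\<lambda>t. tsallis \<kappa> \<gamma> (Z t)) (nhds 0) (nhds 0)"
    by (rule filterlim_compose[OF _ Zt])
  have "\<forall>\<^sub>F t in nhds 0. Z t \<in> V" using topological_tendstoD[OF Zt V] .
  moreover have "\<forall>\<^sub>F t in nhds 0. W (tsallis \<kappa> \<gamma> (Z t)) = w (tsallis \<kappa> \<gamma> (Z t))"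
    using filterlim_iff[THEN iffD1, OF fZ] w(2) by blast
  ultimately have "\<forall>\<^sub>F t in nhds 0. W (G t) = Z t"
    using GZ by eventually_elim (use inv in auto)
  then obtain S where S: "open S" "0 \<in> S" "\<forall>t\<in>S. W (G t) = Z t" unfolding eventually_nhds by blast
  fix t assume t: "t \<in> N"
  show "W (G t) = Z t"
  proof (rule analytic_continuation_open[of "S \<inter> N" N "\<lambda>t. W (G t)" Z])
    show "S \<inter> N \<noteq> {}" using N(3) S(1,2) by (metis closure_iff_nhds_not_empty inf_commute subset_refl)
    have "W \<circ> G holomorphic_on N"
      by (rule holomorphic_on_compose_gen[OF G(1) holH]) (use G(2) in auto)
    then show "(\<lambda>t. W (G t)) holomorphic_on N" by (simp add: o_def)
    show "Z holomorphic_on N" using Z(1) holomorphic_on_subset by blast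
  qed (use S N t in auto)
qed

text \<open>
  The point \<open>z\<close> and the value \<open>f(z)\<close> as functions of \<open>t = log (1 + z/k)\<close>. Unlike \<open>f\<close>, the second function is meromorphic
  on the whole plane.
\<close>

definition z_of_log :: "real \<Rightarrow> complex \<Rightarrow> complex" where
  "z_of_log k t = of_real k * (exp t - 1)"

definition tsallis_of_log :: "real \<Rightarrow> real \<Rightarrow> complex \<Rightarrow> complex" where
  "tsallis_of_log k \<gamma> t = z_of_log k t / (1 + of_real \<gamma> * z_of_log k t) * exp (of_real k * t)"

lemma z_of_log_holomorphic: "z_of_log k holomorphic_on S"
  unfolding z_of_log_def by (intro holomorphic_intros)

lemma tsallis_of_log_pole: "Im (tsallis_of_log k \<gamma> t) > 0 \<Longrightarrow> 1 + of_real \<gamma> * z_of_log k t \<noteq> 0"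
  by (auto simp: tsallis_of_log_def)

lemma tsallis_of_log_holomorphic:
  assumes "\<And>t. t \<in> S \<Longrightarrow> 1 + of_real \<gamma> * z_of_log k t \<noteq> 0"
  shows "tsallis_of_log k \<gamma> holomorphic_on S"
  unfolding tsallis_of_log_def using assms by (intro holomorphic_intros z_of_log_holomorphic) auto

lemma tsallis_of_log_eq_tsallis:
  assumes "k \<noteq> 0" "\<bar>Im t\<bar> < pi"
  shows "tsallis_of_log k \<gamma> t = tsallis (ereal k) \<gamma> (z_of_log k t)"
proof -
  have b: "kappa_base (ereal k) (z_of_log k t) = exp t" using assms by (simp add: kappa_base_def z_of_log_def)
  have "exp_kappa (ereal k) (z_of_log k t) = exp (of_real k * t)"
    using exp_kappa_powr[of k "z_of_log k t"] assms unfolding b by (simp add: powr_def Ln_exp)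
  then show ?thesis by (simp add: tsallis_of_log_def tsallis_def)
qed

text \<open>
  Two configurations that are incompatible with an inverse on the upper half-plane. The condition \<open>\<bar>Re t\<bar> \<ge> 1\<close> keeps \<open>z\<close> away
  from \<open>0\<close>; it is chosen to be invariant under \<open>t \<mapsto> -t\<close>.
\<close>

definition obstructed :: "real \<Rightarrow> real \<Rightarrow> bool" where
  "obstructed k \<gamma> \<longleftrightarrow> (\<exists>N. open N \<and> connected N \<and> 0 \<in> closure N \<and> (\<forall>t\<in>N. Im (tsallis_of_log k \<gamma> t) > 0) \<and>
     ((\<exists>t\<in>N. deriv (tsallis_of_log k \<gamma>) t = 0) \<or>
      (\<exists>t::nat \<Rightarrow> complex. (\<forall>n. t n \<in> N \<and> \<bar>Re (t n)\<bar> \<ge> 1) \<and> (\<lambda>n. tsallis_of_log k \<gamma> (t n)) \<longlonglongrightarrow> 0)))"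

text \<open>
  The relation \<open>W(G(t)) = Z(t)\<close> excludes zeros of \<open>G'\<close>, as \<open>Z'\<close> has none. Moreover, if \<open>G(t\<^sub>n) \<rightarrow> 0\<close>, then
  \<open>Z(t\<^sub>n) \<rightarrow> W(0) = 0\<close>, hence \<open>\<bar>u\<bar> = exp (Re t\<^sub>n) \<rightarrow> 1\<close>.
\<close>

lemma obstructed_no_main_branch:
  assumes k: "k \<noteq> 0" and ob: "obstructed k \<gamma>"
  shows "\<not> main_branch (ereal k) \<gamma> W"
proof
  assume W: "main_branch (ereal k) \<gamma> W"
  have \<kappa>: "ereal k \<noteq> 0" "ereal k \<noteq> -\<infinity>" using k by auto
  obtain N where N: "open N" "connected N" "0 \<in> closure N" and pos: "\<And>t. t \<in> N \<Longrightarrow> Im (tsallis_of_log k \<gamma> t) > 0"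
    and alt: "(\<exists>t\<in>N. deriv (tsallis_of_log k \<gamma>) t = 0) \<or>
      (\<exists>t::nat \<Rightarrow> complex. (\<forall>n. t n \<in> N \<and> \<bar>Re (t n)\<bar> \<ge> 1) \<and> (\<lambda>n. tsallis_of_log k \<gamma> (t n)) \<longlonglongrightarrow> 0)"
    using ob unfolding obstructed_def by blast
  have hol: "tsallis_of_log k \<gamma> holomorphic_on N" using tsallis_of_log_holomorphic tsallis_of_log_pole[OF pos] by blast
  have ev: "\<forall>\<^sub>F t in nhds 0. tsallis_of_log k \<gamma> t = tsallis (ereal k) \<gamma> (z_of_log k t)"
  proof -
    have "\<forall>\<^sub>F t in nhds (0::complex). t \<in> ball 0 pi" by (intro eventually_nhds_in_open) auto
    then show ?thesis
    proof eventually_elim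
      case (elim t)
      then have "\<bar>Im t\<bar> < pi" using abs_Im_le_cmod[of t] by simp
      then show ?case using tsallis_of_log_eq_tsallis[OF k] by simp
    qed
  qed
  have Z0: "z_of_log k 0 = 0" by (simp add: z_of_log_def)
  have posN: "\<forall>t\<in>N. Im (tsallis_of_log k \<gamma> t) > 0" using pos by blast
  note WG = main_branch_along[OF \<kappa> W N z_of_log_holomorphic Z0 hol posN ev]
  from alt show False
  proof
    assume "\<exists>t\<in>N. deriv (tsallis_of_log k \<gamma>) t = 0"
    then obtain t where t: "t \<in> N" "deriv (tsallis_of_log k \<gamma>) t = 0" by blast
    have 1: "(tsallis_of_log k \<gamma> has_field_derivative 0) (at t)" using holomorphic_derivI[OF hol N(1) t(1)] t(2) by simp
    have 2: "(W has_field_derivative deriv W (tsallis_of_log k \<gamma> t)) (at (tsallis_of_log k \<gamma> t))"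
      using holomorphic_derivI[OF WG(2) open_halfspace_Im_gt] pos[OF t(1)] by simp
    have "((\<lambda>t. W (tsallis_of_log k \<gamma> t)) has_field_derivative deriv W (tsallis_of_log k \<gamma> t) * 0) (at t)"
      by (rule DERIV_chain2[OF 2 1])
    then have "(z_of_log k has_field_derivative deriv W (tsallis_of_log k \<gamma> t) * 0) (at t)"
      by (rule has_field_derivative_transform_within_open[OF _ N(1) t(1)]) (rule WG(1))
    moreover have "(z_of_log k has_field_derivative of_real k * exp t) (at t)"
      unfolding z_of_log_def by (auto intro!: derivative_eq_intros)
    ultimately have "of_real k * exp t = 0" using DERIV_unique by fastforce
    then show False using k by simp
  next
    assume "\<exists>t::nat \<Rightarrow> complex. (\<forall>n. t n \<in> N \<and> \<bar>Re (t n)\<bar> \<ge> 1) \<and> (\<lambda>n. tsallis_of_log k \<gamma> (t n)) \<longlonglongrightarrow> 0"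
    then obtain t :: "nat \<Rightarrow> complex" where t: "\<And>n. t n \<in> N" "\<And>n. \<bar>Re (t n)\<bar> \<ge> 1"
      "(\<lambda>n. tsallis_of_log k \<gamma> (t n)) \<longlonglongrightarrow> 0" by blast
    from filterlim_compose[OF WG(3) t(3)] have "(\<lambda>n. z_of_log k (t n)) \<longlonglongrightarrow> 0" using WG(1)[OF t(1)] by simp
    then have "(\<lambda>n. 1 + z_of_log k (t n) / of_real k) \<longlonglongrightarrow> 1 + 0 / of_real k" using k by (intro tendsto_intros) auto
    then have "(\<lambda>n. cmod (1 + z_of_log k (t n) / of_real k)) \<longlonglongrightarrow> cmod 1" using tendsto_norm by fastforce
    then have "(\<lambda>n. exp (Re (t n))) \<longlonglongrightarrow> 1" using k by (simp add: z_of_log_def)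
    then have "(\<lambda>n. ln (exp (Re (t n)))) \<longlonglongrightarrow> ln 1" by (intro tendsto_ln) auto
    then have "(\<lambda>n. \<bar>Re (t n)\<bar>) \<longlonglongrightarrow> 0" by (simp add: tendsto_rabs_zero)
    then have "1 \<le> (0::real)" using t(2) by (intro LIMSEQ_le_const) auto
    then show False by simp
  qed
qed

text \<open>
  Changing the sign of \<open>t\<close> inverts \<open>u\<close>. The substitution \<open>z' = z/u\<close> is a fractional linear map, and it turns
  \<open>z/(1 + \<gamma>z)\<close> into an expression of the same form with \<open>\<gamma>\<close> replaced by \<open>\<gamma> - 1/k\<close>.
\<close>

lemma tsallis_of_log_dual:
  assumes "k \<noteq> 0"
  shows "tsallis_of_log (-k) (\<gamma> - 1 / k) t = tsallis_of_log k \<gamma> (-t)"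
proof -
  define e where "e = exp t"
  have e: "e \<noteq> 0" "exp (-t) = 1 / e" by (auto simp: e_def exp_minus divide_inverse)
  define K where "K = complex_of_real k"
  have K: "K \<noteq> 0" using assms by (simp add: K_def)
  have z: "z_of_log (-k) t = e * z_of_log k (-t)" unfolding z_of_log_def e(2) using e by (simp add: e_def field_simps)
  have "1 + of_real (\<gamma> - 1 / k) * z_of_log (-k) t = e * (1 + of_real \<gamma> * z_of_log k (-t))"
    unfolding z unfolding z_of_log_def e(2) using e(1) K by (simp add: field_simps flip: K_def)
  then have "z_of_log (-k) t / (1 + of_real (\<gamma> - 1 / k) * z_of_log (-k) t) = z_of_log k (-t) / (1 + of_real \<gamma> * z_of_log k (-t))"
    using e(1) z by simp
  then show ?thesis by (simp add: tsallis_of_log_def)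
qed

lemma obstructed_dual:
  assumes k: "k \<noteq> 0" and ob: "obstructed k \<gamma>"
  shows "obstructed (-k) (\<gamma> - 1 / k)"
proof -
  obtain N where N: "open N" "connected N" "0 \<in> closure N" and pos: "\<And>t. t \<in> N \<Longrightarrow> Im (tsallis_of_log k \<gamma> t) > 0"
    and alt: "(\<exists>t\<in>N. deriv (tsallis_of_log k \<gamma>) t = 0) \<or>
      (\<exists>t::nat \<Rightarrow> complex. (\<forall>n. t n \<in> N \<and> \<bar>Re (t n)\<bar> \<ge> 1) \<and> (\<lambda>n. tsallis_of_log k \<gamma> (t n)) \<longlonglongrightarrow> 0)"
    using ob unfolding obstructed_def by blast
  have hol: "tsallis_of_log k \<gamma> holomorphic_on N" using tsallis_of_log_holomorphic tsallis_of_log_pole[OF pos] by blast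
  define N' where "N' = uminus ` N"
  have mem: "- t \<in> N' \<longleftrightarrow> t \<in> N" for t by (auto simp: N'_def)
  show ?thesis unfolding obstructed_def
  proof (intro exI[of _ N'] conjI ballI)
    show "open N'" unfolding N'_def using N(1) by (rule open_negations)
    show "connected N'" unfolding N'_def
      by (rule connected_continuous_image[OF _ N(2)]) (intro continuous_intros)
    have "closure N' = uminus ` closure N" unfolding N'_def
      by (rule closure_injective_linear_image[symmetric]) (auto intro: linear_uminus)
    then show "0 \<in> closure N'" using N(3) by force
    show "Im (tsallis_of_log (-k) (\<gamma> - 1 / k) t) > 0" if "t \<in> N'" for t
      using that pos unfolding tsallis_of_log_dual[OF k] N'_def by auto
    from alt show "(\<exists>t\<in>N'. deriv (tsallis_of_log (-k) (\<gamma> - 1 / k)) t = 0) \<or>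
      (\<exists>t::nat \<Rightarrow> complex. (\<forall>n. t n \<in> N' \<and> \<bar>Re (t n)\<bar> \<ge> 1) \<and> (\<lambda>n. tsallis_of_log (-k) (\<gamma> - 1 / k) (t n)) \<longlonglongrightarrow> 0)"
    proof (elim disjE bexE exE conjE)
      fix t assume t: "t \<in> N" "deriv (tsallis_of_log k \<gamma>) t = 0"
      have "(tsallis_of_log k \<gamma> has_field_derivative 0) (at (- (- t)))" using holomorphic_derivI[OF hol N(1) t(1)] t(2) by simp
      moreover have "(uminus has_field_derivative -1) (at (- t))" by (auto intro!: derivative_eq_intros)
      ultimately have "((\<lambda>s. tsallis_of_log k \<gamma> (- s)) has_field_derivative 0 * (-1)) (at (- t))"
        by (rule DERIV_chain2)
      then have "deriv (tsallis_of_log (-k) (\<gamma> - 1 / k)) (- t) = 0"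
        unfolding tsallis_of_log_dual[OF k, abs_def, symmetric] tsallis_of_log_dual[OF k, symmetric] using DERIV_imp_deriv by fastforce
      then show ?thesis using t(1) mem by blast
    next
      fix t :: "nat \<Rightarrow> complex" assume "\<forall>n. t n \<in> N \<and> \<bar>Re (t n)\<bar> \<ge> 1" "(\<lambda>n. tsallis_of_log k \<gamma> (t n)) \<longlonglongrightarrow> 0"
      then show ?thesis
        by (intro disjI2 exI[of _ "\<lambda>n. - t n"]) (simp add: tsallis_of_log_dual[OF k] mem)
    qed
  qed
qed

text \<open>
  The linear coefficient of the polynomial in \<open>r = \<bar>u\<bar>\<close> that determines the sign of \<open>Im G\<close> on the ray of angle \<open>\<theta>\<close>.
\<close>

definition middle_coeff :: "real \<Rightarrow> real \<Rightarrow> real \<Rightarrow> real" where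
  "middle_coeff k \<gamma> \<theta> = k * (1 - 2 * \<gamma> * k) * cos \<theta> + k * (sin \<theta> * cos (k * \<theta>) / sin (k * \<theta>))"

text \<open>
  Multiplying \<open>Im G\<close> by \<open>\<bar>1 + \<gamma>Z\<bar>\<^sup>2\<close> gives \<open>e\<^sup>k\<^sup>s\<close> times \<open>P\<close>, which is \<open>sin (k\<theta>)\<close> times \<open>F\<close> written in polar
  coordinates of \<open>u\<close>. For a fixed angle, \<open>F\<close> is quadratic in \<open>r = e\<^sup>s\<close>.
\<close>

lemma Im_tsallis_of_log_pos:
  assumes "sin (k * \<theta>) > 0"
    and q: "\<gamma> * k\<^sup>2 * (exp s)\<^sup>2 + middle_coeff k \<gamma> \<theta> * exp s + k * (\<gamma> * k - 1) > 0"
  shows "Im (tsallis_of_log k \<gamma> (Complex s \<theta>)) > 0"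
proof -
  define Z where "Z = z_of_log k (Complex s \<theta>)"
  define r where "r = exp s"
  define d where "d = 1 + of_real \<gamma> * Z"
  define E where "E = exp (of_real k * Complex s \<theta>)"
  have r: "r > 0" by (simp add: r_def)
  have Ze: "Re Z = k * (r * cos \<theta> - 1)" "Im Z = k * (r * sin \<theta>)"
    by (simp_all add: Z_def z_of_log_def r_def Re_exp Im_exp)
  have Ee: "Re E = exp (k * s) * cos (k * \<theta>)" "Im E = exp (k * s) * sin (k * \<theta>)"
    by (simp_all add: E_def Re_exp Im_exp)
  define P where "P = (Re Z + \<gamma> * ((Re Z)\<^sup>2 + (Im Z)\<^sup>2)) * sin (k * \<theta>) + Im Z * cos (k * \<theta>)"
  have "(k * (r * c - 1))\<^sup>2 + (k * (r * s))\<^sup>2 = k\<^sup>2 * (r\<^sup>2 * (c\<^sup>2 + s\<^sup>2) - 2 * r * c + 1)" for c s :: real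
    by (simp add: power2_eq_square algebra_simps)
  then have "(Re Z)\<^sup>2 + (Im Z)\<^sup>2 = k\<^sup>2 * (r\<^sup>2 * ((cos \<theta>)\<^sup>2 + (sin \<theta>)\<^sup>2) - 2 * r * cos \<theta> + 1)"
    unfolding Ze .
  then have nz: "(Re Z)\<^sup>2 + (Im Z)\<^sup>2 = k\<^sup>2 * (r\<^sup>2 - 2 * r * cos \<theta> + 1)"
    by simp
  have "P = sin (k * \<theta>) * (\<gamma> * k\<^sup>2 * r\<^sup>2 + middle_coeff k \<gamma> \<theta> * r + k * (\<gamma> * k - 1))"
    unfolding P_def nz unfolding Ze middle_coeff_def using assms(1)
    by (simp add: field_simps power2_eq_square)
  then have P: "P > 0" using assms by (simp add: r_def)
  have d: "d \<noteq> 0"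
  proof
    assume "d = 0"
    then have "Re d = 0" "Im d = 0" by simp_all
    then have 1: "1 + \<gamma> * Re Z = 0" "\<gamma> * Im Z = 0" by (simp_all add: d_def)
    then have "Im Z = 0" by auto
    then have "P = Re Z * (1 + \<gamma> * Re Z) * sin (k * \<theta>)" by (simp add: P_def power2_eq_square algebra_simps)
    then show False using P 1 by simp
  qed
  have "of_real ((cmod d)\<^sup>2) * tsallis_of_log k \<gamma> (Complex s \<theta>) = Z * cnj d * E"
    using d unfolding tsallis_of_log_def complex_norm_square d_def Z_def E_def by simp
  then have "Im (of_real ((cmod d)\<^sup>2) * tsallis_of_log k \<gamma> (Complex s \<theta>)) = Im (Z * cnj d * E)" by simp
  also have "Im (Z * cnj d * E) = exp (k * s) * P"
    by (simp add: d_def P_def Ee power2_eq_square algebra_simps)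
  finally have "(cmod d)\<^sup>2 * Im (tsallis_of_log k \<gamma> (Complex s \<theta>)) = exp (k * s) * P" by simp
  moreover have "exp (k * s) * P > 0" using P by simp
  ultimately show ?thesis using d by (metis zero_less_mult_pos zero_less_norm_iff zero_less_power)
qed

lemma sin_ratio_tendsto:
  assumes "k \<noteq> 0"
  shows "((\<lambda>\<theta>. sin \<theta> * cos (k * \<theta>) / sin (k * \<theta>)) \<longlongrightarrow> 1 / (k::real)) (at_right 0)"
proof -
  have 1: "((\<lambda>h. sin h / h) \<longlongrightarrow> (1::real)) (at 0)"
    using DERIV_sin[of "0::real"] unfolding DERIV_def by simp
  have "((\<lambda>h. sin (k * h)) has_real_derivative k) (at 0)"
    by (auto intro!: derivative_eq_intros)
  then have 2: "((\<lambda>h. sin (k * h) / h) \<longlongrightarrow> k) (at 0)" unfolding DERIV_def by simp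
  have 3: "((\<lambda>h. cos (k * h)) \<longlongrightarrow> cos (k * 0)) (at 0)" by (intro tendsto_intros)
  have "((\<lambda>h. (sin h / h) * cos (k * h) / (sin (k * h) / h)) \<longlongrightarrow> 1 * cos (k * 0) / k) (at 0)"
    by (intro tendsto_intros 1 2 3) (use assms in auto)
  then have "((\<lambda>h. (sin h / h) * cos (k * h) / (sin (k * h) / h)) \<longlongrightarrow> 1 / k) (at_right 0)"
    by (simp add: filterlim_at_split)
  moreover have "\<forall>\<^sub>F h in at_right 0. (sin h / h) * cos (k * h) / (sin (k * h) / h) = sin h * cos (k * h) / sin (k * h)"
    by (auto simp: eventually_at_filter)
  ultimately show ?thesis by (rule Lim_transform_eventually)
qed

lemma middle_coeff_tendsto:
  assumes "k \<noteq> 0"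
  shows "(middle_coeff k \<gamma> \<longlongrightarrow> k + 1 - 2 * \<gamma> * k\<^sup>2) (at_right 0)"
proof -
  have "((\<lambda>\<theta>. k * (1 - 2 * \<gamma> * k) * cos \<theta> + k * (sin \<theta> * cos (k * \<theta>) / sin (k * \<theta>))) \<longlongrightarrow>
      k * (1 - 2 * \<gamma> * k) * cos 0 + k * (1 / k)) (at_right 0)"
    by (intro tendsto_intros sin_ratio_tendsto assms)
  then show ?thesis using assms unfolding middle_coeff_def[abs_def]
    by (simp add: algebra_simps power2_eq_square)
qed

lemma eventually_sin_pos:
  assumes "k > 0"
  shows "\<forall>\<^sub>F \<theta> in at_right 0. sin (k * \<theta>) > (0::real)"
proof -
  have "\<forall>\<^sub>F \<theta> in at_right 0. \<theta> \<in> {0<..<pi / k}"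
    using assms by (intro eventually_at_right_real) auto
  then show ?thesis
  proof eventually_elim
    case (elim \<theta>)
    then show ?case using assms by (intro sin_gt_zero) (auto simp: field_simps)
  qed
qed

lemma zero_closure_strip:
  assumes "\<epsilon> > 0" shows "0 \<in> closure {t. 0 < Re t \<and> 0 < Im t \<and> Im t < \<epsilon>}"
proof (rule closure_approachable[THEN iffD2], intro allI impI)
  fix e :: real assume e: "e > 0"
  define m where "m = min e \<epsilon> / 4"
  have m: "m > 0" "2 * m < e" "m < \<epsilon>" using e assms by (auto simp: m_def)
  have "cmod (Complex m m) \<le> m + m" using cmod_le[of "Complex m m"] m by simp
  then show "\<exists>y\<in>{t. 0 < Re t \<and> 0 < Im t \<and> Im t < \<epsilon>}. dist y 0 < e"
    using m by (intro bexI[of _ "Complex m m"]) (auto simp: dist_norm)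
qed

lemma horizontal_strip:
  assumes "\<epsilon> > 0"
  shows "open {t. 0 < Im t \<and> Im t < \<epsilon>}" "connected {t. 0 < Im t \<and> Im t < \<epsilon>}"
    "0 \<in> closure {t. 0 < Im t \<and> Im t < \<epsilon>}"
proof -
  have eq: "{t. 0 < Im t \<and> Im t < \<epsilon>} = {t. Im t > 0} \<inter> {t. Im t < \<epsilon>}" by auto
  show "open {t. 0 < Im t \<and> Im t < \<epsilon>}" unfolding eq
    by (intro open_Int open_halfspace_Im_gt open_halfspace_Im_lt)
  show "connected {t. 0 < Im t \<and> Im t < \<epsilon>}" unfolding eq
    by (intro convex_connected convex_Int convex_halfspace_Im_gt convex_halfspace_Im_lt)
  show "0 \<in> closure {t. 0 < Im t \<and> Im t < \<epsilon>}"
    using zero_closure_strip[OF assms] closure_mono[of "{t. 0 < Re t \<and> 0 < Im t \<and> Im t < \<epsilon>}" "{t. 0 < Im t \<and> Im t < \<epsilon>}"]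
    by auto
qed

lemma quadratic_pos:
  fixes a b c x :: real
  assumes "a > 0" "b\<^sup>2 < 4 * a * c"
  shows "a * x\<^sup>2 + b * x + c > 0"
proof -
  have "4 * a * (a * x\<^sup>2 + b * x + c) = (2 * a * x + b)\<^sup>2 + (4 * a * c - b\<^sup>2)"
    by (simp add: power2_eq_square algebra_simps)
  also have "\<dots> > 0" using assms(2) by (simp add: add_nonneg_pos)
  finally show ?thesis using assms(1) by (simp add: zero_less_mult_iff)
qed

lemma exp_minus_Suc_tendsto: "(\<lambda>n. exp (- real (Suc n))) \<longlonglongrightarrow> 0"
proof -
  have "exp (- real (Suc n)) = exp (- 1) ^ Suc n" for n
    using exp_of_nat_mult[of "Suc n" "- 1 :: real"] by simp
  moreover have "(\<lambda>n. exp (- 1 :: real) ^ Suc n) \<longlonglongrightarrow> 0"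
    by (rule LIMSEQ_Suc[OF LIMSEQ_realpow_zero]) auto
  ultimately show ?thesis by simp
qed

text \<open>
  At \<open>\<theta> = 0\<close> the discriminant of the quadratic polynomial is \<open>(k + 1)\<^sup>2 - 4\<gamma>k\<^sup>2 < 0\<close>. It remains negative for small \<open>\<theta>\<close>, so
  \<open>Im G > 0\<close> in a thin horizontal strip. As \<open>Re t \<rightarrow> -\<infinity>\<close> in the strip, \<open>z \<rightarrow> -k\<close> and \<open>G \<rightarrow> 0\<close>.
\<close>

lemma obstructed_complex_critical:
  assumes k: "k > 0" and g: "\<gamma> > 1 / 4 * (1 + 1 / k)\<^sup>2"
  shows "obstructed k \<gamma>"
proof -
  have gk: "4 * \<gamma> * k\<^sup>2 > (k + 1)\<^sup>2"
  proof -
    have "(k + 1)\<^sup>2 = k\<^sup>2 * (1 + 1 / k)\<^sup>2" using k by (simp add: field_simps power2_eq_square)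
    also have "\<dots> < k\<^sup>2 * (4 * \<gamma>)" using g k by (intro mult_strict_left_mono) auto
    finally show ?thesis by (simp add: mult_ac)
  qed
  have "(k + 1)\<^sup>2 = 4 * k + (k - 1)\<^sup>2" by (simp add: power2_eq_square algebra_simps)
  then have "4 * k \<le> (k + 1)\<^sup>2" by simp
  then have "4 * k < 4 * \<gamma> * k\<^sup>2" using gk by linarith
  then have "k * 1 < k * (\<gamma> * k)" by (simp add: power2_eq_square mult_ac)
  then have gk1: "\<gamma> * k > 1" using k by (simp add: mult_less_cancel_left_pos)
  have g0: "\<gamma> > 0" using g by (smt (verit) zero_le_power2 mult_nonneg_nonneg divide_nonneg_nonneg)
  have "((\<lambda>\<theta>. 4 * (\<gamma> * k\<^sup>2) * (k * (\<gamma> * k - 1)) - (middle_coeff k \<gamma> \<theta>)\<^sup>2) \<longlongrightarrow>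
      4 * (\<gamma> * k\<^sup>2) * (k * (\<gamma> * k - 1)) - (k + 1 - 2 * \<gamma> * k\<^sup>2)\<^sup>2) (at_right 0)"
    using k by (intro tendsto_intros middle_coeff_tendsto) auto
  moreover have "4 * (\<gamma> * k\<^sup>2) * (k * (\<gamma> * k - 1)) - (k + 1 - 2 * \<gamma> * k\<^sup>2)\<^sup>2 = 4 * \<gamma> * k\<^sup>2 - (k + 1)\<^sup>2"
    by (simp add: power2_eq_square algebra_simps)
  ultimately have "\<forall>\<^sub>F \<theta> in at_right 0. 4 * (\<gamma> * k\<^sup>2) * (k * (\<gamma> * k - 1)) - (middle_coeff k \<gamma> \<theta>)\<^sup>2 > 0"
    using gk by (intro order_tendstoD(1)) auto
  with eventually_sin_pos[OF k]
  have "\<forall>\<^sub>F \<theta> in at_right 0. sin (k * \<theta>) > 0 \<and> (middle_coeff k \<gamma> \<theta>)\<^sup>2 < 4 * (\<gamma> * k\<^sup>2) * (k * (\<gamma> * k - 1))"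
    by eventually_elim simp
  then obtain \<epsilon> where \<epsilon>: "\<epsilon> > 0" "\<And>\<theta>. 0 < \<theta> \<Longrightarrow> \<theta> < \<epsilon> \<Longrightarrow>
      sin (k * \<theta>) > 0 \<and> (middle_coeff k \<gamma> \<theta>)\<^sup>2 < 4 * (\<gamma> * k\<^sup>2) * (k * (\<gamma> * k - 1))"
    unfolding eventually_at_right_field by auto
  define N where "N = {t. 0 < Im t \<and> Im t < \<epsilon>}"
  define t where "t n = Complex (- real (Suc n)) (\<epsilon> / 2)" for n
  have e0: "(\<lambda>n. exp (t n)) \<longlonglongrightarrow> 0"
  proof (rule tendsto_norm_zero_cancel)
    show "(\<lambda>n. cmod (exp (t n))) \<longlonglongrightarrow> 0" using exp_minus_Suc_tendsto by (simp add: t_def)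
  qed
  have ek: "(\<lambda>n. exp (of_real k * t n)) \<longlonglongrightarrow> 0"
  proof (rule tendsto_norm_zero_cancel)
    have "(\<lambda>n. (cmod (exp (t n))) powr k) \<longlonglongrightarrow> 0"
      using k by (intro powr_tendsto_0_at_0 tendsto_norm_zero e0) auto
    then show "(\<lambda>n. cmod (exp (of_real k * t n))) \<longlonglongrightarrow> 0" by (simp add: powr_def)
  qed
  have Zl: "(\<lambda>n. z_of_log k (t n)) \<longlonglongrightarrow> of_real k * (0 - 1)"
    unfolding z_of_log_def by (intro tendsto_intros e0)
  have eq: "1 + of_real \<gamma> * (of_real k * (0 - 1)) = complex_of_real (1 - \<gamma> * k)" by simp
  have nz: "1 + of_real \<gamma> * (of_real k * (0 - 1)) \<noteq> (0::complex)"
    unfolding eq of_real_eq_0_iff using gk1 by simp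
  have "(\<lambda>n. tsallis_of_log k \<gamma> (t n)) \<longlonglongrightarrow> of_real k * (0 - 1) / (1 + of_real \<gamma> * (of_real k * (0 - 1))) * 0"
    unfolding tsallis_of_log_def by (intro tendsto_intros Zl ek nz)
  then have G0: "(\<lambda>n. tsallis_of_log k \<gamma> (t n)) \<longlonglongrightarrow> 0" by simp
  show ?thesis unfolding obstructed_def
  proof (intro exI[of _ N] conjI ballI disjI2 exI[of _ t] allI G0)
    show "open N" "connected N" "0 \<in> closure N" unfolding N_def using horizontal_strip[OF \<epsilon>(1)] by auto
    show "t n \<in> N" "\<bar>Re (t n)\<bar> \<ge> 1" for n using \<epsilon>(1) by (auto simp: N_def t_def)
    fix v assume "v \<in> N"
    then have v: "sin (k * Im v) > 0" "(middle_coeff k \<gamma> (Im v))\<^sup>2 < 4 * (\<gamma> * k\<^sup>2) * (k * (\<gamma> * k - 1))"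
      using \<epsilon>(2) by (auto simp: N_def)
    have "\<gamma> * k\<^sup>2 * (exp (Re v))\<^sup>2 + middle_coeff k \<gamma> (Im v) * exp (Re v) + k * (\<gamma> * k - 1) > 0"
      by (rule quadratic_pos[OF _ v(2)]) (use g0 k in simp)
    from Im_tsallis_of_log_pos[OF v(1) this] show "Im (tsallis_of_log k \<gamma> v) > 0" by simp
  qed
qed

lemma tsallis_of_log_has_derivative:
  assumes "1 + of_real \<gamma> * z_of_log k t \<noteq> 0"
  shows "(tsallis_of_log k \<gamma> has_field_derivative
     of_real k * exp (of_real k * t) * (exp t + z_of_log k t + of_real \<gamma> * (z_of_log k t)\<^sup>2) / (1 + of_real \<gamma> * z_of_log k t)\<^sup>2) (at t)"
proof -
  have gen: "((a * e * (1 + g * z) - z * (g * (a * e))) / (1 + g * z)\<^sup>2) * E + z / (1 + g * z) * (E * a)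
      = a * E * (e + z + g * z\<^sup>2) / (1 + g * z)\<^sup>2" if "1 + g * z \<noteq> 0" for a e g z E :: complex
    using that by (simp add: divide_simps power2_eq_square) (simp add: algebra_simps)
  have dZ: "(z_of_log k has_field_derivative of_real k * exp t) (at t)"
    unfolding z_of_log_def by (auto intro!: derivative_eq_intros)
  have d1: "((\<lambda>t. 1 + of_real \<gamma> * z_of_log k t) has_field_derivative of_real \<gamma> * (of_real k * exp t)) (at t)"
    by (auto intro!: derivative_eq_intros dZ)
  have dq: "((\<lambda>t. z_of_log k t / (1 + of_real \<gamma> * z_of_log k t)) has_field_derivative
     ((of_real k * exp t) * (1 + of_real \<gamma> * z_of_log k t) - z_of_log k t * (of_real \<gamma> * (of_real k * exp t))) / (1 + of_real \<gamma> * z_of_log k t)\<^sup>2) (at t)"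
    using DERIV_divide[OF dZ d1 assms] by (simp add: power2_eq_square)
  have dE: "((\<lambda>t. exp (of_real k * t)) has_field_derivative exp (of_real k * t) * of_real k) (at t)"
    by (auto intro!: derivative_eq_intros)
  show ?thesis
    unfolding tsallis_of_log_def using DERIV_mult'[OF dq dE] gen[OF assms, of "of_real k" "exp t" "exp (of_real k * t)"]
    by (simp add: add.commute)
qed

text \<open>
  On the line \<open>Im t = \<pi>\<close>, which is the upper side of the cut \<open>z < -k\<close>, the value \<open>G\<close> has argument \<open>k\<pi> \<in> (0, \<pi>)\<close>
  wherever \<open>z/(1 + \<gamma>z) > 0\<close>. The smaller zero \<open>z1\<close> of the critical polynomial lies there. For \<open>r\<close> large, \<open>Im G > 0\<close> on all
  rays of the closed upper half-plane, since the leading coefficient \<open>\<gamma>k\<^sup>2\<close> is positive. So the critical point is reached from \<open>0\<close>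
  by moving out just above the real axis, turning to the cut, and moving in along it.
\<close>

lemma obstructed_cut:
  assumes k: "0 < k" "k < 1" and g: "0 < \<gamma>" "\<gamma> \<le> 1 / 4 * (1 + 1 / k)\<^sup>2"
  shows "obstructed k \<gamma>"
proof -
  define \<beta> where "\<beta> = 1 + 1 / k"
  have \<beta>: "\<beta> > 2" "k * \<beta> = k + 1" using k by (auto simp: \<beta>_def field_simps)
  define D where "D = \<beta>\<^sup>2 - 4 * \<gamma>"
  have D: "D \<ge> 0" using g(2) by (simp add: D_def \<beta>_def)
  define z1 where "z1 = (- \<beta> - sqrt D) / (2 * \<gamma>)"
  have z1g: "2 * \<gamma> * z1 = - \<beta> - sqrt D" using g by (simp add: z1_def)
  have root: "\<gamma> * z1\<^sup>2 + \<beta> * z1 + 1 = 0"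
  proof -
    have "4 * \<gamma> * (\<gamma> * z1\<^sup>2 + \<beta> * z1 + 1) = (2 * \<gamma> * z1 + \<beta>)\<^sup>2 - D"
      by (simp add: D_def power2_eq_square algebra_simps)
    also have "\<dots> = 0" unfolding z1g using D by simp
    finally show ?thesis using g by simp
  qed
  \<comment> \<open>The next two facts put \<open>z1\<close> to the left of the pole \<open>-1/\<gamma>\<close> and of the branch point \<open>-k\<close>.\<close>
  have zg: "\<gamma> * z1 < -1"
  proof -
    have "sqrt D \<ge> 0" using D by simp
    then show ?thesis using z1g \<beta>(1) by linarith
  qed
  have zk: "z1 < - k"
  proof -
    have "sqrt D > 2 * \<gamma> * k - \<beta>"
    proof (cases "\<gamma> * k < 1")
      case True
      show ?thesis
      proof (cases "2 * \<gamma> * k - \<beta> < 0")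
        case True then show ?thesis using real_sqrt_ge_zero[OF D] by linarith
      next
        case False
        have "D - (2 * \<gamma> * k - \<beta>)\<^sup>2 = 4 * \<gamma> * (k * \<beta> - 1 - \<gamma> * k * k)"
          by (simp add: D_def power2_eq_square algebra_simps)
        also have "\<dots> = 4 * \<gamma> * (k * (1 - \<gamma> * k))" unfolding \<beta>(2) by (simp add: algebra_simps)
        also have "\<dots> > 0" using True g k by simp
        finally have "(2 * \<gamma> * k - \<beta>)\<^sup>2 < D" by simp
        then show ?thesis by (rule real_less_rsqrt)
      qed
    next
      case False
      have "4 * (\<gamma> * k) \<le> \<beta>\<^sup>2 * k" using g(2) k by (simp add: \<beta>_def)
      also have "\<beta>\<^sup>2 * k = \<beta> * (k + 1)" using \<beta>(2) by (simp add: power2_eq_square mult_ac)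
      also have "\<dots> < \<beta> * 2" using \<beta>(1) k by (intro mult_strict_left_mono) auto
      finally show ?thesis using real_sqrt_ge_zero[OF D] by linarith
    qed
    then have "2 * \<gamma> * z1 < 2 * \<gamma> * (- k)" using z1g by simp
    then have "\<gamma> * (z1 + k) < 0" by (simp add: algebra_simps)
    then show ?thesis using g(1) by (simp add: mult_less_0_iff)
  qed
  define r1 where "r1 = - z1 / k - 1"
  have r1: "r1 > 0" using zk k by (simp add: r1_def field_simps)
  have zr: "z1 = - k * (r1 + 1)" using k by (simp add: r1_def field_simps)
  \<comment> \<open>The point of the cut with logarithmic coordinate \<open>t1\<close> is \<open>z1\<close>.\<close>
  define s1 where "s1 = ln r1"
  have s1: "exp s1 = r1" using r1 by (simp add: s1_def)
  define t1 where "t1 = Complex s1 pi"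
  have et1: "exp t1 = - of_real r1"
    by (simp add: t1_def complex_eq_iff Re_exp Im_exp s1)
  have Zt1: "z_of_log k t1 = of_real z1" unfolding z_of_log_def et1 zr by (simp add: algebra_simps)
  have half: "2 * \<gamma> * k\<^sup>2 + (k + 1 - 2 * \<gamma> * k\<^sup>2) > k" by simp
  have "((\<lambda>\<theta>. 2 * \<gamma> * k\<^sup>2 + middle_coeff k \<gamma> \<theta>) \<longlongrightarrow> 2 * \<gamma> * k\<^sup>2 + (k + 1 - 2 * \<gamma> * k\<^sup>2)) (at_right 0)"
    using k by (intro tendsto_intros middle_coeff_tendsto) auto
  from order_tendstoD(1)[OF this half]
  have "\<forall>\<^sub>F \<theta> in at_right 0. 2 * \<gamma> * k\<^sup>2 + middle_coeff k \<gamma> \<theta> > k" .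
  then obtain e0 where e0: "e0 > 0" "\<And>\<theta>. 0 < \<theta> \<Longrightarrow> \<theta> < e0 \<Longrightarrow> 2 * \<gamma> * k\<^sup>2 + middle_coeff k \<gamma> \<theta> > k"
    unfolding eventually_at_right_field by auto
  \<comment> \<open>For \<open>r = 1 + h\<close> the polynomial has only positive coefficients in \<open>h\<close> if \<open>2\<gamma>k\<^sup>2 + b(\<theta>) > k\<close>;
    at \<open>\<theta> = 0\<close> this reads \<open>k + 1 > k\<close>.\<close>
  define \<epsilon> where "\<epsilon> = min e0 pi"
  have \<epsilon>: "\<epsilon> > 0" "\<epsilon> \<le> pi" "\<epsilon> \<le> e0" using e0 by (auto simp: \<epsilon>_def)
  have sinpos: "sin (k * \<theta>) > 0" if "0 < \<theta>" "\<theta> \<le> pi" for \<theta>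
  proof (rule sin_gt_zero)
    have "k * \<theta> \<le> k * pi" using that k by (intro mult_left_mono) auto
    also have "k * pi < pi" using k by simp
    finally show "k * \<theta> < pi" .
  qed (use that k in simp)
  define M where "M = {t. Im (tsallis_of_log k \<gamma> t) > 0}"
  define Q where "Q = {t. 0 < Re t \<and> 0 < Im t \<and> Im t < \<epsilon>}"
  have QM: "Q \<subseteq> M"
  proof
    fix t assume t: "t \<in> Q"
    define h where "h = exp (Re t) - 1"
    define b where "b = middle_coeff k \<gamma> (Im t)"
    have h: "h > 0" "exp (Re t) = 1 + h" using t by (auto simp: h_def Q_def)
    have b: "2 * \<gamma> * k\<^sup>2 + b > k" using e0(2)[of "Im t"] t \<epsilon>(3) by (auto simp: Q_def b_def)
    have "\<gamma> * k\<^sup>2 * (1 + h)\<^sup>2 + b * (1 + h) + k * (\<gamma> * k - 1) =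
        (2 * \<gamma> * k\<^sup>2 + b - k) + h * (2 * \<gamma> * k\<^sup>2 + b) + \<gamma> * k\<^sup>2 * h\<^sup>2"
      by (simp add: power2_eq_square algebra_simps)
    also have "\<dots> > 0"
    proof -
      have "h * (2 * \<gamma> * k\<^sup>2 + b) > 0" using b h(1) k(1) by (intro mult_pos_pos) linarith+
      moreover have "\<gamma> * k\<^sup>2 * h\<^sup>2 \<ge> 0" using g(1) by simp
      ultimately show ?thesis using b by linarith
    qed
    finally have "Im (tsallis_of_log k \<gamma> (Complex (Re t) (Im t))) > 0"
      using t \<epsilon> by (intro Im_tsallis_of_log_pos sinpos) (auto simp: Q_def h b_def)
    then show "t \<in> M" by (simp add: M_def)
  qed
  \<comment> \<open>On the compact range of angles between the two sides, the linear coefficient is bounded, and the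
    leading term dominates for \<open>r = R\<close>.\<close>
  have "continuous_on {\<epsilon>/2..pi} (middle_coeff k \<gamma>)"
    unfolding middle_coeff_def using sinpos \<epsilon>
    by (intro continuous_intros) (metis atLeastAtMost_iff half_gt_zero less_le_trans less_numeral_extra(3))
  then have "bounded (middle_coeff k \<gamma> ` {\<epsilon>/2..pi})"
    by (intro compact_imp_bounded compact_continuous_image) auto
  then obtain B where B: "B > 0" "\<And>\<theta>. \<epsilon>/2 \<le> \<theta> \<Longrightarrow> \<theta> \<le> pi \<Longrightarrow> \<bar>middle_coeff k \<gamma> \<theta>\<bar> \<le> B"
    unfolding bounded_pos by auto
  define R where "R = max (max 1 r1) ((B + k) / (\<gamma> * k\<^sup>2)) + 1"
  have R: "R > 1" "R > r1" "R \<ge> (B + k) / (\<gamma> * k\<^sup>2)" by (auto simp: R_def)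
  define s0 where "s0 = ln R"
  have s0: "exp s0 = R" "s0 > 0" "s0 > s1" using R r1 by (auto simp: s0_def s1_def)
  have far: "Complex s0 \<theta> \<in> M" if th: "\<epsilon>/2 \<le> \<theta>" "\<theta> \<le> pi" for \<theta>
  proof -
    have "\<gamma> * k\<^sup>2 * R \<ge> B + k" using R(3) k g by (simp add: field_simps)
    then have "\<gamma> * k\<^sup>2 * R * R \<ge> (B + k) * R" using R(1) by (intro mult_right_mono) auto
    moreover have "middle_coeff k \<gamma> \<theta> * R \<ge> - B * R" using B(2)[OF th] R(1) by (intro mult_right_mono) auto
    moreover have "k * R > k" using k R(1) by simp
    moreover have "\<gamma> * k * k > 0" using g k by simp
    ultimately have "\<gamma> * k\<^sup>2 * R\<^sup>2 + middle_coeff k \<gamma> \<theta> * R + k * (\<gamma> * k - 1) > 0"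
      by (simp add: power2_eq_square algebra_simps)
    then show ?thesis
      using th \<epsilon> unfolding M_def by (auto intro!: Im_tsallis_of_log_pos sinpos simp: s0(1))
  qed
  \<comment> \<open>At \<open>\<theta> = \<pi>\<close> the polynomial is \<open>z(1 + \<gamma>z)\<close> with \<open>z = -k(r + 1)\<close>.\<close>
  have cut: "Complex s pi \<in> M" if s: "s1 \<le> s" for s
  proof -
    define r where "r = exp s"
    have r: "r \<ge> r1" using s s1 by (metis exp_le_cancel_iff r_def)
    have "1 < \<gamma> * k * (r1 + 1)" using zg unfolding zr by (simp add: algebra_simps)
    also have "\<dots> \<le> \<gamma> * k * (r + 1)" using r g k by (intro mult_left_mono) auto
    finally have 1: "\<gamma> * k * (r + 1) - 1 > 0" by simp
    have "\<gamma> * k\<^sup>2 * r\<^sup>2 + middle_coeff k \<gamma> pi * r + k * (\<gamma> * k - 1) = k * (r + 1) * (\<gamma> * k * (r + 1) - 1)"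
      by (simp add: middle_coeff_def power2_eq_square algebra_simps)
    also have "\<dots> > 0" using 1 k r r1 by (intro mult_pos_pos) auto
    finally show ?thesis unfolding M_def r_def by (auto intro!: Im_tsallis_of_log_pos sinpos)
  qed
  have nzM: "1 + of_real \<gamma> * z_of_log k t \<noteq> 0" if "t \<in> M" for t using that tsallis_of_log_pole by (simp add: M_def)
  have "open M"
  proof -
    let ?A = "{t. 1 + of_real \<gamma> * z_of_log k t \<noteq> 0}"
    have "continuous_on UNIV (\<lambda>t. 1 + of_real \<gamma> * z_of_log k t)" unfolding z_of_log_def by (intro continuous_intros)
    then have "open ?A" by (intro open_Collect_neq) auto
    moreover have "continuous_on ?A (\<lambda>t. Im (tsallis_of_log k \<gamma> t))"
      by (intro continuous_intros holomorphic_on_imp_continuous_on tsallis_of_log_holomorphic) auto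
    ultimately have "open (?A \<inter> (\<lambda>t. Im (tsallis_of_log k \<gamma> t)) -` {0<..})"
      by (intro continuous_open_preimage) auto
    moreover have "M = ?A \<inter> (\<lambda>t. Im (tsallis_of_log k \<gamma> t)) -` {0<..}" using nzM by (auto simp: M_def)
    ultimately show ?thesis by simp
  qed
  define a where "a = Complex s0 (\<epsilon> / 2)"
  define N where "N = connected_component_set M a"
  have aQ: "a \<in> Q" using s0(2) \<epsilon>(1) by (simp add: a_def Q_def)
  have "connected Q"
  proof -
    have "Q = {t. Re t > 0} \<inter> ({t. Im t > 0} \<inter> {t. Im t < \<epsilon>})" by (auto simp: Q_def)
    then show ?thesis
      by (simp add: convex_connected convex_Int convex_halfspace_Im_gt convex_halfspace_Im_lt convex_halfspace_Re_gt)
  qed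
  then have QN: "Q \<subseteq> N" unfolding N_def using aQ QM by (intro connected_component_maximal)
  have "connected_component M a (Complex s0 pi)"
    unfolding connected_component_def
  proof (intro exI[of _ "closed_segment a (Complex s0 pi)"] conjI)
    show "closed_segment a (Complex s0 pi) \<subseteq> M"
    proof
      fix t assume "t \<in> closed_segment a (Complex s0 pi)"
      then obtain u where u: "0 \<le> u" "u \<le> 1" "t = (1 - u) *\<^sub>R a + u *\<^sub>R Complex s0 pi"
        by (auto simp: in_segment)
      have "t = Complex s0 (Im t)" unfolding u(3) a_def by (simp add: complex_eq_iff algebra_simps)
      moreover have "\<epsilon>/2 \<le> Im t" "Im t \<le> pi"
      proof -
        have I: "Im t = \<epsilon>/2 + u * (pi - \<epsilon>/2)" unfolding u(3) a_def by (simp add: algebra_simps)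
        have "0 \<le> u * (pi - \<epsilon>/2)" "u * (pi - \<epsilon>/2) \<le> 1 * (pi - \<epsilon>/2)"
          using u \<epsilon> by (auto intro!: mult_nonneg_nonneg mult_right_mono)
        then show "\<epsilon>/2 \<le> Im t" "Im t \<le> pi" using I by auto
      qed
      ultimately show "t \<in> M" using far by metis
    qed
  qed auto
  moreover have "connected_component M (Complex s0 pi) t1"
    unfolding connected_component_def
  proof (intro exI[of _ "closed_segment (Complex s0 pi) t1"] conjI)
    show "closed_segment (Complex s0 pi) t1 \<subseteq> M"
    proof
      fix t assume "t \<in> closed_segment (Complex s0 pi) t1"
      then obtain u where u: "0 \<le> u" "u \<le> 1" "t = (1 - u) *\<^sub>R Complex s0 pi + u *\<^sub>R t1"
        by (auto simp: in_segment)
      have "t = Complex (Re t) pi" unfolding u(3) t1_def by (simp add: complex_eq_iff algebra_simps)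
      moreover have "Re t = s1 + (1 - u) * (s0 - s1)" unfolding u(3) t1_def by (simp add: algebra_simps)
      then have "s1 \<le> Re t" using u s0(3) by simp
      ultimately show "t \<in> M" using cut by metis
    qed
  qed auto
  ultimately have t1N: "t1 \<in> N" unfolding N_def using connected_component_trans by blast
  have "deriv (tsallis_of_log k \<gamma>) t1 = 0"
  proof -
    have "t1 \<in> M" using cut[of s1] by (simp add: t1_def)
    from tsallis_of_log_has_derivative[OF nzM[OF this]]
    have "deriv (tsallis_of_log k \<gamma>) t1 = of_real k * exp (of_real k * t1) * (exp t1 + z_of_log k t1 + of_real \<gamma> * (z_of_log k t1)\<^sup>2) / (1 + of_real \<gamma> * z_of_log k t1)\<^sup>2"
      by (rule DERIV_imp_deriv)
    moreover have "exp t1 + z_of_log k t1 + of_real \<gamma> * (z_of_log k t1)\<^sup>2 = 0"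
    proof -
      have "exp t1 + z_of_log k t1 + of_real \<gamma> * (z_of_log k t1)\<^sup>2 = of_real (- r1 + z1 + \<gamma> * z1\<^sup>2)"
        unfolding et1 Zt1 by simp
      also have "- r1 + z1 + \<gamma> * z1\<^sup>2 = \<gamma> * z1\<^sup>2 + \<beta> * z1 + 1"
        using k by (simp add: r1_def \<beta>_def field_simps)
      finally show ?thesis unfolding root by simp
    qed
    ultimately show ?thesis by simp
  qed
  then show ?thesis unfolding obstructed_def
  proof (intro exI[of _ N] conjI ballI disjI1)
    show "open N" unfolding N_def using \<open>open M\<close> by (rule open_connected_component)
    show "connected N" unfolding N_def by simp
    show "0 \<in> closure N" using zero_closure_strip[OF \<epsilon>(1)] closure_mono[OF QN] unfolding Q_def by blast
    show "Im (tsallis_of_log k \<gamma> t) > 0" if "t \<in> N" for t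
      using that connected_component_subset unfolding N_def M_def by blast
    show "\<exists>t\<in>N. deriv (tsallis_of_log k \<gamma>) t = 0" using t1N \<open>deriv (tsallis_of_log k \<gamma>) t1 = 0\<close> by blast
  qed
qed

text \<open>
  The analogue of \<open>obstructed_complex_critical\<close>, with \<open>z\<close> itself as coordinate: as \<open>y \<rightarrow> 0\<close>, the discriminant of
  \<open>\<gamma>x\<^sup>2 + x + y cot y\<close> tends to \<open>1 - 4\<gamma> < 0\<close>, and \<open>f \<rightarrow> 0\<close> as \<open>x \<rightarrow> -\<infinity>\<close>.
\<close>

lemma no_main_branch_infinity:
  assumes g: "\<gamma> > 1 / 4"
  shows "\<not> main_branch \<infinity> \<gamma> W"
proof
  assume W: "main_branch \<infinity> \<gamma> W"
  have \<kappa>: "(\<infinity>::ereal) \<noteq> 0" "(\<infinity>::ereal) \<noteq> -\<infinity>" by auto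
  have "((\<lambda>y. 4 * \<gamma> * (y * (cos y / sin y))) \<longlongrightarrow> 4 * \<gamma> * 1) (at_right 0)"
  proof (intro tendsto_intros)
    have "((\<lambda>h. sin h / h) \<longlongrightarrow> (1::real)) (at 0)"
      using DERIV_sin[of "0::real"] unfolding DERIV_def by simp
    then have 1: "((\<lambda>h. sin h / h) \<longlongrightarrow> (1::real)) (at_right 0)" by (simp add: filterlim_at_split)
    have "((\<lambda>y. cos y / (sin y / y)) \<longlongrightarrow> cos 0 / 1) (at_right (0::real))"
      by (intro tendsto_intros 1) auto
    then show "((\<lambda>y. y * (cos y / sin y)) \<longlongrightarrow> (1::real)) (at_right 0)" by (simp add: mult.commute)
  qed
  then have "\<forall>\<^sub>F y in at_right 0. 4 * \<gamma> * (y * (cos y / sin y)) > 1"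
    by (rule order_tendstoD(1)) (use g in simp)
  with eventually_sin_pos[OF zero_less_one]
  have "\<forall>\<^sub>F y in at_right 0. sin y > 0 \<and> 1 < 4 * \<gamma> * (y * (cos y / sin y))" by eventually_elim simp
  then obtain \<epsilon> where \<epsilon>: "\<epsilon> > 0" "\<And>y. 0 < y \<Longrightarrow> y < \<epsilon> \<Longrightarrow> sin y > 0 \<and> 1 < 4 * \<gamma> * (y * (cos y / sin y))"
    unfolding eventually_at_right_field by auto
  define N where "N = {t. 0 < Im t \<and> Im t < \<epsilon>}"
  have N: "open N" "connected N" "0 \<in> closure N" unfolding N_def using horizontal_strip[OF \<epsilon>(1)] by auto
  have pos: "Im (tsallis \<infinity> \<gamma> t) > 0" if t: "t \<in> N" for t
  proof -
    define x where "x = Re t" 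
    define y where "y = Im t"
    have y: "sin y > 0" "1 < 4 * \<gamma> * (y * (cos y / sin y))" "y > 0"
      using \<epsilon>(2)[of y] t unfolding N_def y_def by blast+
    have d: "1 + of_real \<gamma> * t \<noteq> 0"
      using regular_nonreal[OF \<kappa>, of t \<gamma>] t by (auto simp: regular_at_def N_def)
    have "\<gamma> * x\<^sup>2 + 1 * x + y * (cos y / sin y) > 0" by (rule quadratic_pos) (use g y in auto)
    then have p: "\<gamma> * x\<^sup>2 + x + y * (cos y / sin y) + \<gamma> * y\<^sup>2 > 0" using g by (simp add: add_pos_nonneg)
    have "(cmod (1 + of_real \<gamma> * t))\<^sup>2 * Im (tsallis \<infinity> \<gamma> t) =
       exp x * sin y * (\<gamma> * x\<^sup>2 + x + y * (cos y / sin y) + \<gamma> * y\<^sup>2)"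
      using Im_tsallis[OF d, of \<infinity>] y(1) by (simp add: exp_kappa_def Re_exp Im_exp x_def y_def field_simps)
    also have "\<dots> > 0" using p y by simp
    finally show ?thesis using d by (metis zero_less_mult_pos zero_less_norm_iff zero_less_power)
  qed
  have hol: "tsallis \<infinity> \<gamma> holomorphic_on N"
    by (rule tsallis_holomorphic[OF \<kappa>], rule regular_nonreal[OF \<kappa>]) (auto simp: N_def)
  have posN: "\<forall>t\<in>N. Im (tsallis \<infinity> \<gamma> t) > 0" using pos by blast
  note WG = main_branch_along[OF \<kappa> W N holomorphic_on_ident refl hol posN always_eventually[OF allI[OF refl]]]
  define t where "t n = Complex (- real (Suc n)) (\<epsilon> / 2)" for n
  have tN: "t n \<in> N" for n using \<epsilon> by (simp add: N_def t_def)
  have inf: "filterlim t at_infinity sequentially"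
  proof (rule filterlim_norm_at_top_imp_at_infinity, rule filterlim_at_top_mono[OF filterlim_real_sequentially])
    show "\<forall>\<^sub>F n in sequentially. real n \<le> cmod (t n)"
    proof (intro always_eventually allI)
      fix n show "real n \<le> cmod (t n)" using abs_Re_le_cmod[of "t n"] by (simp add: t_def)
    qed
  qed
  have t0: "t n \<noteq> 0" for n using tN[of n] by (auto simp: N_def)
  have e0: "(\<lambda>n. exp (t n)) \<longlonglongrightarrow> 0"
  proof (rule tendsto_norm_zero_cancel)
    show "(\<lambda>n. cmod (exp (t n))) \<longlonglongrightarrow> 0" using exp_minus_Suc_tendsto by (simp add: t_def)
  qed
  have "(\<lambda>n. 1 / (inverse (t n) + of_real \<gamma>) * exp (t n)) \<longlonglongrightarrow> 1 / (0 + of_real \<gamma>) * 0"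
    using g by (intro tendsto_intros e0 filterlim_compose[OF tendsto_inverse_0 inf]) auto
  moreover have "1 / (inverse (t n) + of_real \<gamma>) * exp (t n) = tsallis \<infinity> \<gamma> (t n)" for n
  proof -
    have "inverse (t n) + of_real \<gamma> = (1 + of_real \<gamma> * t n) / t n" using t0[of n] by (simp add: field_simps)
    then show ?thesis by (simp add: tsallis_def exp_kappa_def)
  qed
  ultimately have "(\<lambda>n. tsallis \<infinity> \<gamma> (t n)) \<longlonglongrightarrow> 0" by simp
  from filterlim_compose[OF WG(3) this] have "t \<longlonglongrightarrow> 0" using WG(1)[OF tN] by simp
  then show False using inf not_tendsto_and_filterlim_at_infinity[of sequentially] by (metis sequentially_bot)
qed

text \<open>
  For \<open>k < 0\<close> the dual parameters are \<open>-k\<close> and \<open>\<gamma> - 1/k\<close>; the identity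
  \<open>(1 - 1/k)\<^sup>2/4 = (1 + 1/k)\<^sup>2/4 - 1/k\<close> matches the discriminant bounds.
\<close>

theorem main_branch_exists_only_if:
  assumes \<kappa>: "\<kappa> \<noteq> 0" "\<kappa> \<noteq> -\<infinity>" and ex: "main_branch_exists \<kappa> \<gamma>"
  shows "existence_condition \<kappa> \<gamma>"
proof (rule ccontr)
  assume nc: "\<not> existence_condition \<kappa> \<gamma>"
  obtain W where W: "main_branch \<kappa> \<gamma> W" using ex unfolding main_branch_exists_def by blast
  show False using \<kappa>
  proof (cases rule: ereal_cases_kappa)
    case 1
    then show False using nc no_main_branch_infinity[of \<gamma> W] W by (auto simp: existence_condition_def)
  next
    case (2 k)
    have pos: "obstructed k' \<gamma>'" if "k' > 0" "\<gamma>' > 1 / 4 * (1 + 1 / k')\<^sup>2 \<or> (k' < 1 \<and> \<gamma>' > 0)" for k' \<gamma>'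
      using that obstructed_complex_critical[of k' \<gamma>'] obstructed_cut[of k' \<gamma>'] by linarith
    have ob: "obstructed k \<gamma>"
    proof (cases "k > 0")
      case True
      then have "\<gamma> > 1 / 4 * (1 + 1 / k)\<^sup>2 \<or> (k < 1 \<and> \<gamma> > 0)"
        using nc 2 unfolding existence_condition_def by (cases "k < 1") (auto simp: one_ereal_def)
      then show ?thesis using pos True by blast
    next
      case False
      then have k: "- k > 0" using 2 by simp
      have m1: "- (1::ereal) = ereal (- 1)" by (simp add: one_ereal_def)
      define \<gamma>' where "\<gamma>' = \<gamma> - 1 / k"
      have d: "1 / 4 * (1 + 1 / (- k))\<^sup>2 = 1 / 4 * (1 + 1 / k)\<^sup>2 - 1 / k"
        using k by (simp add: power2_eq_square field_simps)
      have "\<gamma> > 1 / 4 * (1 + 1 / k)\<^sup>2 \<or> (- k < 1 \<and> \<gamma> > 1 / k)"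
        using nc 2 k unfolding existence_condition_def m1
        by (cases "-1 < k") auto
      then have "\<gamma>' > 1 / 4 * (1 + 1 / (- k))\<^sup>2 \<or> (- k < 1 \<and> \<gamma>' > 0)"
        unfolding d \<gamma>'_def by auto
      then have "obstructed (- k) \<gamma>'" using pos[OF k] by blast
      from obstructed_dual[OF _ this] k have "obstructed (- (- k)) (\<gamma>' - 1 / (- k))" by simp
      then show ?thesis by (simp add: \<gamma>'_def)
    qed
    show False using obstructed_no_main_branch[OF 2(2) ob] W 2 by simp
  qed
qed

theorem theorem1p2:
  fixes \<kappa> :: ereal and \<gamma> :: real
  assumes "\<kappa> \<noteq> 0" and "\<kappa> \<noteq> -\<infinity>"
  shows "main_branch_exists \<kappa> \<gamma> \<longleftrightarrow>
      (0 < \<kappa> \<and> \<kappa> < 1 \<and> \<gamma> \<le> 0)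
    \<or> (1 \<le> \<kappa> \<and> \<kappa> < \<infinity> \<and> \<gamma> \<le> 1 / 4 * (1 + 1 / real_of_ereal \<kappa>)\<^sup>2)
    \<or> (-1 < \<kappa> \<and> \<kappa> < 0 \<and> \<gamma> \<le> 1 / real_of_ereal \<kappa>)
    \<or> (\<kappa> \<le> -1 \<and> \<gamma> \<le> 1 / 4 * (1 + 1 / real_of_ereal \<kappa>)\<^sup>2)
    \<or> (\<kappa> = \<infinity> \<and> \<gamma> \<le> 1 / 4)"
  using main_branch_exists_if[OF assms] main_branch_exists_only_if[OF assms]
  unfolding existence_condition_def by blast

end
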